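(* Let $D$ be a rotationally invariant subdomain of $\Omega$ containing the origin $(0,0)$ and let $n\in\mathbb{Z}$. Suppose that $f \in \mathcal{H}(D)$ is an $n$-homogeneous solution of $\Delta_{zw}f=\lambda f$ for some $\lambda \in \mathbb{C}$ of the form $\lambda=4\mu(\mu-1)$ with $\operatorname{Re} \mu \ge 1/2$. Then there is a constant $c \in \mathbb{C}$ such that $$f(z,w)=c\, P_{-n}^{\mu}(z,w),\qquad (z,w) \in D \cap \Omega_*.$$ In particular, $f$ has a holomorphic extension to $D \cup \Omega_*$. Moreover, the following dichotomy holds: (NE) (Non-exceptional case) If $\lambda\neq 4m (m+1)$ for all $m \in \mathbb{N}_0$, then $\Omega_*$ is the maximal domain of existence of $f$. (E) (Exceptional case) If $\lambda=4m(m+1)$ for some $m \in \mathbb{N}_0$, then the maximal domain of existence of $f$ is $\Omega_+$ if $n<-m$; $\Omega_-$ if $n>m$; and $\Omega$ if $|n|\le m$.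
   Context: $\widehat{\mathbb{C}}=\mathbb{C}\cup\{\infty\}$, $\mathbb{D}$ is the open unit disk, $\mathbb{D}^2=\mathbb{D}\times\mathbb{D}$, $\mathbb{N}_0=\{0,1,2,\dots\}$. With the conventions $z\cdot\infty=\infty\cdot z=\infty$ for $z\in\widehat{\mathbb{C}}\setminus\{0\}$ and $0\cdot\infty=\infty\cdot 0=1$, put $\Omega=\{(z,w)\in\widehat{\mathbb{C}}^2: z\cdot w\neq 1\}$, an open complex submanifold of $\widehat{\mathbb{C}}^2$ with the standard chart on $\Omega\cap\mathbb{C}^2$ and the flip chart $(u,v)\mapsto(1/v,1/u)$ on $\Omega\cap(\widehat{\mathbb{C}}\setminus\{0\})^2$; the operator $\Delta_{zw}=4(1-zw)^2\partial_z\partial_w$ is given by this formula in both charts. Further, $\Omega_+=\Omega\setminus\{(z,\infty):z\in\widehat{\mathbb{C}}\}$, $\Omega_-=\Omega\setminus\{(\infty,w):w\in\widehat{\mathbb{C}}\}$, $\Omega_*=\{(z,w)\in\mathbb{C}^2: zw\in\mathbb{C}\setminus[1,\infty)\}$. $\mathcal{H}(D)$ is the space of holomorphic functions on $D$. A subdomain $D\subseteq\Omega$ is rotationally invariant if $(\eta z,w/\eta)\in D$ for all $(z,w)\in D$ and all $\eta\in\partial\mathbb{D}$. A function $f$ holomorphic on a domain containing $(0,0)$ is $n$-homogeneous if $f(\eta z,w/\eta)=\eta^n f(z,w)$ for all $\eta\in\partial\mathbb{D}$ and all $(z,w)$ in some (and hence every) bidisk $\{|z|<r,|w|<r\}$ contained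 in the domain. Maximal domain of existence: for $F\in\mathcal{H}(\mathbb{D}^2)$, a subdomain $D'\subseteq\Omega$ with $\mathbb{D}^2\subseteq D'$ is a maximal domain of existence of $F$ if $F$ has a holomorphic extension to $D'$ but to no strictly larger subdomain of $\Omega$. For $\mu\in\mathbb{C}$, $n\in\mathbb{Z}$, the $n$-th Poisson Fourier mode of order $\mu$ is $$P_n^\mu(z,w)=\frac{(1-zw)^{\mu}}{2\pi}\int_0^{2\pi}\frac{e^{-int}}{(1-ze^{-it})^\mu(1-we^{it})^\mu}\,dt,\qquad (z,w)\in\mathbb{D}^2,$$ with principal branches of the powers; it has a holomorphic extension to $\Omega_*$, again denoted $P^\mu_n$.
   Formalization: If λ is non-exceptional and D∩Ω_* is disconnected, f=cP is claimed only on the component of the origin and no extension to D∪Ω_* is claimed; the dichotomy assumes f is not identically 0 and concerns the function on 𝔻² that agrees with f near the origin. *)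

theory Defs
  imports "HOL-Analysis.Analysis"
begin

text \<open>The Riemann sphere is the one-point compactification of the plane; \<open>None\<close> is the
  point at infinity.\<close>

type_synonym csphere = "complex option"

definition sphere2_top :: "(csphere \<times> csphere) topology" where
  "sphere2_top = prod_topology (Alexandroff_compactification euclidean)
                               (Alexandroff_compactification euclidean)"

text \<open>Note the convention that zero times infinity equals one.\<close>

fun sph_mult :: "csphere \<Rightarrow> csphere \<Rightarrow> csphere" where
  "sph_mult (Some a) (Some b) = Some (a * b)"
| "sph_mult (Some a) None = (if a = 0 then Some 1 else None)"
| "sph_mult None (Some b) = (if b = 0 then Some 1 else None)"
| "sph_mult None None = None"

fun sph_inverse :: "csphere \<Rightarrow> csphere" where
  "sph_inverse (Some a) = (if a = 0 then None else Some (1 / a))"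
| "sph_inverse None = Some 0"

definition Omega :: "(csphere \<times> csphere) set" where
  "Omega = {(z, w). sph_mult z w \<noteq> Some 1}"

definition Omega_plus :: "(csphere \<times> csphere) set" where
  "Omega_plus = Omega - {(z, None) |z. True}"

definition Omega_minus :: "(csphere \<times> csphere) set" where
  "Omega_minus = Omega - {(None, w) |w. True}"

definition Omega_star :: "(csphere \<times> csphere) set" where
  "Omega_star = {(Some z, Some w) |z w. z * w \<notin> complex_of_real ` {1..}}"

definition sph_origin :: "csphere \<times> csphere" where
  "sph_origin = (Some 0, Some 0)"

definition bidisk :: "real \<Rightarrow> (csphere \<times> csphere) set" where
  "bidisk r = {(Some z, Some w) |z w. norm z < r \<and> norm w < r}"

definition subdomain :: "(csphere \<times> csphere) set \<Rightarrow> bool" where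
  "subdomain D \<longleftrightarrow> D \<subseteq> Omega \<and> D \<noteq> {} \<and> openin sphere2_top D \<and> connectedin sphere2_top D"

text \<open>Inverses of the standard chart and of the flip chart; the map
  \<open>(u, v) \<mapsto> (1/v, 1/u)\<close> is an involution.\<close>

definition std_param :: "complex \<times> complex \<Rightarrow> csphere \<times> csphere" where
  "std_param = (\<lambda>(u, v). (Some u, Some v))"

definition flip_param :: "complex \<times> complex \<Rightarrow> csphere \<times> csphere" where
  "flip_param = (\<lambda>(u, v). (sph_inverse (Some v), sph_inverse (Some u)))"

text \<open>Holomorphy in two variables: complex differentiability at every point. Both this and
  the next notion are only used on open sets.\<close>

definition holomorphic2_on :: "(complex \<times> complex \<Rightarrow> complex) \<Rightarrow> (complex \<times> complex) set \<Rightarrow> bool" where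
  "holomorphic2_on g U \<longleftrightarrow>
     (\<forall>p\<in>U. \<exists>a b. (g has_derivative (\<lambda>(h, k). a * h + b * k)) (at p))"

definition holomorphic_Omega :: "(csphere \<times> csphere \<Rightarrow> complex) \<Rightarrow> (csphere \<times> csphere) set \<Rightarrow> bool" where
  "holomorphic_Omega f D \<longleftrightarrow>
     holomorphic2_on (f \<circ> std_param) (std_param -` D) \<and>
     holomorphic2_on (f \<circ> flip_param) (flip_param -` D)"

text \<open>The coordinate expression of the invariant Laplacian, the same in both charts.\<close>

definition Delta_chart :: "(complex \<times> complex \<Rightarrow> complex) \<Rightarrow> complex \<times> complex \<Rightarrow> complex" where
  "Delta_chart g = (\<lambda>(z, w). 4 * (1 - z * w)\<^sup>2 * deriv (\<lambda>z'. deriv (\<lambda>w'. g (z', w')) w) z)"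

definition Delta_eigenfunction ::
    "complex \<Rightarrow> (csphere \<times> csphere \<Rightarrow> complex) \<Rightarrow> (csphere \<times> csphere) set \<Rightarrow> bool" where
  "Delta_eigenfunction lam f D \<longleftrightarrow>
     (\<forall>p \<in> std_param -` D. Delta_chart (f \<circ> std_param) p = lam * f (std_param p)) \<and>
     (\<forall>p \<in> flip_param -` D. Delta_chart (f \<circ> flip_param) p = lam * f (flip_param p))"

definition rotationally_invariant :: "(csphere \<times> csphere) set \<Rightarrow> bool" where
  "rotationally_invariant D \<longleftrightarrow>
     (\<forall>\<eta> z w. norm \<eta> = 1 \<longrightarrow> (z, w) \<in> D \<longrightarrow>
        (sph_mult (Some \<eta>) z, sph_mult w (Some (1 / \<eta>))) \<in> D)"

definition homogeneous :: "int \<Rightarrow> (csphere \<times> csphere \<Rightarrow> complex) \<Rightarrow> (csphere \<times> csphere) set \<Rightarrow> bool" where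
  "homogeneous n f D \<longleftrightarrow>
     (\<exists>r>0. bidisk r \<subseteq> D \<and>
        (\<forall>\<eta> z w. norm \<eta> = 1 \<longrightarrow> norm z < r \<longrightarrow> norm w < r \<longrightarrow>
           f (Some (\<eta> * z), Some (w / \<eta>)) = \<eta> powi n * f (Some z, Some w)))"

definition extends_holomorphically ::
    "(csphere \<times> csphere \<Rightarrow> complex) \<Rightarrow> (csphere \<times> csphere) set \<Rightarrow> (csphere \<times> csphere) set \<Rightarrow> bool" where
  "extends_holomorphically f A B \<longleftrightarrow> (\<exists>g. holomorphic_Omega g B \<and> (\<forall>p\<in>A. g p = f p))"

text \<open>Intended for functions that are holomorphic on the unit bidisk.\<close>

definition maximal_domain_of_existence ::
    "(csphere \<times> csphere \<Rightarrow> complex) \<Rightarrow> (csphere \<times> csphere) set \<Rightarrow> bool" where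
  "maximal_domain_of_existence F D \<longleftrightarrow>
     subdomain D \<and> bidisk 1 \<subseteq> D \<and> extends_holomorphically F (bidisk 1) D \<and>
     \<not> (\<exists>D'. subdomain D' \<and> D \<subset> D' \<and> extends_holomorphically F (bidisk 1) D')"

definition poisson_mode_bidisk :: "complex \<Rightarrow> int \<Rightarrow> complex \<Rightarrow> complex \<Rightarrow> complex" where
  "poisson_mode_bidisk \<mu> n z w =
     (1 - z * w) powr \<mu> / (2 * of_real pi) *
     integral {0..2*pi} (\<lambda>t. exp (- \<i> * of_int n * of_real t) /
       ((1 - z * exp (- \<i> * of_real t)) powr \<mu> * (1 - w * exp (\<i> * of_real t)) powr \<mu>))"

text \<open>The holomorphic extension of the Poisson Fourier mode. \<^const>\<open>Omega_star\<close> is connected,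
  so the values there are determined; the values elsewhere are irrelevant.\<close>

definition poisson_mode :: "complex \<Rightarrow> int \<Rightarrow> csphere \<times> csphere \<Rightarrow> complex" where
  "poisson_mode \<mu> n = (SOME P. holomorphic_Omega P Omega_star \<and>
     (\<forall>z w. norm z < 1 \<longrightarrow> norm w < 1 \<longrightarrow> P (Some z, Some w) = poisson_mode_bidisk \<mu> n z w))"

definition exceptional :: "complex \<Rightarrow> bool" where
  "exceptional lam \<longleftrightarrow> (\<exists>m::nat. lam = 4 * of_nat m * (of_nat m + 1))"

end

theory Submission
  imports Defs "HOL-Complex_Analysis.Complex_Analysis"
begin

text \<open>Homogeneity and the eigenvalue equation, with \<open>\<lambda> = 4 \<kappa>\<close>, force \<open>f\<close> near the origin to be a multiple of
  \<open>z\<^sup>n K (s)\<close> (or \<open>w\<^sup>-\<^sup>n K (s)\<close> if \<open>n < 0\<close>), where \<open>s = z w / (z w - 1)\<close> and \<open>K\<close> is the solution with \<open>K 0 = 1\<close> of the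
  hypergeometric equation with parameters \<open>\<mu>, 1 - \<mu>; |n| + 1\<close>. The inverse Koebe function turns the slit plane into
  the unit disc, where the Frobenius series converges; so \<open>K\<close> lives on the whole slit plane and the mode
  on \<open>\<Omega>\<^sub>*\<close>, and comparing Taylor coefficients identifies it with the Poisson mode.

  If the mode continued across a boundary point of \<open>\<Omega>\<^sub>*\<close>, then \<open>K\<close> would be holomorphic on an annulus around
  some circle \<open>|s| = s0 > 1\<close>. The equation gives a two-term recursion for its Laurent coefficients; outside the
  exceptional case it kills the negative ones, and the others would grow like a series of radius of
  convergence \<open>1\<close>, so that \<open>K = 0\<close>. In the exceptional case \<open>K\<close> is a polynomial of degree at most \<open>m\<close>, and its order of
  vanishing at \<open>s = 1\<close>, which is \<open>0\<close> or at least \<open>|n|\<close> according to \<open>|n| > m\<close> or \<open>|n| \<le> m\<close>, decides whether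
  the pole of \<open>z\<^sup>n\<close> or \<open>w\<^sup>-\<^sup>n\<close> at infinity cancels.\<close>

section \<open>Regular singular equations\<close>

text \<open>\<open>D\<close> is connected, but \<open>D \<inter> Omega_star\<close> need not be: for
  a thin strip U that runs from 0 across the cut x > 1, the set of all (z, w) with z w in U is an
  example. Continuation inside \<open>Omega_star\<close> reaches only the component of the origin;
  beyond the cut a non-exceptional f may be another branch. Hence the identity with the Poisson mode
  is proved on that component, and on all of \<open>D \<inter> Omega_star\<close> if it is connected
  or the case is exceptional. In the exceptional case the mode is rational and regular wherever z w
  differs from 1, so the identity can be carried along \<open>D\<close> itself, across the cut and
  through points at infinity.

  The variable s is adapted to the points at infinity: z w = infinity becomes the singular point s =
  1, with exponents 0 and |n|, while the forbidden value z w = 1 becomes s = infinity. The equation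
  in s sees \<mu> only through \<kappa> = \<mu> (\<mu> - 1). The condition on Re \<mu> ensures that
  the factor relating the Poisson mode to the normalised mode is nonzero.\<close>

fun frobenius_coeff :: "(nat \<Rightarrow> complex) \<Rightarrow> (nat \<Rightarrow> complex) \<Rightarrow> nat \<Rightarrow> nat \<Rightarrow> complex" where
  "frobenius_coeff a b N 0 = 1"
| "frobenius_coeff a b N (Suc k) =
     - (\<Sum>j\<le>k. (of_nat j * a (Suc k - j) + b (k - j)) * frobenius_coeff a b N j) /
     (of_nat (Suc k) * of_nat (Suc k + N))"

text \<open>In the recursion the value \<open>a 0\<close> = N + 1 sits in the denominator, where it
  adds (k + 1)(N + 1) to the (k + 1) k of the second derivative. With \<open>g k\<close> the modulus
  of the k-th coefficient times \<open>r ^ k\<close>, the bounds on \<open>a\<close> and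
  \<open>b\<close> give (k + 1)^2 g (k + 1) \<le> M S k; the weight j + 1 in \<open>S\<close> pays
  for the factor j of \<open>a\<close> and for the term with \<open>b\<close>. Hence S (k + 1) / S k
  tends to 1, and the majorant has radius of convergence 1 in |x| / r.\<close>

lemma frobenius_coeff_summable:
  fixes a b :: "nat \<Rightarrow> complex"
  assumes r: "r > 0" and a: "\<And>k. norm (a k) * r ^ k \<le> M" and b: "\<And>k. norm (b k) * r ^ Suc k \<le> M"
    and x: "norm x < r"
  shows "summable (\<lambda>k. frobenius_coeff a b N k * x ^ k)"
proof -
  define c where "c = frobenius_coeff a b N"
  define g where "g k = norm (c k) * r ^ k" for k
  define S where "S k = (\<Sum>j\<le>k. (real j + 1) * g j)" for k
  have M: "M \<ge> 0"
    using a[of 0] by (smt (verit, best) mult_nonneg_nonneg norm_ge_zero r zero_le_power less_imp_le)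
  have g0: "g k \<ge> 0" for k using r by (simp add: g_def)
  have S_Suc: "S (Suc k) = S k + (real k + 2) * g (Suc k)" for k
    by (simp add: S_def)
  have gb: "real (Suc k) ^ 2 * g (Suc k) \<le> M * S k" for k
  proof -
    have "norm (of_nat (Suc k) * of_nat (Suc k + N) * c (Suc k)) =
          norm (\<Sum>j\<le>k. (of_nat j * a (Suc k - j) + b (k - j)) * c j)"
      unfolding c_def by (simp del: of_nat_Suc of_nat_add add: norm_divide norm_mult)
    hence eq: "real (Suc k) * real (Suc k + N) * g (Suc k) =
          norm (\<Sum>j\<le>k. (of_nat j * a (Suc k - j) + b (k - j)) * c j) * r ^ Suc k"
      unfolding norm_mult norm_of_nat by (simp add: g_def)
    have t: "norm ((of_nat j * a (Suc k - j) + b (k - j)) * c j) * r ^ Suc k \<le> M * ((real j + 1) * g j)"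
      if "j \<le> k" for j
    proof -
      obtain i where i: "k = j + i" using \<open>j \<le> k\<close> le_Suc_ex by blast
      have ij: "Suc k - j = Suc i" "k - j = i" by (simp_all add: i)
      have "norm ((of_nat j * a (Suc k - j) + b (k - j)) * c j) * r ^ Suc k
          \<le> (real j * norm (a (Suc k - j)) + norm (b (k - j))) * norm (c j) * r ^ Suc k"
      proof -
        have "norm (of_nat j * a (Suc k - j) + b (k - j)) \<le> real j * norm (a (Suc k - j)) + norm (b (k - j))"
          using norm_triangle_ineq[of "of_nat j * a (Suc k - j)" "b (k - j)"] by (simp add: norm_mult)
        thus ?thesis unfolding norm_mult using r by (intro mult_right_mono) auto
      qed
      also have "\<dots> = (real j * (norm (a (Suc k - j)) * r ^ (Suc k - j)) + norm (b (k - j)) * r ^ Suc (k - j)) * g j"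
      proof -
        have ring: "(real j * x + y) * z * (p * q) = (real j * (x * p) + y * p) * (z * q)" for x y z p q :: real
          by (simp add: algebra_simps)
        have "r ^ Suc k = r ^ Suc i * r ^ j" by (simp add: i power_add)
        thus ?thesis unfolding g_def ring[symmetric] ij by simp
      qed
      also have "\<dots> \<le> (real j * M + M) * g j"
        by (intro mult_right_mono add_mono mult_left_mono a b g0) auto
      finally show ?thesis by (simp add: algebra_simps)
    qed
    have "real (Suc k) ^ 2 * g (Suc k) \<le> real (Suc k) * real (Suc k + N) * g (Suc k)"
      unfolding power2_eq_square by (intro mult_right_mono mult_left_mono g0) auto
    also have "\<dots> \<le> (\<Sum>j\<le>k. norm ((of_nat j * a (Suc k - j) + b (k - j)) * c j)) * r ^ Suc k"
      unfolding eq using r by (intro mult_right_mono norm_sum) auto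
    also have "\<dots> \<le> M * S k"
      unfolding S_def sum_distrib_left sum_distrib_right by (intro sum_mono t) auto
    finally show ?thesis .
  qed
  have S1: "S k \<ge> 1" for k
  proof (induction k)
    case (Suc k)
    have "(real k + 2) * g (Suc k) \<ge> 0" using g0 by simp
    thus ?case using Suc S_Suc[of k] by linarith
  qed (simp add: S_def g_def c_def)
  have Sb: "S (Suc k) \<le> (1 + 2 * M / real (Suc k)) * S k" for k
  proof -
    have "(real k + 2) * g (Suc k) \<le> (2 * real (Suc k)) * g (Suc k)"
      by (intro mult_right_mono g0) auto
    also have "\<dots> = 2 * (real (Suc k) ^ 2 * g (Suc k)) / real (Suc k)"
      by (simp add: power2_eq_square)
    also have "\<dots> \<le> 2 * (M * S k) / real (Suc k)"
      by (intro divide_right_mono mult_left_mono gb) auto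
    finally show ?thesis unfolding S_Suc by (simp add: algebra_simps)
  qed
  have "(\<lambda>k. S (Suc k) / S k) \<longlonglongrightarrow> 1"
  proof (rule tendsto_sandwich[where f = "\<lambda>_. 1" and h = "\<lambda>k. 1 + 2 * M / real (Suc k)"])
    show "(\<lambda>k. 1 + 2 * M / real (Suc k)) \<longlonglongrightarrow> 1"
      using tendsto_add[OF tendsto_const LIMSEQ_Suc[OF tendsto_divide_0[OF tendsto_const filterlim_real_at_infinity_sequentially]], of 1 "2*M"]
      by simp
    show "\<forall>\<^sub>F k in sequentially. 1 \<le> S (Suc k) / S k"
      using S1 g0 by (intro always_eventually allI) (simp add: S_Suc add_pos_pos less_le_trans[OF zero_less_one])
    show "\<forall>\<^sub>F k in sequentially. S (Suc k) / S k \<le> 1 + 2 * M / real (Suc k)"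
      using Sb S1 by (intro always_eventually allI) (simp add: divide_le_eq less_le_trans[OF zero_less_one])
  qed simp
  hence "(\<lambda>k. S k / S (Suc k)) \<longlonglongrightarrow> 1"
    using tendsto_inverse[of "\<lambda>k. S (Suc k) / S k" 1] by simp
  hence cr: "conv_radius S = 1"
  proof -
    have nz: "norm (S k) = S k" for k using S1[of k] by auto
    have "conv_radius S = ereal 1"
      using conv_radius_ratio_limit_nonzero[OF refl one_neq_zero, of S]
        \<open>(\<lambda>k. S k / S (Suc k)) \<longlonglongrightarrow> 1\<close> by (simp only: nz)
    thus ?thesis by (simp add: one_ereal_def)
  qed
  have "summable (\<lambda>k. S k * (norm x / r) ^ k)"
    using x r by (intro summable_in_conv_radius) (simp add: cr)
  thus ?thesis
  proof (rule summable_comparison_test'[where N = 0])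
    fix k
    have "norm (c k * x ^ k) = g k * (norm x / r) ^ k"
      using r by (simp add: norm_mult norm_power g_def power_divide)
    also have "g k \<le> S k"
    proof -
      have "g k \<le> (real k + 1) * g k" using g0[of k] by (simp add: mult_le_cancel_right1)
      also have "\<dots> \<le> S k" unfolding S_def using g0 by (intro member_le_sum) auto
      finally show ?thesis .
    qed
    finally show "norm (frobenius_coeff a b N k * x ^ k) \<le> S k * (norm x / r) ^ k"
      using r by (simp add: c_def mult_right_mono)
  qed
qed

lemma fps_coeff_geometric_bound:
  fixes F :: "complex fps"
  assumes "ereal r < fps_conv_radius F" "r > 0"
  obtains M where "\<And>k. norm (fps_nth F k) * r ^ k \<le> M"
proof -
  have "summable (\<lambda>k. fps_nth F k * of_real r ^ k)"
    using assms by (intro summable_in_conv_radius) (auto simp: fps_conv_radius_def)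
  hence "Bseq (\<lambda>k. fps_nth F k * of_real r ^ k)"
    by (intro convergent_imp_Bseq) (auto simp: convergent_def dest: summable_LIMSEQ_zero)
  then obtain M where "\<And>k. norm (fps_nth F k * of_real r ^ k) \<le> M"
    unfolding Bseq_def by blast
  thus ?thesis using assms that[of M] by (simp add: norm_mult norm_power)
qed

text \<open>The indicial equation of \<open>y u'' + a u' + b u = 0\<close> at the origin is \<open>k (k + N) = 0\<close>,
  so the recursion for the coefficients never degenerates.\<close>

theorem regular_singular_ode_exists:
  fixes a b :: "complex \<Rightarrow> complex"
  assumes a: "a holomorphic_on ball 0 R" and b: "b holomorphic_on ball 0 R" and R: "R > 0"
    and a0: "a 0 = of_nat (Suc N)"
  obtains u where "u holomorphic_on ball 0 R" "u 0 = 1"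
    "\<And>y. y \<in> ball 0 R \<Longrightarrow> y * deriv (deriv u) y + a y * deriv u y + b y * u y = 0"
proof -
  define A where "A = fps_expansion a 0"
  define B where "B = fps_expansion b 0"
  define C where "C = Abs_fps (frobenius_coeff (fps_nth A) (fps_nth B) N)"
  have ea: "a has_fps_expansion A" and eb: "b has_fps_expansion B"
    unfolding A_def B_def using a b R by (auto intro!: has_fps_expansion_fps_expansion[of "ball 0 R"])
  have rA: "fps_conv_radius A \<ge> R" and rB: "fps_conv_radius B \<ge> R"
    using holomorphic_on_imp_fps_conv_radius_ge[OF ea, of R] holomorphic_on_imp_fps_conv_radius_ge[OF eb, of R] a b
    by auto
  have rC: "fps_conv_radius C \<ge> R"
    unfolding fps_conv_radius_def
  proof (rule conv_radius_geI_ex)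
    fix s :: real assume s: "0 < s" "ereal s < ereal R"
    \<comment> \<open>The coefficient bounds are taken on a larger circle, of radius r, so that s
      lies strictly inside it.\<close>
    define r where "r = (s + R) / 2"
    have r: "s < r" "r < R" "r > 0" using s by (auto simp: r_def)
    obtain M1 where M1: "\<And>k. norm (fps_nth A k) * r ^ k \<le> M1"
      using fps_coeff_geometric_bound[of r A] r rA by (meson ereal_less_eq(3) less_ereal.simps(1) less_le_trans)
    obtain M2 where M2: "\<And>k. norm (fps_nth B k) * r ^ k \<le> M2"
      using fps_coeff_geometric_bound[of r B] r rB by (meson ereal_less_eq(3) less_ereal.simps(1) less_le_trans)
    have "summable (\<lambda>k. frobenius_coeff (fps_nth A) (fps_nth B) N k * of_real s ^ k)"
    proof (rule frobenius_coeff_summable)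
      \<comment> \<open>One constant serves both bounds; the bound for \<open>b\<close> carries one
        more power of r, hence \<open>M2 * r\<close>.\<close>
      show "norm (fps_nth A k) * r ^ k \<le> max M1 (M2 * r)" for k
        using M1[of k] by simp
      show "norm (fps_nth B k) * r ^ Suc k \<le> max M1 (M2 * r)" for k
        using mult_right_mono[OF M2[of k], of r] r by (simp add: mult_ac le_max_iff_disj)
    qed (use r s in auto)
    thus "\<exists>z::complex. norm z = s \<and> summable (\<lambda>n. fps_nth C n * z ^ n)"
      using s by (intro exI[of _ "of_real s"]) (auto simp: C_def)
  qed
  define u where "u = eval_fps C"
  have hu: "u holomorphic_on ball 0 R"
  proof -
    have "ball 0 R \<subseteq> eball 0 (fps_conv_radius C)"
      using less_le_trans[OF _ rC] by (auto simp: in_eball_iff)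
    thus ?thesis unfolding u_def by (intro holomorphic_intros)
  qed
  have pos: "fps_conv_radius C > 0" using rC R by (meson ereal_less(2) less_le_trans)
  have eu: "u has_fps_expansion C" unfolding u_def by (intro eval_fps_has_fps_expansion pos)
  define E where "E y = y * deriv (deriv u) y + a y * deriv u y + b y * u y" for y
  have eq: "fps_X * fps_deriv (fps_deriv C) + A * fps_deriv C + B * C = 0"
  proof (rule fps_ext)
    fix k
    have A0: "fps_nth A 0 = of_nat (Suc N)"
      using fps_nth_fps_expansion[OF ea, of 0] a0 by simp
    \<comment> \<open>The term with j = k + 1 is split off: it carries the value of \<open>a\<close>
      at the origin and joins the contribution of the second derivative.\<close>
    have s1: "fps_nth (A * fps_deriv C) k =
        of_nat (Suc N) * of_nat (Suc k) * fps_nth C (Suc k) + (\<Sum>j\<le>k. of_nat j * fps_nth A (Suc k - j) * fps_nth C j)"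
    proof -
      have "fps_nth (A * fps_deriv C) k = fps_nth (fps_deriv C * A) k" by (simp add: mult.commute)
      also have "\<dots> = (\<Sum>i=0..k. of_nat (Suc i) * fps_nth C (Suc i) * fps_nth A (k - i))"
        by (simp add: fps_mult_nth fps_deriv_def)
      also have "\<dots> = (\<Sum>i=Suc 0..Suc k. of_nat i * fps_nth C i * fps_nth A (Suc k - i))"
        by (subst sum.shift_bounds_cl_Suc_ivl) simp
      also have "\<dots> = (\<Sum>i=0..Suc k. of_nat i * fps_nth C i * fps_nth A (Suc k - i))"
        by (subst (2) sum.atLeast_Suc_atMost) auto
      finally show ?thesis
        by (simp add: A0 atMost_atLeast0 algebra_simps)
    qed
    have s2: "fps_nth (B * C) k = (\<Sum>j\<le>k. fps_nth B (k - j) * fps_nth C j)"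
      by (subst mult.commute[of B C], subst fps_mult_nth) (simp add: atMost_atLeast0 mult.commute)
    have "fps_nth C (Suc k) * (of_nat (Suc k) * of_nat (Suc k + N)) =
        - (\<Sum>j\<le>k. (of_nat j * fps_nth A (Suc k - j) + fps_nth B (k - j)) * fps_nth C j)"
    proof -
      have nz: "(of_nat (Suc k) * of_nat (Suc k + N) :: complex) \<noteq> 0"
        by (simp del: of_nat_Suc of_nat_add)
      have C: "fps_nth C = frobenius_coeff (fps_nth A) (fps_nth B) N"
        by (simp add: C_def fun_eq_iff)
      show ?thesis
        unfolding C frobenius_coeff.simps(2) by (rule nonzero_eq_divide_eq[OF nz, THEN iffD1, OF refl])
    qed
    also have "\<dots> = - ((\<Sum>j\<le>k. of_nat j * fps_nth A (Suc k - j) * fps_nth C j) + (\<Sum>j\<le>k. fps_nth B (k - j) * fps_nth C j))"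
      by (subst sum.distrib[symmetric]) (simp only: distrib_right)
    finally have rec: "fps_nth C (Suc k) * (of_nat (Suc k) * of_nat (Suc k + N)) + 
       ((\<Sum>j\<le>k. of_nat j * fps_nth A (Suc k - j) * fps_nth C j) + (\<Sum>j\<le>k. fps_nth B (k - j) * fps_nth C j)) = 0"
      by (simp only: left_minus)
    have s3: "fps_nth (fps_X * fps_deriv (fps_deriv C)) k = of_nat k * of_nat (Suc k) * fps_nth C (Suc k)"
      by (cases k) (auto simp: fps_deriv_def)
    have "fps_nth (fps_X * fps_deriv (fps_deriv C) + A * fps_deriv C + B * C) k =
       fps_nth C (Suc k) * (of_nat (Suc k) * of_nat (Suc k + N)) + 
       ((\<Sum>j\<le>k. of_nat j * fps_nth A (Suc k - j) * fps_nth C j) + (\<Sum>j\<le>k. fps_nth B (k - j) * fps_nth C j))"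
      unfolding fps_add_nth s1 s2 s3 by (simp add: algebra_simps)
    thus "fps_nth (fps_X * fps_deriv (fps_deriv C) + A * fps_deriv C + B * C) k = fps_nth 0 k"
      unfolding rec by simp
  qed
  have "E has_fps_expansion (fps_X * fps_deriv (fps_deriv C) + A * fps_deriv C + B * C)"
    unfolding E_def by (intro fps_expansion_intros eu ea eb)
  hence e0: "E has_fps_expansion 0" by (simp only: eq)
  have hE: "E holomorphic_on ball 0 R"
    unfolding E_def by (intro holomorphic_intros a b hu) auto
  have "E y = 0" if "y \<in> ball 0 R" for y
    using has_fps_expansion_0_analytic_continuation[OF e0 hE _ _ _ that] R by auto
  moreover have "u 0 = 1"
    by (simp add: u_def eval_fps_at_0 C_def)
  ultimately show ?thesis using that[OF hu] by (auto simp: E_def)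
qed

section \<open>The hypergeometric equation on the slit plane\<close>

definition slit :: "complex set" where
  "slit = - complex_of_real ` {1..}"

lemma slit_iff: "s \<in> slit \<longleftrightarrow> 1 - s \<notin> \<real>\<^sub>\<le>\<^sub>0"
proof -
  have "s \<in> complex_of_real ` {1..} \<longleftrightarrow> 1 - s \<in> \<real>\<^sub>\<le>\<^sub>0"
    by (auto simp: complex_nonpos_Reals_iff image_iff complex_eq_iff)
  thus ?thesis by (simp add: slit_def)
qed

lemma slit_nonreal: "Im s \<noteq> 0 \<Longrightarrow> s \<in> slit"
  by (auto simp: slit_def)

lemma open_slit: "open slit"
proof -
  have eq: "slit = (\<lambda>s. 1 - s) -` (- \<real>\<^sub>\<le>\<^sub>0)" by (auto simp: slit_iff)
  show ?thesis unfolding eq by (intro open_vimage continuous_intros open_Compl closed_nonpos_Reals_complex)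
qed

lemma ball_subset_slit: "ball 0 1 \<subseteq> slit"
  by (auto simp: slit_def)

lemma zero_in_slit [simp]: "0 \<in> slit"
  using ball_subset_slit by auto

lemma one_notin_slit [simp]: "1 \<notin> slit"
  by (auto simp: slit_def image_iff intro!: exI[of _ 1])

lemma starlike_slit: "0 \<le> t \<Longrightarrow> t \<le> 1 \<Longrightarrow> s \<in> slit \<Longrightarrow> complex_of_real t * s \<in> slit"
proof (cases "t = 0")
  case False
  assume t: "0 \<le> t" "t \<le> 1" and s: "s \<in> slit"
  show ?thesis
  proof (rule ccontr)
    assume "complex_of_real t * s \<notin> slit"
    then obtain x where "x \<ge> 1" "of_real t * s = of_real x" by (auto simp: slit_def)
    hence "s = of_real (x / t)" using False by (simp add: field_simps)
    moreover have "x / t \<ge> 1" using t False \<open>x \<ge> 1\<close> by (simp add: le_divide_eq)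
    ultimately show False using s unfolding slit_def by (metis ComplD atLeast_iff image_eqI)
  qed
qed auto

lemma connected_slit: "connected slit"
proof -
  have "starlike slit"
    unfolding starlike_def
  proof (intro bexI[of _ 0] ballI subsetI)
    fix s y assume "s \<in> slit" "y \<in> closed_segment 0 s"
    thus "y \<in> slit" using starlike_slit by (auto simp: closed_segment_def scaleR_conv_of_real)
  qed auto
  thus ?thesis by (rule starlike_imp_connected)
qed

text \<open>The hypergeometric equation with parameters \<open>a + b = 1\<close>, \<open>a b = - \<kappa>\<close>.\<close>

definition hyp_ode :: "complex \<Rightarrow> complex \<Rightarrow> (complex \<Rightarrow> complex) \<Rightarrow> complex \<Rightarrow> bool" where
  "hyp_ode c \<kappa> k s \<longleftrightarrow>
     s * (1 - s) * deriv (deriv k) s + (c - 2 * s) * deriv k s + \<kappa> * k s = 0"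

text \<open>The terms s k'' + c k' lower the power of s by one and the others preserve it, so each
  coefficient is linked to the next one only.\<close>

lemma hyp_ode_coeff:
  assumes F: "k has_fps_expansion F" and ode: "eventually (hyp_ode c \<kappa> k) (nhds 0)"
  shows "(of_nat j + 1) * (of_nat j + c) * fps_nth F (Suc j) = (of_nat j * (of_nat j + 1) - \<kappa>) * fps_nth F j"
proof -
  define E where "E s = s * deriv (deriv k) s - s * (s * deriv (deriv k) s) + c * deriv k s
      - 2 * (s * deriv k s) + \<kappa> * k s" for s
  define G where "G = fps_X * fps_deriv (fps_deriv F) - fps_X * (fps_X * fps_deriv (fps_deriv F))
      + fps_const c * fps_deriv F - fps_const 2 * (fps_X * fps_deriv F) + fps_const \<kappa> * F"
  have "E has_fps_expansion G"
    unfolding E_def G_def by (intro fps_expansion_intros F)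
  moreover have "eventually (\<lambda>s. E s = 0) (nhds 0)"
    using ode by eventually_elim (simp add: hyp_ode_def E_def algebra_simps)
  hence "E has_fps_expansion 0"
    by (simp add: has_fps_expansion_0_iff)
  ultimately have "G = 0" by (rule fps_expansion_unique_complex)
  hence "fps_nth G j = 0" by simp
  thus ?thesis
    unfolding G_def by (cases j; cases "j - 1") (auto simp: algebra_simps add_eq_0_iff)
qed

text \<open>The factor (j + 1)(j + N + 1) in front of the next coefficient never vanishes, so the
  value at the origin determines the whole series.\<close>

lemma hyp_ode_unique:
  assumes k: "k analytic_on {0}" "eventually (hyp_ode (of_nat N + 1) \<kappa> k) (nhds 0)"
    and K: "K analytic_on {0}" "eventually (hyp_ode (of_nat N + 1) \<kappa> K) (nhds 0)" "K 0 = 1"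
  shows "eventually (\<lambda>s. k s = k 0 * K s) (nhds 0)"
proof -
  define F where "F = fps_expansion k 0"
  define G where "G = fps_expansion K 0"
  have F: "k has_fps_expansion F" and G: "K has_fps_expansion G"
    unfolding F_def G_def using k K by (auto intro: analytic_at_imp_has_fps_expansion_0)
  have "fps_nth F j = k 0 * fps_nth G j" for j
  proof (induction j)
    case 0
    thus ?case using fps_nth_fps_expansion[OF F, of 0] fps_nth_fps_expansion[OF G, of 0] K by simp
  next
    case (Suc j)
    have nz: "(of_nat j + 1) * (of_nat j + (of_nat N + 1)) \<noteq> (0::complex)"
      using of_nat_neq_0[of j, where 'a = complex] of_nat_neq_0[of "j + N", where 'a = complex]
      by (simp add: add_ac)
    have "(of_nat j + 1) * (of_nat j + (of_nat N + 1)) * fps_nth F (Suc j) =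
          (of_nat j + 1) * (of_nat j + (of_nat N + 1)) * (k 0 * fps_nth G (Suc j))"
      using hyp_ode_coeff[OF F k(2), of j] hyp_ode_coeff[OF G K(2), of j] Suc
      by (simp only: mult.assoc[symmetric]) (simp only: mult_ac)
    thus ?case using nz mult_left_cancel by blast
  qed
  hence "F = fps_const (k 0) * G" by (intro fps_ext) simp
  hence "(\<lambda>s. k 0 * K s) has_fps_expansion F"
    by (simp only:) (intro fps_expansion_intros G)
  with F have "eventually (\<lambda>s. eval_fps F s = k s) (nhds 0)" "eventually (\<lambda>s. eval_fps F s = k 0 * K s) (nhds 0)"
    by (auto simp: has_fps_expansion_def)
  thus ?thesis by eventually_elim simp
qed

lemma hyp_ode_cong:
  assumes U: "open U" "s \<in> U" and eq: "\<And>t. t \<in> U \<Longrightarrow> k t = k' t"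
  shows "hyp_ode c \<kappa> k s \<longleftrightarrow> hyp_ode c \<kappa> k' s"
proof -
  have d: "deriv k t = deriv k' t" if "t \<in> U" for t
    by (rule deriv_cong_ev) (use U eq that in \<open>auto simp: eventually_nhds\<close>)
  have "deriv (deriv k) s = deriv (deriv k') s"
    by (rule deriv_cong_ev) (use U d in \<open>auto simp: eventually_nhds\<close>)
  thus ?thesis using d eq U by (simp add: hyp_ode_def)
qed

lemma deriv2_compose:
  assumes U: "open U" "s \<in> U" and V: "open V" "u holomorphic_on V" "\<And>t. t \<in> U \<Longrightarrow> \<phi> t \<in> V"
    and \<phi>: "\<And>t. t \<in> U \<Longrightarrow> (\<phi> has_field_derivative X t) (at t)"
      "\<And>t. t \<in> U \<Longrightarrow> (X has_field_derivative X2 t) (at t)"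
  shows "((\<lambda>t. u (\<phi> t)) has_field_derivative (deriv u (\<phi> s) * X s)) (at s)"
    and "deriv (\<lambda>t. u (\<phi> t)) s = deriv u (\<phi> s) * X s"
    and "deriv (deriv (\<lambda>t. u (\<phi> t))) s = deriv (deriv u) (\<phi> s) * X s ^ 2 + deriv u (\<phi> s) * X2 s"
proof -
  have u: "(u has_field_derivative deriv u (\<phi> t)) (at (\<phi> t))"
    "(deriv u has_field_derivative deriv (deriv u) (\<phi> t)) (at (\<phi> t))" if "t \<in> U" for t
    using V that by (auto intro!: holomorphic_derivI[of _ V] holomorphic_deriv)
  have 1: "((\<lambda>t. u (\<phi> t)) has_field_derivative (deriv u (\<phi> t) * X t)) (at t)" if "t \<in> U" for t
    using DERIV_chain2[OF u(1)[OF that] \<phi>(1)[OF that]] .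
  show "((\<lambda>t. u (\<phi> t)) has_field_derivative (deriv u (\<phi> s) * X s)) (at s)"
    "deriv (\<lambda>t. u (\<phi> t)) s = deriv u (\<phi> s) * X s"
    using 1[OF U(2)] by (auto intro: DERIV_imp_deriv)
  have "((\<lambda>t. deriv u (\<phi> t) * X t) has_field_derivative
     (deriv u (\<phi> s) * X2 s + (deriv (deriv u) (\<phi> s) * X s) * X s)) (at s)"
    by (rule DERIV_mult'[OF DERIV_chain2[OF u(2)[OF U(2)] \<phi>(1)[OF U(2)]] \<phi>(2)[OF U(2)]])
  hence "deriv (\<lambda>t. deriv u (\<phi> t) * X t) s = deriv (deriv u) (\<phi> s) * X s ^ 2 + deriv u (\<phi> s) * X2 s"
    by (simp add: DERIV_imp_deriv power2_eq_square algebra_simps)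
  moreover have "eventually (\<lambda>t. deriv (\<lambda>t. u (\<phi> t)) t = deriv u (\<phi> t) * X t) (nhds s)"
    using U 1 DERIV_imp_deriv unfolding eventually_nhds by blast
  ultimately show "deriv (deriv (\<lambda>t. u (\<phi> t))) s = deriv (deriv u) (\<phi> s) * X s ^ 2 + deriv u (\<phi> s) * X2 s"
    by (simp add: deriv_cong_ev)
qed

text \<open>With q = \<open>csqrt (1 - s)\<close> the slit plane goes to the right half plane, and
  the Cayley map q \<mapsto> (1 - q) / (1 + q) takes that to the unit disc. The singular points s =
  1 and s = infinity go to the boundary points 1 and -1.\<close>

definition koebe_inv :: "complex \<Rightarrow> complex" where
  "koebe_inv s = (1 - csqrt (1 - s)) / (1 + csqrt (1 - s))"

lemma slit_csqrt:
  assumes "s \<in> slit"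
  shows "Re (csqrt (1 - s)) > 0" "csqrt (1 - s) \<noteq> 0" "1 + csqrt (1 - s) \<noteq> 0"
proof -
  show *: "Re (csqrt (1 - s)) > 0"
  proof (rule ccontr)
    assume "\<not> Re (csqrt (1 - s)) > 0"
    hence "Re (csqrt (1 - s)) = 0" using csqrt_principal[of "1 - s"] by auto
    hence "Re ((csqrt (1 - s))\<^sup>2) \<le> 0" "Im ((csqrt (1 - s))\<^sup>2) = 0"
      by (simp_all add: power2_eq_square)
    thus False using assms by (simp add: slit_iff complex_nonpos_Reals_iff)
  qed
  show "csqrt (1 - s) \<noteq> 0" using * by auto
  show "1 + csqrt (1 - s) \<noteq> 0"
  proof
    assume "1 + csqrt (1 - s) = 0"
    hence "csqrt (1 - s) = -1" by (simp add: add_eq_0_iff)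
    hence "Re (csqrt (1 - s)) = -1" by (simp only:) simp
    thus False using * by linarith
  qed
qed

text \<open>|1 + q|^2 - |1 - q|^2 = 4 Re q, which is positive.\<close>

lemma koebe_inv_in_ball:
  assumes "s \<in> slit"
  shows "koebe_inv s \<in> ball 0 1"
proof -
  define q where "q = csqrt (1 - s)"
  have q: "Re q > 0" "1 + q \<noteq> 0" using slit_csqrt[OF assms] by (auto simp: q_def)
  have "norm (1 - q) ^ 2 < norm (1 + q) ^ 2"
    using q unfolding cmod_power2 by (simp add: power2_eq_square algebra_simps)
  hence "norm (1 - q) < norm (1 + q)" by (rule power_less_imp_less_base) simp
  thus ?thesis using q by (simp add: koebe_inv_def q_def norm_divide)
qed

lemma has_field_derivative_csqrt_slit:
  assumes "s \<in> slit"
  shows "((\<lambda>s. csqrt (1 - s)) has_field_derivative (- 1 / (2 * csqrt (1 - s)))) (at s)"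
  using assms by (auto intro!: derivative_eq_intros simp: slit_iff field_simps)

text \<open>Chain rule with q = \<open>csqrt (1 - s)\<close>: the product of -2 / (1 + q)^2 and -1 /
  (2 q).\<close>

lemma has_field_derivative_koebe_inv:
  assumes "s \<in> slit"
  shows "(koebe_inv has_field_derivative (1 / (csqrt (1 - s) * (1 + csqrt (1 - s))^2))) (at s)"
proof -
  note nz = slit_csqrt(2,3)[OF assms]
  show ?thesis
    unfolding koebe_inv_def
    by (rule derivative_eq_intros has_field_derivative_csqrt_slit[OF assms] nz(2) refl)+
       (use nz in \<open>simp add: divide_simps power2_eq_square\<close>; simp add: algebra_simps)
qed

lemma has_field_derivative_koebe_inv2:
  assumes "s \<in> slit"
  shows "((\<lambda>s. 1 / (csqrt (1 - s) * (1 + csqrt (1 - s))^2)) has_field_derivative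
     ((1 + 3 * csqrt (1 - s)) / (2 * csqrt (1 - s) ^ 3 * (1 + csqrt (1 - s))^3))) (at s)"
proof -
  define q where "q = csqrt (1 - s)"
  note nz = slit_csqrt(2,3)[OF assms]
  have nz': "q \<noteq> 0" "1 + q \<noteq> 0" using nz by (auto simp: q_def)
  have "((\<lambda>q. 1 / (q * (1 + q)^2)) has_field_derivative (- (1 + 3 * q) / (q^2 * (1 + q)^3))) (at q)"
    using nz' by (auto intro!: derivative_eq_intros simp: divide_simps) (simp add: algebra_simps power2_eq_square power3_eq_cube)
  from DERIV_chain2[OF this[unfolded q_def] has_field_derivative_csqrt_slit[OF assms]]
  have "((\<lambda>s. 1 / (csqrt (1 - s) * (1 + csqrt (1 - s))^2)) has_field_derivative
     (- (1 + 3 * q) / (q^2 * (1 + q)^3) * (- 1 / (2 * q)))) (at s)"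
    by (simp only: q_def)
  also have "(- (1 + 3 * q) / (q^2 * (1 + q)^3) * (- 1 / (2 * q))) = (1 + 3 * q) / (2 * q ^ 3 * (1 + q)^3)"
    using nz' by (simp add: divide_simps) (simp add: power2_eq_square power3_eq_cube algebra_simps)
  finally show ?thesis by (simp only: q_def)
qed

text \<open>Pulling the equation back along the inverse Koebe function \<open>s = 4 y / (1 + y)\<^sup>2\<close> moves the
  slit plane to the unit disc, where the origin is the only singular point.\<close>

lemma hyp_ode_exists:
  "\<exists>K. K holomorphic_on slit \<and> K 0 = 1 \<and> (\<forall>s\<in>slit. hyp_ode (of_nat N + 1) \<kappa> K s)"
proof -
  \<comment> \<open>With q = \<open>csqrt (1 - s)\<close>, multiplying the transformed equation by
    (1 + q)^2 makes its leading coefficient y. \<open>a\<close> and \<open>b\<close> are the other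
    two coefficients, rewritten in y by q = (1 - y) / (1 + y) and 1 + q = 2 / (1 + y).\<close>
  define a :: "complex \<Rightarrow> complex" where
    "a y = (of_nat N - 1 / 2) * ((1 + y) / (1 - y)) + 1 + (1 - y) / (1 + y) / 2" for y
  define b :: "complex \<Rightarrow> complex" where "b y = 4 * \<kappa> / (1 + y) ^ 2" for y
  have nz: "1 - y \<noteq> 0" "1 + y \<noteq> 0" if "y \<in> ball 0 1" for y :: complex
  proof -
    show "1 - y \<noteq> 0" using that by auto
    show "1 + y \<noteq> 0"
    proof
      assume "1 + y = 0"
      hence "y = -1" by (simp add: add_eq_0_iff)
      thus False using that by simp
    qed
  qed
  have "a holomorphic_on ball 0 1" "b holomorphic_on ball 0 1"
    unfolding a_def b_def by (intro holomorphic_intros; use nz in force)+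
  moreover have "a 0 = of_nat (Suc N)" by (simp add: a_def)
  ultimately obtain u where u: "u holomorphic_on ball 0 1" "u 0 = 1"
    "\<And>y. y \<in> ball 0 1 \<Longrightarrow> y * deriv (deriv u) y + a y * deriv u y + b y * u y = 0"
    using regular_singular_ode_exists[of a 1 b N] by auto
  define K where "K = (\<lambda>s. u (koebe_inv s))"
  define Y1 where "Y1 = (\<lambda>s. 1 / (csqrt (1 - s) * (1 + csqrt (1 - s))^2))"
  define Y2 where "Y2 = (\<lambda>s. (1 + 3 * csqrt (1 - s)) / (2 * csqrt (1 - s) ^ 3 * (1 + csqrt (1 - s))^3))"
  have Y: "\<And>s. s \<in> slit \<Longrightarrow> (koebe_inv has_field_derivative Y1 s) (at s)"
    "\<And>s. s \<in> slit \<Longrightarrow> (Y1 has_field_derivative Y2 s) (at s)"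
    unfolding Y1_def Y2_def by (rule has_field_derivative_koebe_inv has_field_derivative_koebe_inv2; assumption)+
  have K': "(K has_field_derivative (deriv u (koebe_inv s) * Y1 s)) (at s)"
    "deriv K s = deriv u (koebe_inv s) * Y1 s"
    "deriv (deriv K) s = deriv (deriv u) (koebe_inv s) * Y1 s ^ 2 + deriv u (koebe_inv s) * Y2 s"
    if s: "s \<in> slit" for s
    unfolding K_def
    by (rule deriv2_compose[where X = Y1 and ?X2.0 = Y2, OF open_slit s open_ball u(1) koebe_inv_in_ball Y]; assumption)+
  have "hyp_ode (of_nat N + 1) \<kappa> K s" if s: "s \<in> slit" for s
  proof -
    define q where "q = csqrt (1 - s)"
    define y where "y = koebe_inv s"
    have q: "q \<noteq> 0" "1 + q \<noteq> 0" using slit_csqrt[OF s] by (auto simp: q_def)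
    have yq: "y = (1 - q) / (1 + q)" by (simp add: y_def q_def koebe_inv_def)
    have sq: "s = 1 - q^2" by (simp add: q_def)
    have y1: "1 + y = 2 / (1 + q)" "1 - y = 2 * q / (1 + q)"
      using q by (simp_all add: yq divide_simps)
    have ay: "a y = (of_nat N - 1 / 2) / q + 1 + q / 2"
    proof -
      have r: "2 / (1 + q) / (2 * q / (1 + q)) = 1 / q" "2 * q / (1 + q) / (2 / (1 + q)) = q"
      proof -
        have "2 + q * 2 \<noteq> 0" using q(2) using mult_eq_0_iff[of 2 "1 + q"] by (simp add: distrib_left mult.commute)
        thus "2 / (1 + q) / (2 * q / (1 + q)) = 1 / q" "2 * q / (1 + q) / (2 / (1 + q)) = q"
          using q by (simp_all add: divide_simps)
      qed
      show ?thesis unfolding a_def y1 r by simp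
    qed
    have by': "b y = \<kappa> * (1 + q)^2"
      using q by (simp add: b_def y1 power_divide)
    have Y: "Y1 s = 1 / (q * (1 + q)^2)" "Y2 s = (1 + 3 * q) / (2 * q ^ 3 * (1 + q)^3)"
      by (simp_all add: Y1_def Y2_def q_def)
    have s1: "s * (1 - s) = (1 - q) * (1 + q) * q^2" and s2: "of_nat N + 1 - 2 * s = of_nat N - 1 + 2 * q^2"
      unfolding sq by (simp_all add: power2_eq_square algebra_simps)
    have e1: "(1 + q)^2 * (s * (1 - s) * Y1 s ^ 2) = y"
      using q unfolding Y yq s1 by (simp add: divide_simps) (simp add: power2_eq_square power4_eq_xxxx algebra_simps)
    have e2: "(1 + q)^2 * (s * (1 - s) * Y2 s + (of_nat N + 1 - 2 * s) * Y1 s) = a y"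
      using q unfolding Y ay s1 s2
      by (simp add: divide_simps) (simp add: power2_eq_square power3_eq_cube algebra_simps)
    have "(1 + q)^2 * (s * (1 - s) * deriv (deriv K) s + (of_nat N + 1 - 2 * s) * deriv K s + \<kappa> * K s) =
       (1 + q)^2 * (s * (1 - s) * Y1 s ^ 2) * deriv (deriv u) y +
       (1 + q)^2 * (s * (1 - s) * Y2 s + (of_nat N + 1 - 2 * s) * Y1 s) * deriv u y + (\<kappa> * (1 + q)^2) * u y"
      using K'(2,3)[OF s] by (simp add: K_def y_def algebra_simps)
    also have "\<dots> = y * deriv (deriv u) y + a y * deriv u y + b y * u y"
      by (simp only: e1 e2 by')
    also have "\<dots> = 0" using u(3)[OF koebe_inv_in_ball[OF s]] by (simp add: y_def)
    finally show ?thesis using q by (simp add: hyp_ode_def)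
  qed
  moreover have "K holomorphic_on slit"
    using K'(1) by (auto simp: holomorphic_on_open[OF open_slit])
  moreover have "K 0 = 1" using u(2) by (simp add: K_def koebe_inv_def)
  ultimately show ?thesis by blast
qed

text \<open>The Gauss function 2F1 (\<mu>, 1 - \<mu>; N + 1; s) for \<kappa> = \<mu> (\<mu> - 1),
  continued to the slit plane. The recursion determines its germ at 0, connectedness of
  \<open>slit\<close> its remaining values.\<close>

definition hyp_fun :: "nat \<Rightarrow> complex \<Rightarrow> complex \<Rightarrow> complex" where
  "hyp_fun N \<kappa> = (SOME K. K holomorphic_on slit \<and> K 0 = 1 \<and> (\<forall>s\<in>slit. hyp_ode (of_nat N + 1) \<kappa> K s))"

lemma hyp_fun:
  shows holomorphic_hyp_fun: "hyp_fun N \<kappa> holomorphic_on slit"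
    and hyp_fun_0: "hyp_fun N \<kappa> 0 = 1"
    and hyp_ode_hyp_fun: "s \<in> slit \<Longrightarrow> hyp_ode (of_nat N + 1) \<kappa> (hyp_fun N \<kappa>) s"
  using someI_ex[OF hyp_ode_exists[of N \<kappa>]] by (auto simp: hyp_fun_def)

lemma analytic_hyp_fun_0: "hyp_fun N \<kappa> analytic_on {0}"
  using holomorphic_hyp_fun open_slit zero_in_slit analytic_at by blast

lemma eventually_hyp_ode_hyp_fun: "eventually (hyp_ode (of_nat N + 1) \<kappa> (hyp_fun N \<kappa>)) (nhds 0)"
  using hyp_ode_hyp_fun open_slit zero_in_slit unfolding eventually_nhds by blast

lemma hyp_ode_eq_hyp_fun:
  assumes "k analytic_on {0}" "eventually (hyp_ode (of_nat N + 1) \<kappa> k) (nhds 0)"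
  shows "eventually (\<lambda>s. k s = k 0 * hyp_fun N \<kappa> s) (nhds 0)"
  by (rule hyp_ode_unique[OF assms analytic_hyp_fun_0 eventually_hyp_ode_hyp_fun hyp_fun_0])

section \<open>Solutions on an annulus\<close>

lemma annulus_path_image:
  assumes "0 \<le> R1" "R1 < r" "r < R2"
  shows "path_image (circlepath 0 r) \<subseteq> {z::complex. R1 < norm z \<and> norm z < R2}"
  using assms by (auto simp: path_image_circlepath)

lemma open_annulus: "open {z::complex. R1 < norm z \<and> norm z < R2}"
  by (intro open_Collect_conj open_Collect_less continuous_intros)

lemma contour_integral_annulus_radius:
  assumes h: "h holomorphic_on {z. R1 < norm z \<and> norm z < R2}" and R1: "0 \<le> R1"
    and r: "R1 < r" "r < R2" "R1 < r'" "r' < R2"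
  shows "contour_integral (circlepath 0 r) h = contour_integral (circlepath 0 r') h"
proof (rule Cauchy_theorem_homotopic_loops[OF _ open_annulus h])
  show "homotopic_loops {z. R1 < norm z \<and> norm z < R2} (circlepath 0 r) (circlepath 0 r')"
  proof (rule homotopic_loops_linear)
    fix t x :: real assume "t \<in> {0..1}"
    define w where "w = exp (2 * of_real pi * \<i> * of_real t)"
    have w: "norm w = 1" by (simp add: w_def norm_exp_eq_Re)
    have c: "circlepath 0 \<rho> t = of_real \<rho> * w" for \<rho>
      by (simp add: circlepath w_def)
    show "closed_segment (circlepath 0 r t) (circlepath 0 r' t) \<subseteq> {z. R1 < norm z \<and> norm z < R2}"
    proof
      fix z assume "z \<in> closed_segment (circlepath 0 r t) (circlepath 0 r' t)"
      then obtain u where u: "0 \<le> u" "u \<le> 1" "z = of_real ((1 - u) * r + u * r') * w"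
        by (auto simp: closed_segment_def c scaleR_conv_of_real algebra_simps)
      have "(1 - u) * r + u * r' \<in> {R1<..<R2}"
        using convexD[OF convex_real_interval(8)[of R1 R2], of r r' "1 - u" u] u r by auto
      thus "z \<in> {z. R1 < norm z \<and> norm z < R2}"
        using R1 unfolding u(3) by (auto simp: norm_mult w simp del: of_real_add of_real_mult)
    qed
  qed auto
qed auto

lemma geometric_bound_imp_zero:
  fixes y :: real
  assumes "\<And>n. norm (x :: complex) \<le> C * y ^ n" "0 \<le> y" "y < 1"
  shows "x = 0"
proof -
  have "(\<lambda>n. C * y ^ n) \<longlonglongrightarrow> C * 0"
    by (intro tendsto_intros LIMSEQ_realpow_zero) (use assms in auto)
  hence "norm x \<le> C * 0"
    by (rule tendsto_lowerbound) (use assms(1) in auto)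
  thus ?thesis by simp
qed

lemma contour_integral_circlepath_power_int:
  assumes "r > 0" "m \<noteq> -1"
  shows "contour_integral (circlepath 0 r) (\<lambda>s. s powi m) = 0"
proof -
  have "((\<lambda>s. s powi m) has_contour_integral 0) (circlepath 0 r)"
  proof (rule Cauchy_theorem_primitive)
    fix s :: complex assume s: "s \<in> - {0}"
    have "((\<lambda>s. s powi (m + 1) / of_int (m + 1)) has_field_derivative
        of_int (m + 1) * s powi (m + 1 - 1) * 1 / of_int (m + 1)) (at s within - {0})"
      using s by (intro DERIV_cdivide DERIV_power_int DERIV_ident) simp
    moreover have "of_int (m + 1) \<noteq> (0::complex)" using assms by (simp only: of_int_eq_0_iff)
    ultimately show "((\<lambda>s. s powi (m + 1) / of_int (m + 1)) has_field_derivative s powi m) (at s within - {0})"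
      by (simp del: of_int_add)
  qed (use assms in \<open>auto simp: path_image_circlepath\<close>)
  thus ?thesis by (rule contour_integral_unique)
qed

lemma contour_integral_power_int_bound:
  assumes "continuous_on (sphere 0 r) q" "r > 0"
  obtains C where "C \<ge> 0" "\<And>m. norm (contour_integral (circlepath 0 r) (\<lambda>s. q s * s powi m)) \<le> C * r powi m"
proof -
  have "compact (q ` sphere 0 r)" using assms by (intro compact_continuous_image) auto
  then obtain B where B: "B > 0" "\<And>s. s \<in> sphere 0 r \<Longrightarrow> norm (q s) \<le> B"
    using compact_imp_bounded[OF \<open>compact (q ` sphere 0 r)\<close>] unfolding bounded_pos by blast
  have "norm (contour_integral (circlepath 0 r) (\<lambda>s. q s * s powi m)) \<le> (B * r powi m) * (2 * pi * r)" for m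
  proof (rule has_contour_integral_bound_circlepath)
    have "continuous_on (path_image (circlepath 0 r)) (\<lambda>s. q s * s powi m)"
      using assms by (auto simp: path_image_circlepath intro!: continuous_intros)
    hence "(\<lambda>s. q s * s powi m) contour_integrable_on (circlepath 0 r)"
      by (rule contour_integrable_continuous_circlepath)
    thus "((\<lambda>s. q s * s powi m) has_contour_integral
       contour_integral (circlepath 0 r) (\<lambda>s. q s * s powi m)) (circlepath 0 r)"
      by (rule has_contour_integral_integral)
    show "norm (q x * x powi m) \<le> B * r powi m" if "norm (x - 0) = r" for x
      using that B assms(2) by (auto simp: norm_mult norm_power_int intro!: mult_right_mono)
  qed (use B assms in auto)
  thus ?thesis using that[of "B * (2 * pi * r)"] B assms by (auto simp: mult_ac)
qed

text \<open>The Laurent coefficients \<open>I m\<close> of \<open>q s = (K s - K \<zeta>) / (s - \<zeta>)\<close> satisfy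
  \<open>I (m + 1) = \<zeta> I m\<close> for \<open>m \<noteq> -1\<close>, and comparing with their growth on circles inside and outside
  \<open>|\<zeta>|\<close> forces them to vanish.\<close>

lemma laurent_coefficients_zero_imp_zero:
  assumes K: "K holomorphic_on {z. R1 < norm z \<and> norm z < R2}" and R1: "0 \<le> R1"
    and z: "\<And>r m. R1 < r \<Longrightarrow> r < R2 \<Longrightarrow> contour_integral (circlepath 0 r) (\<lambda>s. K s * s powi m) = 0"
    and \<zeta>: "R1 < norm \<zeta>" "norm \<zeta> < R2"
  shows "K \<zeta> = 0"
proof -
  define A where "A = {z::complex. R1 < norm z \<and> norm z < R2}"
  define q where "q s = (if s = \<zeta> then deriv K \<zeta> else (K s - K \<zeta>) / (s - \<zeta>))" for s
  define r1 where "r1 = (R1 + norm \<zeta>) / 2"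
  define r2 where "r2 = (R2 + norm \<zeta>) / 2"
  have r: "R1 < r1" "r1 < norm \<zeta>" "norm \<zeta> < r2" "r2 < R2" using \<zeta> by (auto simp: r1_def r2_def)
  have oA: "open A" unfolding A_def by (rule open_annulus)
  have qA: "q holomorphic_on A"
    unfolding q_def by (rule pole_lemma) (use K \<zeta> oA in \<open>auto simp: A_def interior_open\<close>)
  have q: "(s - \<zeta>) * q s = K s - K \<zeta>" for s by (simp add: q_def)
  define I where "I r m = contour_integral (circlepath 0 r) (\<lambda>s. q s * s powi m)" for r m
  have A0: "s \<noteq> 0" if "s \<in> A" for s using that R1 by (auto simp: A_def)
  have pow: "(\<lambda>s. s powi m) holomorphic_on A" for m
    by (intro holomorphic_intros) (use A0 in auto)
  have I_eq: "I r m = I r' m" if "R1 < r" "r < R2" "R1 < r'" "r' < R2" for r r' m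
    unfolding I_def
    by (rule contour_integral_annulus_radius[OF _ R1 that]) (use holomorphic_on_mult[OF qA pow] in \<open>simp add: A_def\<close>)
  have integrable: "f contour_integrable_on (circlepath 0 r)" if "f holomorphic_on A" "R1 < r" "r < R2" for f r
  proof (rule contour_integrable_continuous_circlepath)
    show "continuous_on (path_image (circlepath 0 r)) f"
      using holomorphic_on_imp_continuous_on[OF that(1)] annulus_path_image[OF R1 that(2,3)]
      unfolding A_def by (rule continuous_on_subset)
  qed
  have step: "I r2 (m + 1) - \<zeta> * I r2 m = - K \<zeta> * contour_integral (circlepath 0 r2) (\<lambda>s. s powi m)" for m
  proof -
    have r2: "R1 < r2" "r2 < R2" using r by auto
    have h1: "(\<lambda>s. q s * s powi (m + 1)) holomorphic_on A" "(\<lambda>s. \<zeta> * (q s * s powi m)) holomorphic_on A"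
      "(\<lambda>s. K s * s powi m) holomorphic_on A" "(\<lambda>s. K \<zeta> * s powi m) holomorphic_on A"
      "(\<lambda>s. q s * s powi m) holomorphic_on A"
      using K unfolding A_def[symmetric] by (intro holomorphic_on_mult holomorphic_on_const qA pow; assumption)+
    have "I r2 (m + 1) - \<zeta> * I r2 m =
       contour_integral (circlepath 0 r2) (\<lambda>s. q s * s powi (m + 1) - \<zeta> * (q s * s powi m))"
      unfolding I_def using integrable[OF _ r2] h1
      by (subst contour_integral_diff) (auto simp: contour_integral_lmul)
    also have "\<dots> = contour_integral (circlepath 0 r2) (\<lambda>s. K s * s powi m - K \<zeta> * s powi m)"
    proof (rule contour_integral_eq)
      fix s assume "s \<in> path_image (circlepath 0 r2)"
      hence "s \<noteq> 0" using r R1 by (auto simp: path_image_circlepath)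
      have "q s * s powi (m + 1) - \<zeta> * (q s * s powi m) = ((s - \<zeta>) * q s) * s powi m"
        proof -
        have "s powi (m + 1) = s * s powi m" using power_int_add[of s m 1] \<open>s \<noteq> 0\<close> by simp
        thus ?thesis by (simp only: left_diff_distrib right_diff_distrib mult_ac)
      qed
      thus "q s * s powi (m + 1) - \<zeta> * (q s * s powi m) = K s * s powi m - K \<zeta> * s powi m"
        unfolding q by (simp only: left_diff_distrib)
    qed
    also have "\<dots> = - K \<zeta> * contour_integral (circlepath 0 r2) (\<lambda>s. s powi m)"
      using integrable[OF _ r2] h1 pow z[OF r2]
      by (subst contour_integral_diff) (auto simp: contour_integral_lmul)
    finally show ?thesis .
  qed
  have step': "I r2 (m + 1) = \<zeta> * I r2 m" if "m \<noteq> -1" for m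
    using step[of m] contour_integral_circlepath_power_int[OF _ that, of r2] r R1 by auto
  have up: "I r2 (int n) = \<zeta> ^ n * I r2 0" for n
  proof (induction n)
    case (Suc n)
    have "I r2 (int n + 1) = \<zeta> * I r2 (int n)" by (rule step') auto
    thus ?case using Suc by (simp add: algebra_simps)
  qed auto
  have down: "\<zeta> ^ n * I r2 (- int n - 1) = I r2 (-1)" for n
  proof (induction n)
    case (Suc n)
    have "I r2 (- int (Suc n) - 1 + 1) = \<zeta> * I r2 (- int (Suc n) - 1)" by (rule step') auto
    moreover have "- int (Suc n) - 1 + 1 = - int n - 1" by simp
    ultimately have "I r2 (- int n - 1) = \<zeta> * I r2 (- int (Suc n) - 1)" by (simp only:)
    thus ?case using Suc by (simp only: power_Suc mult_ac)
  qed auto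
  have contq: "continuous_on (sphere 0 r) q" if "R1 < r" "r < R2" for r
    using holomorphic_on_imp_continuous_on[OF qA] by (rule continuous_on_subset) (use that in \<open>auto simp: A_def\<close>)
  have \<zeta>0: "norm \<zeta> > 0" using \<zeta> R1 by linarith
  \<comment> \<open>Upwards I n = \<zeta>^n I 0, while on the inner circle I n is O(r1^n) with r1 <
    |\<zeta>|. The coefficient I (-1) is treated downwards in the same way, on the outer
    circle.\<close>
  have "I r2 0 = 0"
  proof -
    obtain C where C: "\<And>m. norm (I r1 m) \<le> C * r1 powi m"
      using contour_integral_power_int_bound[OF contq, of r1] r R1 \<zeta> unfolding I_def by (metis order.strict_trans order.strict_trans1)
    have "norm (I r2 0) \<le> C * (r1 / norm \<zeta>) ^ n" for n
    proof -
      have "norm \<zeta> ^ n * norm (I r2 0) = norm (I r1 (int n))"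
        using up[of n] I_eq[of r1 r2 "int n"] r \<zeta> by (simp add: norm_mult norm_power)
      also have "\<dots> \<le> C * r1 ^ n" using C[of "int n"] by simp
      finally show ?thesis using \<zeta>0 by (simp add: power_divide field_simps)
    qed
    thus ?thesis by (rule geometric_bound_imp_zero) (use r R1 \<zeta>0 in auto)
  qed
  moreover have "I r2 (-1) = 0"
  proof -
    have r20: "r2 > 0" using r R1 by linarith
    obtain C where C: "\<And>m. norm (I r2 m) \<le> C * r2 powi m"
      using contour_integral_power_int_bound[OF contq, of r2] r R1 \<zeta> r20 unfolding I_def by (metis order.strict_trans)
    have "norm (I r2 (-1)) \<le> (C / r2) * (norm \<zeta> / r2) ^ n" for n
    proof -
      have "norm (I r2 (-1)) = norm \<zeta> ^ n * norm (I r2 (- int n - 1))"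
        using down[of n] by (metis norm_mult norm_power)
      also have "\<dots> \<le> norm \<zeta> ^ n * (C * r2 powi (- int n - 1))"
        by (intro mult_left_mono C) auto
      also have "r2 powi (- int n - 1) = inverse (r2 ^ n) * inverse r2"
        using r20 by (simp add: power_int_diff power_int_minus divide_inverse)
      also have "norm \<zeta> ^ n * (C * (inverse (r2 ^ n) * inverse r2)) = (C / r2) * (norm \<zeta> / r2) ^ n"
        by (simp add: power_divide divide_inverse power_mult_distrib power_inverse mult_ac)
      finally show ?thesis .
    qed
    thus ?thesis by (rule geometric_bound_imp_zero) (use r r20 in auto)
  qed
  \<comment> \<open>The index m = -1 is the only one at which the constant K \<zeta> contributes.
    There \<open>step\<close> reads I 0 - \<zeta> I (-1) = - K \<zeta> 2 pi i, and its left side has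
    just been shown to vanish.\<close>
  moreover have "contour_integral (circlepath 0 r2) (\<lambda>s. s powi (-1)) = 2 * pi * \<i>"
    using contour_integral_circlepath[of r2 0] r R1 by (simp add: power_int_minus divide_inverse)
  ultimately show ?thesis using step[of "-1"] by auto
qed

text \<open>The primitive of the integrand is read off from \<open>(s (1 - s) K')' + N K' + \<kappa> K = 0\<close> by
  two integrations by parts against \<open>s\<^sup>-\<^sup>k\<close>.\<close>

lemma laurent_recursion:
  assumes K: "K holomorphic_on {z. R1 < norm z \<and> norm z < R2}" and R1: "0 \<le> R1"
    and ode: "\<And>s. R1 < norm s \<Longrightarrow> norm s < R2 \<Longrightarrow> hyp_ode (N + 1) \<kappa> K s"
    and r: "R1 < r" "r < R2"
  shows "of_int k * (of_int k + N) * contour_integral (circlepath 0 r) (\<lambda>s. K s * s powi (- k - 1)) =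
    (of_int k * (of_int k - 1) - \<kappa>) * contour_integral (circlepath 0 r) (\<lambda>s. K s * s powi (- k))"
proof -
  define A where "A = {z::complex. R1 < norm z \<and> norm z < R2}"
  have oA: "open A" unfolding A_def by (rule open_annulus)
  have KA: "K holomorphic_on A" using K by (simp add: A_def)
  define g where "g s = of_int k * (of_int k + N) * (K s * s powi (- k - 1)) -
      (of_int k * (of_int k - 1) - \<kappa>) * (K s * s powi (- k))" for s
  have A0: "s \<noteq> 0" if "s \<in> A" for s using that R1 by (auto simp: A_def)
  have "(g has_contour_integral 0) (circlepath 0 r)"
  proof (rule Cauchy_theorem_primitive)
    fix s assume s: "s \<in> A"
    note s0 = A0[OF s]
    define p where "p = s powi (- k)"
    have K1: "(K has_field_derivative deriv K s) (at s)"
      and K2: "(deriv K has_field_derivative deriv (deriv K) s) (at s)"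
      using s KA oA by (auto intro!: holomorphic_derivI[of _ A] holomorphic_deriv)
    have P: "((\<lambda>s. s powi (- k)) has_field_derivative (- of_int k * p / s)) (at s)"
      using DERIV_power_int[OF DERIV_ident, where n = "- k" and x = s and s = UNIV] s0
      by (simp add: p_def power_int_diff)
    define G where "G s = - (s powi (- k) * (s * (1 - s) * deriv K s + N * K s + of_int k * (1 - s) * K s))" for s
    have "(G has_field_derivative
       - (p * ((1 - 2 * s) * deriv K s + s * (1 - s) * deriv (deriv K) s + N * deriv K s
           + (of_int k * (1 - s) * deriv K s - of_int k * K s))
         + (- of_int k * p / s) * (s * (1 - s) * deriv K s + N * K s + of_int k * (1 - s) * K s))) (at s)"
      unfolding G_def p_def
      by (rule derivative_eq_intros P[unfolded p_def] K1 K2 refl)+ (simp add: p_def algebra_simps)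
    \<comment> \<open>The derivative of G is g minus p times the left side of the equation.\<close>
    also have "- (p * ((1 - 2 * s) * deriv K s + s * (1 - s) * deriv (deriv K) s + N * deriv K s
           + (of_int k * (1 - s) * deriv K s - of_int k * K s))
         + (- of_int k * p / s) * (s * (1 - s) * deriv K s + N * K s + of_int k * (1 - s) * K s)) = 
        - (p * (s * (1 - s) * deriv (deriv K) s + (N + 1 - 2 * s) * deriv K s + \<kappa> * K s)) + g s"
    proof -
      have "s powi (- k - 1) = p / s" using s0 by (simp add: p_def power_int_diff)
      hence gs: "g s = of_int k * (of_int k + N) * (K s * (p / s)) - (of_int k * (of_int k - 1) - \<kappa>) * (K s * p)"
        by (simp add: g_def p_def)
      show ?thesis unfolding gs using s0 by (simp add: field_simps)
    qed
    also have "\<dots> = g s"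
      using ode[of s] s by (simp add: A_def hyp_ode_def)
    finally show "(G has_field_derivative g s) (at s within A)" by (rule DERIV_subset) auto
  qed (use annulus_path_image[OF R1 r] in \<open>auto simp: A_def\<close>)
  hence "contour_integral (circlepath 0 r) g = 0" by (rule contour_integral_unique)
  moreover have "contour_integral (circlepath 0 r) g =
     of_int k * (of_int k + N) * contour_integral (circlepath 0 r) (\<lambda>s. K s * s powi (- k - 1)) -
     (of_int k * (of_int k - 1) - \<kappa>) * contour_integral (circlepath 0 r) (\<lambda>s. K s * s powi (- k))"
  proof -
    have "(\<lambda>s. K s * s powi m) contour_integrable_on (circlepath 0 r)" for m
    proof (rule contour_integrable_continuous_circlepath)
      have "(\<lambda>s. K s * s powi m) holomorphic_on A"
        using A0 by (intro holomorphic_intros KA) auto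
      thus "continuous_on (path_image (circlepath 0 r)) (\<lambda>s. K s * s powi m)"
        using annulus_path_image[OF R1 r] unfolding A_def
        by (metis holomorphic_on_imp_continuous_on continuous_on_subset)
    qed
    thus ?thesis unfolding g_def
      by (subst contour_integral_diff) (auto simp: contour_integral_lmul intro!: contour_integrable_lmul)
  qed
  ultimately show ?thesis by simp
qed

text \<open>Up to the factor 2 pi i, \<open>a k\<close> is the k-th Laurent coefficient. At k = 0
  the left factor k (k + N) vanishes, which gives a (-1) = 0, and the nonvanishing right factors
  pass the zero on to all smaller indices. If a 0 were nonzero, so would be all later coefficients,
  with quotients tending to 1; this contradicts convergence on a circle of radius r > 1. Once a 0 =
  0, the left factors, nonzero for k > 0, carry the zero upwards.\<close>

theorem hyp_ode_annulus_trivial: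
  assumes K: "K holomorphic_on {z. R1 < norm z \<and> norm z < R2}" and R1: "1 \<le> R1"
    and ode: "\<And>s. R1 < norm s \<Longrightarrow> norm s < R2 \<Longrightarrow> hyp_ode (of_nat N + 1) \<kappa> K s"
    and ne: "\<And>k::int. of_int k * (of_int k - 1) \<noteq> \<kappa>"
    and \<zeta>: "R1 < norm \<zeta>" "norm \<zeta> < R2"
  shows "K \<zeta> = 0"
proof (rule laurent_coefficients_zero_imp_zero[OF K _ _ \<zeta>])
  fix r m assume r: "R1 < r" "r < R2"
  define a where "a k = contour_integral (circlepath 0 r) (\<lambda>s. K s * s powi (- k - 1))" for k
  have rec: "of_int k * (of_int k + of_nat N) * a k = (of_int k * (of_int k - 1) - \<kappa>) * a (k - 1)" for k
    using laurent_recursion[OF K _ ode r, of k] R1 by (simp add: a_def)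
  have nz: "of_int k * (of_int k - 1) - \<kappa> \<noteq> 0" for k using ne[of k] by simp
  have neg: "a (- int j - 1) = 0" for j
  proof (induction j)
    case 0
    thus ?case using rec[of 0] nz[of 0] by simp
  next
    case (Suc j)
    thus ?case using rec[of "- int j - 1"] nz[of "- int j - 1"] by simp
  qed
  have "a 0 = 0"
  proof (rule ccontr)
    assume a0: "a 0 \<noteq> 0"
    define b where "b j = a (int j)" for j
    have recb: "of_nat (Suc j) * (of_nat (Suc j) + of_nat N) * b (Suc j) = (of_nat (Suc j) * of_nat j - \<kappa>) * b j" for j
      using rec[of "int (Suc j)"] by (simp add: b_def)
    have nzb: "of_nat (Suc j) * of_nat j - \<kappa> \<noteq> 0" for j
      using nz[of "int (Suc j)"] by simp
    have b0: "b j \<noteq> 0" for j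
    proof (induction j)
      case (Suc j)
      show ?case
      proof
        assume "b (Suc j) = 0"
        hence "(of_nat (Suc j) * of_nat j - \<kappa>) * b j = 0" using recb[of j] by (metis mult_zero_right)
        thus False using Suc nzb[of j] by (metis mult_eq_0_iff)
      qed
    qed (use a0 in \<open>simp add: b_def\<close>)
    have x: "(\<lambda>j. 1 / of_nat (Suc j) :: complex) \<longlonglongrightarrow> 0"
      using LIMSEQ_inverse_real_of_nat[THEN tendsto_of_real, where 'a = complex]
      by (simp add: inverse_eq_divide del: of_nat_Suc)
    have "(\<lambda>j. (1 + of_nat N * (1 / of_nat (Suc j))) / (1 - 1 / of_nat (Suc j) - \<kappa> * (1 / of_nat (Suc j)) ^ 2))
        \<longlonglongrightarrow> (1 + of_nat N * 0) / (1 - 0 - \<kappa> * 0 ^ 2)"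
      by (intro tendsto_intros x) auto
    moreover have "b j / b (Suc j) =
       (1 + of_nat N * (1 / of_nat (Suc j))) / (1 - 1 / of_nat (Suc j) - \<kappa> * (1 / of_nat (Suc j)) ^ 2)" for j
    proof -
      define n where "n = (of_nat (Suc j) :: complex)"
      have n: "n \<noteq> 0" by (simp add: n_def del: of_nat_Suc)
      have nj: "of_nat j = n - 1" by (simp add: n_def)
      have "n * (n + of_nat N) * b (Suc j) = (n * (n - 1) - \<kappa>) * b j" "n * (n - 1) - \<kappa> \<noteq> 0"
        using recb[of j] nzb[of j] unfolding nj n_def[symmetric] by auto
      hence "b j / b (Suc j) = n * (n + of_nat N) / (n * (n - 1) - \<kappa>)"
        using b0[of "Suc j"] by (simp add: field_simps)
      also have "\<dots> = (n^2 * (1 + of_nat N * (1 / n))) / (n^2 * (1 - 1 / n - \<kappa> * (1 / n)^2))"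
        using n by (intro arg_cong2[where f = "(/)"]) (simp_all add: field_simps power2_eq_square)
      also have "\<dots> = (1 + of_nat N * (1 / n)) / (1 - 1 / n - \<kappa> * (1 / n)^2)"
        using n by (subst mult_divide_mult_cancel_left) auto
      finally show ?thesis by (simp only: n_def)
    qed
    ultimately have "(\<lambda>j. b j / b (Suc j)) \<longlonglongrightarrow> 1" by simp
    hence "(\<lambda>j. norm (b j) / norm (b (Suc j))) \<longlonglongrightarrow> 1"
      using tendsto_norm[of "\<lambda>j. b j / b (Suc j)" 1] by (simp add: norm_divide)
    hence cr: "conv_radius b = ereal 1"
      by (intro conv_radius_ratio_limit_nonzero[OF refl one_neq_zero])
    \<comment> \<open>A point between the radius of convergence 1 and r: the bound O(r^-j) on the
      coefficients makes the power series converge at t.\<close>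
    define t where "t = (1 + r) / 2"
    have t: "1 < t" "t < r" using r R1 by (auto simp: t_def)
    have "continuous_on (sphere 0 r) K"
      using holomorphic_on_imp_continuous_on[OF K] by (rule continuous_on_subset) (use r in auto)
    then obtain C where C: "\<And>m. norm (contour_integral (circlepath 0 r) (\<lambda>s. K s * s powi m)) \<le> C * r powi m"
      using contour_integral_power_int_bound[of r K] r R1 by (metis less_le_trans order.strict_trans zero_less_one order.trans less_imp_le not_le)
    have bb: "norm (b j * of_real t ^ j) \<le> C / r * (t / r) ^ j" for j
    proof -
      have "norm (b j) \<le> C * r powi (- int j - 1)" using C by (simp add: b_def a_def)
      also have "r powi (- int j - 1) = inverse (r ^ j) * inverse r"
        using r R1 by (simp add: power_int_diff power_int_minus divide_inverse)
      finally have "norm (b j) * t ^ j \<le> C * (inverse (r ^ j) * inverse r) * t ^ j"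
        using t by (intro mult_right_mono) auto
      thus ?thesis using t by (simp add: norm_mult norm_power power_divide divide_inverse power_mult_distrib power_inverse mult_ac)
    qed
    have "summable (\<lambda>j. C / r * (t / r) ^ j)"
      using t by (intro summable_mult summable_geometric) auto
    hence "summable (\<lambda>j. b j * of_real t ^ j)"
      by (rule summable_comparison_test') (use bb in auto)
    moreover have "\<not> summable (\<lambda>j. b j * of_real t ^ j)"
      by (rule not_summable_outside_conv_radius) (use t cr in auto)
    ultimately show False by blast
  qed
  have pos: "a (int j) = 0" for j
  proof (induction j)
    case (Suc j)
    have "of_int (int (Suc j)) * (of_int (int (Suc j)) + of_nat N) * a (int (Suc j)) = 0"
      using rec[of "int (Suc j)"] Suc by simp
    moreover have "of_int (int (Suc j)) * (of_int (int (Suc j)) + of_nat N) \<noteq> (0::complex)"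
      by (simp only: of_int_of_nat_eq of_nat_add[symmetric] of_nat_mult[symmetric] of_nat_eq_0_iff) simp
    ultimately show ?case by simp
  qed (use \<open>a 0 = 0\<close> in auto)
  have "a (- m - 1) = 0"
  proof (cases "- m - 1 \<ge> 0")
    case True
    thus ?thesis using pos[of "nat (- m - 1)"] by simp
  next
    case False
    thus ?thesis using neg[of "nat m"] by simp
  qed
  thus "contour_integral (circlepath 0 r) (\<lambda>s. K s * s powi m) = 0"
    by (simp add: a_def)
qed (use R1 in auto)

section \<open>Polynomial solutions\<close>

lemma deriv_poly: "deriv (poly p) = poly (pderiv p)"
  by (auto intro!: DERIV_imp_deriv poly_DERIV)

text \<open>Needed to pass from the slit plane to a neighbourhood of s = 1, which lies on the cut. A
  polynomial with infinitely many zeros is zero.\<close>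

lemma hyp_ode_poly_everywhere:
  assumes U: "open U" "U \<noteq> {}" and ode: "\<And>s. s \<in> U \<Longrightarrow> hyp_ode c \<kappa> (poly p) s"
  shows "hyp_ode c \<kappa> (poly p) s"
proof -
  define E where "E = [:0, 1, -1:] * pderiv (pderiv p) + [:c, -2:] * pderiv p + smult \<kappa> p"
  have E: "poly E s = s * (1 - s) * deriv (deriv (poly p)) s + (c - 2 * s) * deriv (poly p) s + \<kappa> * poly p s" for s
    unfolding deriv_poly by (simp add: E_def algebra_simps)
  have "U \<subseteq> {s. poly E s = 0}" using ode by (auto simp: E hyp_ode_def)
  moreover have "infinite U" using U by (metis finite_imp_not_open)
  ultimately have "E = 0" using poly_roots_finite finite_subset by blast
  thus ?thesis using E[of s] by (simp add: hyp_ode_def)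
qed

lemma has_fps_expansion_poly: "poly p has_fps_expansion fps_of_poly (p :: complex poly)"
proof (rule has_fps_expansionI, rule always_eventually, rule allI)
  fix u :: complex
  have "(\<lambda>n. fps_nth (fps_of_poly p) n * u ^ n) sums (\<Sum>n\<le>degree p. fps_nth (fps_of_poly p) n * u ^ n)"
    by (rule sums_finite) (auto simp: coeff_eq_0)
  thus "(\<lambda>n. fps_nth (fps_of_poly p) n * u ^ n) sums poly p u"
    by (simp add: poly_altdef)
qed

lemma hyp_ode_poly_coeff:
  assumes "\<And>s. hyp_ode c \<kappa> (poly p) s"
  shows "(of_nat j + 1) * (of_nat j + c) * coeff p (Suc j) = (of_nat j * (of_nat j + 1) - \<kappa>) * coeff p j"
proof -
  have "eventually (hyp_ode c \<kappa> (poly p)) (nhds 0)"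
    by (intro always_eventually allI assms)
  from hyp_ode_coeff[OF has_fps_expansion_poly this, of j] show ?thesis by simp
qed

text \<open>The reflection s = 1 - r exchanges the singular points 0 and 1; as the first two
  parameters add up to 1, it replaces c by 2 - c. The exponents at s = 1 are therefore 0 and
  N.\<close>

lemma hyp_ode_reflect_poly:
  assumes "\<And>s. hyp_ode (of_nat N + 1) \<kappa> (poly p) s"
  shows "hyp_ode (1 - of_nat N) \<kappa> (poly (pcompose p [:1, -1:])) r"
proof -
  have d: "poly (pderiv (pcompose p [:1, -1:])) r = - poly (pderiv p) (1 - r)"
    "poly (pderiv (pderiv (pcompose p [:1, -1:]))) r = poly (pderiv (pderiv p)) (1 - r)"
    by (auto simp: pderiv_pcompose poly_pcompose pderiv_pCons pderiv_mult pderiv_minus)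
  show ?thesis
    using assms[of "1 - r"] unfolding hyp_ode_def deriv_poly d by (simp add: poly_pcompose algebra_simps)
qed

text \<open>At index m the right factor of the recursion is zero, so the series at 0 stops. The
  coefficients of q, the expansion at s = 1, obey (j + 1)(j + 1 - N) q (j + 1) = (j (j + 1) -
  \<kappa>) q j, whose left factor vanishes at j = N - 1. If N \<le> m, this gives q (N - 1) = 0,
  and the right factors, nonzero below m, carry the zero down to q 0. If m < N and q 0 = 0, zeros
  propagate upwards to q (N - 1), beyond the degree, so that p = 0 against p(0) = 1.\<close>

theorem hyp_fun_exceptional:
  assumes \<kappa>: "\<kappa> = of_nat m * (of_nat m + 1)"
  shows "\<exists>p. (\<forall>s\<in>slit. hyp_fun N \<kappa> s = poly p s) \<and> (m < N \<longrightarrow> poly p 1 \<noteq> 0) \<and>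
    (N \<le> m \<longrightarrow> (\<exists>p'. \<forall>s. poly p s = (1 - s) ^ N * poly p' s))"
proof -
  define G where "G = fps_expansion (hyp_fun N \<kappa>) 0"
  have G: "hyp_fun N \<kappa> has_fps_expansion G"
    unfolding G_def by (rule analytic_at_imp_has_fps_expansion_0[OF analytic_hyp_fun_0])
  note rec = hyp_ode_coeff[OF G eventually_hyp_ode_hyp_fun]
  have pos: "(of_nat j + 1) * (of_nat j + (of_nat N + 1)) \<noteq> (0::complex)" for j
    using of_nat_neq_0[of j, where 'a = complex] of_nat_neq_0[of "j + N", where 'a = complex]
    by (simp add: add_ac)
  have G0: "fps_nth G (Suc m + i) = 0" for i
  proof (induction i)
    case 0
    have "(of_nat m + 1) * (of_nat m + (of_nat N + 1)) * fps_nth G (Suc m) = 0"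
      using rec[of m] by (simp add: \<kappa>)
    thus ?case using pos[of m] by simp
  next
    case (Suc i)
    thus ?case using rec[of "Suc m + i"] pos[of "Suc m + i"] by (metis add_Suc_right mult_eq_0_iff mult_zero_right)
  qed
  define p where "p = (\<Sum>j\<le>m. monom (fps_nth G j) j)"
  have cp: "coeff p j = fps_nth G j" for j
  proof (cases "j \<le> m")
    case False
    then obtain i where "j = Suc m + i" using less_imp_Suc_add by (metis add_Suc not_le)
    thus ?thesis using G0 by (simp add: p_def coeff_sum)
  qed (simp add: p_def coeff_sum)
  have "fps_of_poly p = G" by (rule fps_ext) (simp add: cp)
  hence ep: "poly p has_fps_expansion G"
    using has_fps_expansion_poly[of p] by simp
  have eq: "hyp_fun N \<kappa> s = poly p s" if s: "s \<in> slit" for s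
  proof -
    have "(\<lambda>s. hyp_fun N \<kappa> s - poly p s) has_fps_expansion (G - G)"
      by (intro fps_expansion_intros G ep)
    hence "(\<lambda>s. hyp_fun N \<kappa> s - poly p s) has_fps_expansion 0" by simp
    hence "hyp_fun N \<kappa> s - poly p s = 0"
      by (rule has_fps_expansion_0_analytic_continuation[OF _ _ open_slit connected_slit zero_in_slit s])
         (intro holomorphic_intros holomorphic_hyp_fun)
    thus ?thesis by simp
  qed
  have ode: "hyp_ode (of_nat N + 1) \<kappa> (poly p) s" for s
  proof (rule hyp_ode_poly_everywhere[OF open_slit])
    fix s assume s: "s \<in> slit"
    show "hyp_ode (of_nat N + 1) \<kappa> (poly p) s"
      using hyp_ode_hyp_fun[OF s] hyp_ode_cong[OF open_slit s, of "poly p" "hyp_fun N \<kappa>"] eq by simp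
  qed (use zero_in_slit in blast)
  define q where "q = pcompose p [:1, -1:]"
  have pq: "poly p s = poly q (1 - s)" for s by (simp add: q_def poly_pcompose)
  note recq = hyp_ode_poly_coeff[OF hyp_ode_reflect_poly[OF ode], folded q_def]
  have \<kappa>': "of_nat j * (of_nat j + 1) - \<kappa> \<noteq> 0" if "j < m" for j
  proof -
    have "j * (j + 1) < m * (m + 1)" using that by (intro mult_strict_mono) auto
    hence "of_nat (j * (j + 1)) \<noteq> (of_nat (m * (m + 1)) :: complex)" unfolding of_nat_eq_iff by simp
    moreover have "of_nat i * (of_nat i + 1) = (of_nat (i * (i + 1)) :: complex)" for i by (simp add: algebra_simps)
    ultimately show ?thesis unfolding \<kappa> by (metis right_minus_eq)
  qed
  show ?thesis
  proof (rule exI[of _ p], intro conjI impI)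
    show "poly p 1 \<noteq> 0" if "m < N"
    proof
      assume "poly p 1 = 0"
      hence q0: "coeff q 0 = 0" using pq[of 1] by (simp add: poly_0_coeff_0)
      have "coeff q j = 0" if "j < N" for j
        using that
      proof (induction j)
        case (Suc j)
        have "(of_nat j + 1) * (of_nat j + (1 - of_nat N)) * coeff q (Suc j) = 0"
          using recq[of j] Suc by simp
        moreover have "of_nat j + (1 - of_nat N) \<noteq> (0::complex)"
        proof
          assume "of_nat j + (1 - of_nat N) = (0::complex)"
          hence "of_nat (Suc j) = (of_nat N :: complex)" by (simp add: algebra_simps)
          hence "Suc j = N" by (simp only: of_nat_eq_iff)
          thus False using Suc by simp
        qed
        moreover have "of_nat j + 1 \<noteq> (0::complex)" using of_nat_neq_0[of j, where 'a = complex] by (simp add: add_ac)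
        ultimately show ?case by simp
      qed (use q0 in simp)
      moreover have "degree q < N"
      proof -
        have "degree p \<le> m" by (rule degree_le) (metis cp G0 less_imp_Suc_add add_Suc)
        moreover have "degree q \<le> degree p * degree [:1, -1::complex:]"
          unfolding q_def by (rule degree_pcompose_le)
        ultimately show ?thesis using \<open>m < N\<close> by simp
      qed
      ultimately have "coeff q j = 0" for j by (cases "j < N") (auto simp: coeff_eq_0)
      hence "q = 0" by (intro poly_eqI) simp
      hence "poly p 0 = 0" using pq[of 0] by simp
      thus False using eq[of 0] hyp_fun_0 by simp
    qed
    show "\<exists>p'. \<forall>s. poly p s = (1 - s) ^ N * poly p' s" if "N \<le> m"
    proof -
      have "coeff q (N - Suc i) = 0" if "i < N" for i
        using that
      proof (induction i)
        case 0
        have "of_nat (N - 1) + (1 - of_nat N) = (0::complex)" using 0 by (cases N) auto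
        thus ?case using recq[of "N - 1"] \<kappa>'[of "N - 1"] 0 \<open>N \<le> m\<close> by simp
      next
        case (Suc i)
        have "coeff q (Suc (N - Suc (Suc i))) = 0" using Suc by (simp add: Suc_diff_Suc)
        thus ?case using recq[of "N - Suc (Suc i)"] \<kappa>'[of "N - Suc (Suc i)"] Suc.prems \<open>N \<le> m\<close> by simp
      qed
      hence "coeff q k = 0" if "k < N" for k
        using that by (metis Suc_diff_Suc diff_diff_cancel diff_less less_imp_le_nat not_less_zero zero_less_Suc neq0_conv diff_Suc_less Suc_leI)
      hence "monom 1 N dvd q" by (simp add: monom_1_dvd_iff')
      then obtain q' where "q = monom 1 N * q'" by (auto elim: dvdE)
      hence "poly p s = (1 - s) ^ N * poly (pcompose q' [:1, -1:]) s" for s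
        by (simp add: pq poly_monom poly_pcompose)
      thus ?thesis by blast
    qed
  qed (use eq in auto)
qed

section \<open>Charts\<close>

text \<open>If V contains 0, the image contains infinity, and its complement comes from the set C,
  which is closed and, as V contains a ball of radius e, bounded by 1 / e; hence C is
  compact.\<close>

lemma open_map_sph_inverse:
  fixes V :: "complex set"
  assumes V: "open V"
  shows "openin (Alexandroff_compactification euclidean) ((\<lambda>v. sph_inverse (Some v)) ` V)"
proof (cases "0 \<in> V")
  case False
  have "(\<lambda>v. sph_inverse (Some v)) ` V = Some ` (inverse ` V)"
    using False by (force simp: image_iff divide_inverse)
  moreover have "inverse ` V = inverse -` V \<inter> (- {0})"
    using False by (force simp: image_iff intro: inverse_inverse_eq[symmetric])
  moreover have "open (inverse -` V \<inter> (- {0::complex}))"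
  proof -
    have "continuous_on (- {0::complex}) inverse" by (intro continuous_intros) auto
    hence "open ((- {0::complex}) \<inter> inverse -` V)"
      using V by (intro continuous_open_preimage) auto
    thus ?thesis by (simp add: Int_commute)
  qed
  ultimately show ?thesis by simp
next
  case True
  \<comment> \<open>The point 0 is added by hand: it is the inverse of infinity only, but
    \<open>inverse 0 = 0\<close> lies in V, so the second condition alone would miss it.\<close>
  define C where "C = {b::complex. b = 0 \<or> inverse b \<notin> V}"
  obtain e where e: "e > 0" "ball 0 e \<subseteq> V" using V True by (auto simp: open_contains_ball)
  have cl: "closed C"
  proof -
    have "- C = (- {0}) \<inter> inverse -` V" by (auto simp: C_def)
    moreover have "continuous_on (- {0::complex}) inverse" by (intro continuous_intros) auto
    hence "open ((- {0::complex}) \<inter> inverse -` V)"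
      using V by (intro continuous_open_preimage) auto
    ultimately show ?thesis by (simp add: closed_def)
  qed
  have "norm b \<le> inverse e" if "b \<in> C" for b
  proof (cases "b = 0")
    case False
    hence "inverse b \<notin> ball 0 e" using that e by (auto simp: C_def)
    hence "e \<le> inverse (norm b)" by (simp add: norm_inverse)
    thus ?thesis using e False by (metis inverse_inverse_eq le_imp_inverse_le)
  qed (use e in auto)
  hence "bounded C" by (auto simp: bounded_iff)
  hence "compact C" using cl by (simp add: compact_eq_bounded_closed)
  moreover have "(\<lambda>v. sph_inverse (Some v)) ` V = topspace (Alexandroff_compactification euclidean) - Some ` C"
  proof (intro set_eqI iffI)
    fix p assume "p \<in> (\<lambda>v. sph_inverse (Some v)) ` V"
    thus "p \<in> topspace (Alexandroff_compactification euclidean) - Some ` C"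
      by (auto simp: C_def divide_inverse)
  next
    fix p assume p: "p \<in> topspace (Alexandroff_compactification euclidean) - Some ` C"
    show "p \<in> (\<lambda>v. sph_inverse (Some v)) ` V"
    proof (cases p)
      case None
      thus ?thesis using True by (auto simp: image_iff intro!: bexI[of _ 0])
    next
      case (Some b)
      hence "b \<noteq> 0" "inverse b \<in> V" using p by (auto simp: C_def)
      thus ?thesis using Some by (auto simp: image_iff divide_inverse intro!: bexI[of _ "inverse b"])
    qed
  qed
  moreover have "topspace (Alexandroff_compactification euclidean) - Some ` C = insert None (Some ` (UNIV - C))"
    by auto
  ultimately show ?thesis
    using cl by (auto simp only: openin_Alexandroff_compactification compactin_euclidean_iff closed_closedin topspace_euclidean)
qed

lemma continuous_map_sph_inverse:
  "continuous_map euclidean (Alexandroff_compactification euclidean) (\<lambda>v::complex. sph_inverse (Some v))"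
proof (rule continuous_map_openin_preimage_eq[THEN iffD2], intro conjI allI impI)
  fix W :: "complex option set"
  assume W: "openin (Alexandroff_compactification euclidean) W"
  have inv: "continuous_on (- {0::complex}) inverse" by (intro continuous_intros) auto
  have "open ((\<lambda>v. sph_inverse (Some v)) -` W)"
  proof -
    consider U where "open U" "W = Some ` U"
      | C where "compact C" "closed C" "W = topspace (Alexandroff_compactification euclidean) - Some ` C"
    proof -
      have "insert None (Some ` (UNIV - C)) = topspace (Alexandroff_compactification euclidean) - Some ` C"
        for C :: "complex set" by auto
      thus ?thesis
        using W that unfolding openin_Alexandroff_compactification topspace_euclidean compactin_euclidean_iff
          closed_closedin[symmetric] open_openin[symmetric] by metis
    qed
    thus ?thesis
    proof cases
      case 1
      have "(\<lambda>v. sph_inverse (Some v)) -` W = (- {0}) \<inter> inverse -` U"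
        by (auto simp: 1 divide_inverse split: if_splits)
      thus ?thesis using continuous_open_preimage[OF inv open_Compl[OF closed_singleton] 1(1)] by simp
    next
      case 2
      obtain B where B: "B > 0" "\<And>c. c \<in> C \<Longrightarrow> norm c \<le> B"
        using compact_imp_bounded[OF 2(1)] by (auto simp: bounded_pos)
      \<comment> \<open>The point v = 0 goes to infinity, which lies in W. The first set misses it,
        and the ball supplies its neighbourhood.\<close>
      have "(\<lambda>v. sph_inverse (Some v)) -` W = ((- {0}) \<inter> inverse -` (- C)) \<union> ball 0 (inverse B)"
      proof (intro set_eqI iffI)
        fix v assume "v \<in> (\<lambda>v. sph_inverse (Some v)) -` W"
        thus "v \<in> ((- {0}) \<inter> inverse -` (- C)) \<union> ball 0 (inverse B)"
          using B(1) by (auto simp: 2(3) divide_inverse split: if_splits)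
      next
        fix v assume v: "v \<in> ((- {0}) \<inter> inverse -` (- C)) \<union> ball 0 (inverse B)"
        have "inverse v \<notin> C" if "v \<noteq> 0" "norm v < inverse B"
        proof
          assume "inverse v \<in> C"
          hence "inverse (norm v) \<le> B" using B(2)[of "inverse v"] by (simp add: norm_inverse)
          hence "inverse B \<le> norm v" using that by (metis inverse_inverse_eq le_imp_inverse_le
             positive_imp_inverse_positive zero_less_norm_iff)
          thus False using that by simp
        qed
        thus "v \<in> (\<lambda>v. sph_inverse (Some v)) -` W"
          using v by (auto simp: 2(3) divide_inverse)
      qed
      moreover have "open ((- {0::complex}) \<inter> inverse -` (- C))"
        using continuous_open_preimage[OF inv, of "- C"] 2(2) by auto
      ultimately show ?thesis by auto
    qed
  qed
  thus "openin euclidean (topspace euclidean \<inter> (\<lambda>v. sph_inverse (Some v)) -` W)" by simp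
qed auto

lemma continuous_std_param: "continuous_map euclidean sphere2_top std_param"
  unfolding sphere2_top_def std_param_def case_prod_unfold
  by (intro continuous_map_pairedI continuous_map_compose[OF _ continuous_map_Some, unfolded o_def])
     (auto intro: continuous_intros)

lemma continuous_flip_param: "continuous_map euclidean sphere2_top flip_param"
  unfolding sphere2_top_def flip_param_def case_prod_unfold
  by (intro continuous_map_pairedI continuous_map_compose[OF _ continuous_map_sph_inverse, unfolded o_def])
     (auto intro: continuous_intros)

lemma openin_std_param_image:
  assumes "open U"
  shows "openin sphere2_top (std_param ` U)"
proof (subst openin_subopen, intro ballI)
  fix p assume "p \<in> std_param ` U"
  then obtain u v where p: "p = std_param (u, v)" "(u, v) \<in> U" by auto
  obtain A B where AB: "open A" "open B" "(u, v) \<in> A \<times> B" "A \<times> B \<subseteq> U"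
    using open_prod_elim[OF assms p(2)] by blast
  have "openin sphere2_top (Some ` A \<times> Some ` B)"
    unfolding sphere2_top_def using AB by (simp add: openin_prod_Times_iff)
  moreover have "p \<in> Some ` A \<times> Some ` B" "Some ` A \<times> Some ` B \<subseteq> std_param ` U"
    using AB p by (force simp: std_param_def)+
  ultimately show "\<exists>T. openin sphere2_top T \<and> p \<in> T \<and> T \<subseteq> std_param ` U" by blast
qed

lemma openin_flip_param_image:
  assumes "open U"
  shows "openin sphere2_top (flip_param ` U)"
proof (subst openin_subopen, intro ballI)
  fix p assume "p \<in> flip_param ` U"
  then obtain u v where p: "p = flip_param (u, v)" "(u, v) \<in> U" by auto
  obtain A B where AB: "open A" "open B" "(u, v) \<in> A \<times> B" "A \<times> B \<subseteq> U"
    using open_prod_elim[OF assms p(2)] by blast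
  let ?f = "\<lambda>v. sph_inverse (Some v)"
  have "openin sphere2_top (?f ` B \<times> ?f ` A)"
    unfolding sphere2_top_def using AB open_map_sph_inverse by (simp add: openin_prod_Times_iff del: sph_inverse.simps)
  moreover have "p \<in> ?f ` B \<times> ?f ` A"
    unfolding p(1) flip_param_def using AB(3) by (simp del: sph_inverse.simps)
  moreover have "?f ` B \<times> ?f ` A \<subseteq> flip_param ` U"
  proof
    fix x assume "x \<in> ?f ` B \<times> ?f ` A"
    then obtain a b where ab: "a \<in> A" "b \<in> B" "x = (?f b, ?f a)" by auto
    hence "x = flip_param (a, b)" by (simp add: flip_param_def)
    moreover have "(a, b) \<in> U" using ab AB(4) by auto
    ultimately show "x \<in> flip_param ` U" by blast
  qed
  ultimately show "\<exists>T. openin sphere2_top T \<and> p \<in> T \<and> T \<subseteq> flip_param ` U" by blast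
qed

lemma topspace_sphere2 [simp]: "topspace sphere2_top = UNIV"
proof -
  have "x \<in> range Some" if "x \<noteq> None" for x :: csphere
    using that by (cases x) auto
  thus ?thesis by (force simp: sphere2_top_def)
qed

text \<open>The convention that 0 times infinity is 1 removes (0, infinity) and (infinity, 0) from
  \<open>Omega\<close>. These are the only points of the product of spheres that neither chart
  reaches.\<close>

lemma Omega_charts:
  assumes "p \<in> Omega"
  obtains q where "p = std_param q" | u v where "p = flip_param (u, v)" "u = 0 \<or> v = 0"
proof -
  obtain z w where p: "p = (z, w)" by (cases p)
  have flip: "flip_param (u, v) = (if v = 0 then None else Some (1 / v), if u = 0 then None else Some (1 / u))" for u v
    by (simp add: flip_param_def)
  show ?thesis
  proof (cases z; cases w)
    assume "z = None" "w = None"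
    thus ?thesis using that(2)[of 0 0] p by (simp add: flip)
  next
    fix b assume zw: "z = None" "w = Some b"
    hence "b \<noteq> 0" using assms p by (auto simp: Omega_def)
    thus ?thesis using that(2)[of "1 / b" 0] p zw by (simp add: flip)
  next
    fix a assume zw: "z = Some a" "w = None"
    hence "a \<noteq> 0" using assms p by (auto simp: Omega_def)
    thus ?thesis using that(2)[of 0 "1 / a"] p zw by (simp add: flip)
  next
    fix a b assume zw: "z = Some a" "w = Some b"
    thus ?thesis using that(1)[of "(a, b)"] p by (simp add: std_param_def)
  qed
qed

lemma open_std_vimage: "openin sphere2_top S \<Longrightarrow> open (std_param -` S)"
  using continuous_std_param by (auto simp: continuous_map_openin_preimage_eq)

lemma open_flip_vimage: "openin sphere2_top S \<Longrightarrow> open (flip_param -` S)"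
  using continuous_flip_param by (auto simp: continuous_map_openin_preimage_eq)

lemma openin_sphere2_iff:
  assumes "S \<subseteq> Omega"
  shows "openin sphere2_top S \<longleftrightarrow> open (std_param -` S) \<and> open (flip_param -` S)"
proof
  assume "open (std_param -` S) \<and> open (flip_param -` S)"
  hence "openin sphere2_top (std_param ` (std_param -` S) \<union> flip_param ` (flip_param -` S))"
    by (intro openin_Un openin_std_param_image openin_flip_param_image) auto
  moreover have "std_param ` (std_param -` S) \<union> flip_param ` (flip_param -` S) = S"
  proof -
    have "p \<in> std_param ` (std_param -` S) \<union> flip_param ` (flip_param -` S)" if "p \<in> S" for p
      using that assms by (metis (no_types, lifting) Omega_charts UnI1 UnI2 image_vimage_eq IntI rangeI subsetD)
    thus ?thesis by blast
  qed
  ultimately show "openin sphere2_top S" by simp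
qed (auto intro: open_std_vimage open_flip_vimage)

lemma std_param_in_Omega: "std_param (z, w) \<in> Omega \<longleftrightarrow> z * w \<noteq> 1"
  by (simp add: std_param_def Omega_def)

lemma flip_param_in_Omega: "flip_param (u, v) \<in> Omega \<longleftrightarrow> u * v \<noteq> 1"
  by (auto simp: flip_param_def Omega_def divide_simps mult.commute)

lemma flip_param_eq_std: "u \<noteq> 0 \<Longrightarrow> v \<noteq> 0 \<Longrightarrow> flip_param (u, v) = std_param (1 / v, 1 / u)"
  by (simp add: flip_param_def std_param_def)

text \<open>Along the curve (u + t, v + i t) the imaginary part of the product is a real quadratic
  polynomial in t with leading coefficient 1. Its second difference over 0, e / 4, e / 2 is e^2 / 8,
  so it cannot vanish at all three points. Points with nonreal product lie in
  \<open>Omega_star\<close> and have nonzero coordinates, so both charts apply to them.\<close>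

lemma open_meets_nonreal:
  fixes V :: "(complex \<times> complex) set"
  assumes "open V" "V \<noteq> {}"
  obtains u v where "(u, v) \<in> V" "Im (u * v) \<noteq> 0"
proof -
  obtain u v where uv: "(u, v) \<in> V" using assms by auto
  then obtain e where e: "e > 0" "ball (u, v) e \<subseteq> V"
    using assms(1) by (auto simp: open_contains_ball)
  define f where "f t = Im ((u + of_real t) * (v + of_real t * \<i>))" for t
  have f: "f t = Im (u * v) + t * (Im v + Re u) + t^2" for t
    by (simp add: f_def power2_eq_square algebra_simps)
  have V: "(u + of_real t, v + of_real t * \<i>) \<in> V" if "0 \<le> t" "t \<le> e / 2" for t
  proof -
    have "dist (u, v) (u + of_real t, v + of_real t * \<i>) = sqrt (t^2 + t^2)"
      using that by (simp add: dist_Pair_Pair dist_norm norm_mult norm_Pair)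
    also have "\<dots> < sqrt (e^2)"
    proof -
      have "t^2 \<le> (e/2)^2" using that by (intro power_mono)
      moreover have "(e/2)^2 = e^2 / 4" "e^2 > 0" using e by (simp_all add: power_divide)
      ultimately have "t^2 + t^2 < e^2" by linarith
      thus ?thesis by (rule real_sqrt_less_mono)
    qed
    also have "\<dots> = e" using e by simp
    finally have "(u + of_real t, v + of_real t * \<i>) \<in> ball (u, v) e" by simp
    thus ?thesis using e by blast
  qed
  have "f (e / 2) - 2 * f (e / 4) + f 0 = e^2 / 8"
    unfolding f by (simp add: power_divide algebra_simps)
  moreover have "e^2 / 8 \<noteq> 0" using e by simp
  ultimately have "f (e / 2) \<noteq> 0 \<or> f (e / 4) \<noteq> 0 \<or> f 0 \<noteq> 0" by auto
  hence "\<exists>t. 0 \<le> t \<and> t \<le> e / 2 \<and> f t \<noteq> 0"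
    using e(1) by (elim disjE) (auto intro: exI[of _ "e / 2"] exI[of _ "e / 4"] exI[of _ 0])
  then obtain t where "0 \<le> t" "t \<le> e / 2" "f t \<noteq> 0" by blast
  with that[OF V] show ?thesis unfolding f_def by blast
qed

section \<open>Holomorphic functions of two variables\<close>

definition holo2_at :: "(complex \<times> complex \<Rightarrow> complex) \<Rightarrow> complex \<times> complex \<Rightarrow> bool" where
  "holo2_at g p \<longleftrightarrow> (\<exists>a b. (g has_derivative (\<lambda>(h, k). a * h + b * k)) (at p))"

lemma holomorphic2_on_iff: "holomorphic2_on g U \<longleftrightarrow> (\<forall>p\<in>U. holo2_at g p)"
  by (simp add: holomorphic2_on_def holo2_at_def)

lemma holo2_at_const: "holo2_at (\<lambda>p. c) p"
  unfolding holo2_at_def by (rule exI[of _ 0], rule exI[of _ 0]) (auto intro!: derivative_eq_intros simp: case_prod_unfold)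

lemma holo2_at_fst: "holo2_at fst p"
  unfolding holo2_at_def by (rule exI[of _ 1], rule exI[of _ 0]) (auto intro!: derivative_eq_intros simp: case_prod_unfold)

lemma holo2_at_snd: "holo2_at snd p"
  unfolding holo2_at_def by (rule exI[of _ 0], rule exI[of _ 1]) (auto intro!: derivative_eq_intros simp: case_prod_unfold)

lemma holo2_at_diff:
  assumes "holo2_at f p" "holo2_at g p"
  shows "holo2_at (\<lambda>q. f q - g q) p"
proof -
  obtain a b c d where "(f has_derivative (\<lambda>(h, k). a * h + b * k)) (at p)"
    "(g has_derivative (\<lambda>(h, k). c * h + d * k)) (at p)"
    using assms by (auto simp: holo2_at_def)
  from has_derivative_diff[OF this]
  have "((\<lambda>q. f q - g q) has_derivative (\<lambda>(h, k). (a - c) * h + (b - d) * k)) (at p)"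
    by (rule has_derivative_eq_rhs) (auto simp: algebra_simps)
  thus ?thesis by (auto simp: holo2_at_def)
qed

lemma holo2_at_mult:
  assumes "holo2_at f p" "holo2_at g p"
  shows "holo2_at (\<lambda>q. f q * g q) p"
proof -
  obtain a b c d where "(f has_derivative (\<lambda>(h, k). a * h + b * k)) (at p)"
    "(g has_derivative (\<lambda>(h, k). c * h + d * k)) (at p)"
    using assms by (auto simp: holo2_at_def)
  from has_derivative_mult[OF this]
  have "((\<lambda>q. f q * g q) has_derivative (\<lambda>(h, k). (f p * c + a * g p) * h + (f p * d + b * g p) * k)) (at p)"
    by (rule has_derivative_eq_rhs) (auto simp: algebra_simps)
  thus ?thesis unfolding holo2_at_def by blast
qed

lemma holo2_at_compose:
  assumes "holo2_at g p" "f field_differentiable (at (g p))"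
  shows "holo2_at (\<lambda>q. f (g q)) p"
proof -
  obtain a b where "(g has_derivative (\<lambda>(h, k). a * h + b * k)) (at p)"
    using assms by (auto simp: holo2_at_def)
  moreover obtain d where "(f has_derivative (\<lambda>h. d * h)) (at (g p))"
    using assms(2) by (auto simp: field_differentiable_def has_field_derivative_def)
  ultimately have "((\<lambda>q. f (g q)) has_derivative (\<lambda>x. d * (case x of (h, k) \<Rightarrow> a * h + b * k))) (at p)"
    by (rule has_derivative_compose)
  hence "((\<lambda>q. f (g q)) has_derivative (\<lambda>(h, k). (d * a) * h + (d * b) * k)) (at p)"
    by (rule has_derivative_eq_rhs) (auto simp: algebra_simps)
  thus ?thesis unfolding holo2_at_def by blast
qed

lemma holo2_at_power: "holo2_at g p \<Longrightarrow> holo2_at (\<lambda>q. g q ^ n) p"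
  by (rule holo2_at_compose[where f = "\<lambda>x. x ^ n"]) (auto intro!: derivative_intros)

lemma holo2_at_divide:
  assumes "holo2_at f p" "holo2_at g p" "g p \<noteq> 0"
  shows "holo2_at (\<lambda>q. f q / g q) p"
  unfolding divide_inverse
  by (intro holo2_at_mult assms(1) holo2_at_compose[OF assms(2), where f = inverse])
     (use assms(3) in \<open>auto intro!: derivative_intros\<close>)

lemmas holo2_intros = holo2_at_const holo2_at_fst holo2_at_snd holo2_at_diff holo2_at_mult
  holo2_at_power holo2_at_divide

lemma holo2_at_cong:
  assumes "open U" "p \<in> U" "\<And>q. q \<in> U \<Longrightarrow> f q = g q"
  shows "holo2_at f p \<longleftrightarrow> holo2_at g p"
  unfolding holo2_at_def
  using has_derivative_transform_within_open[OF _ assms(1,2)] assms(3) by metis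

lemma holo2_at_curve:
  assumes "holo2_at g (\<phi> t, \<psi> t)" "\<phi> field_differentiable (at t)" "\<psi> field_differentiable (at t)"
  shows "(\<lambda>t. g (\<phi> t, \<psi> t)) field_differentiable (at t)"
proof -
  obtain a b where g: "(g has_derivative (\<lambda>(h, k). a * h + b * k)) (at (\<phi> t, \<psi> t))"
    using assms by (auto simp: holo2_at_def)
  obtain d e where de: "(\<phi> has_derivative (\<lambda>h. d * h)) (at t)" "(\<psi> has_derivative (\<lambda>h. e * h)) (at t)"
    using assms by (auto simp: field_differentiable_def has_field_derivative_def)
  have "((\<lambda>t. g (\<phi> t, \<psi> t)) has_derivative (\<lambda>x. case (d * x, e * x) of (h, k) \<Rightarrow> a * h + b * k)) (at t)"
    using has_derivative_compose[OF has_derivative_Pair[OF de] g] by simp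
  hence "((\<lambda>t. g (\<phi> t, \<psi> t)) has_derivative (\<lambda>x. (a * d + b * e) * x)) (at t)"
    by (rule has_derivative_eq_rhs) (auto simp: algebra_simps)
  thus ?thesis by (auto simp: field_differentiable_def has_field_derivative_def)
qed

lemma continuous_holo2_at: "holo2_at g p \<Longrightarrow> isCont g p"
  unfolding holo2_at_def by (auto dest: has_derivative_continuous)

text \<open>Restriction to complex lines reduces this to the identity theorem in one variable.\<close>

lemma holo2_identity_convex:
  assumes U: "open U" "convex U" and g: "\<And>p. p \<in> U \<Longrightarrow> holo2_at g p"
    and V: "open V" "V \<noteq> {}" "V \<subseteq> U" "\<And>p. p \<in> V \<Longrightarrow> g p = 0" and q: "q \<in> U"
  shows "g q = 0"
proof -
  obtain p where p: "p \<in> V" using V by auto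
  define \<phi> where "\<phi> t = fst p + t * (fst q - fst p)" for t
  define \<psi> where "\<psi> t = snd p + t * (snd q - snd p)" for t
  define L where "L t = (\<phi> t, \<psi> t)" for t
  have L01: "L 0 = p" "L 1 = q" by (auto simp: L_def \<phi>_def \<psi>_def)
  have contL: "continuous_on UNIV L"
    unfolding L_def \<phi>_def \<psi>_def by (intro continuous_intros)
  define A where "A = L -` U"
  have "open A" unfolding A_def by (intro open_vimage U contL)
  have "convex A"
  proof (rule convexI)
    fix s t :: complex and x y :: real
    assume st: "s \<in> A" "t \<in> A" "0 \<le> x" "0 \<le> y" "x + y = 1"
    have xy: "y = 1 - x" using st by simp
    have "L (x *\<^sub>R s + y *\<^sub>R t) = x *\<^sub>R L s + y *\<^sub>R L t"
      unfolding xy L_def \<phi>_def \<psi>_def by (simp add: scaleR_conv_of_real algebra_simps)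
    thus "x *\<^sub>R s + y *\<^sub>R t \<in> A" using st U(2) by (auto simp: A_def convex_def)
  qed
  hence "connected A" by (rule convex_connected)
  have hol: "(\<lambda>t. g (L t)) holomorphic_on A"
    unfolding holomorphic_on_def
  proof
    fix t assume "t \<in> A"
    hence "holo2_at g (\<phi> t, \<psi> t)" using g by (auto simp: A_def L_def)
    hence "(\<lambda>t. g (\<phi> t, \<psi> t)) field_differentiable (at t)"
      by (rule holo2_at_curve) (auto simp: \<phi>_def[abs_def] \<psi>_def[abs_def] intro!: derivative_intros)
    thus "(\<lambda>t. g (L t)) field_differentiable at t within A"
      by (auto simp: L_def intro: field_differentiable_at_within)
  qed
  have oV: "open (L -` V)" by (intro open_vimage V contL)
  have "g (L 1) = 0"
  proof (rule analytic_continuation_open[where f = "\<lambda>t. g (L t)" and g = "\<lambda>_. 0" and s = "L -` V" and s' = A])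
    show "L -` V \<noteq> {}" using p L01 by (metis empty_iff vimageI)
  qed (use oV \<open>open A\<close> \<open>connected A\<close> hol V q L01 in \<open>auto simp: A_def\<close>)
  thus ?thesis by (simp add: L01)
qed

text \<open>G = 0 has to imply P throughout the chart, but the converse is asked only where the
  product of the coordinates is nonreal: P may hold vacuously at points at infinity, where it says
  nothing about G. Since V meets the nonreal points in an open set, G vanishes on an open set and
  hence on B.\<close>

lemma chart_propagation:
  fixes P :: "csphere \<times> csphere \<Rightarrow> bool"
  assumes cont: "continuous_map euclidean sphere2_top \<pi>"
    and B: "open B" "convex B" and G: "\<And>q. q \<in> B \<Longrightarrow> holo2_at G q"
    and GP: "\<And>q. q \<in> B \<Longrightarrow> G q = 0 \<Longrightarrow> P (\<pi> q)"
    and PG: "\<And>q. q \<in> B \<Longrightarrow> Im (fst q * snd q) \<noteq> 0 \<Longrightarrow> P (\<pi> q) \<Longrightarrow> G q = 0"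
    and V: "openin sphere2_top V" "V \<noteq> {}" "V \<subseteq> \<pi> ` B" "\<And>p. p \<in> V \<Longrightarrow> P p"
    and p: "p \<in> \<pi> ` B"
  shows "P p"
proof -
  define W where "W = (\<pi> -` V \<inter> B) \<inter> (\<lambda>q. Im (fst q * snd q)) -` (- {0})"
  have oV: "open (\<pi> -` V)"
    using cont V(1) by (auto simp: continuous_map_openin_preimage_eq)
  have W1: "open (\<pi> -` V \<inter> B)" using oV B by auto
  have W2: "\<pi> -` V \<inter> B \<noteq> {}" using V(2,3) by blast
  have "open W"
    unfolding W_def by (intro open_Int W1(1) open_vimage) (auto intro!: continuous_intros)
  moreover have "W \<noteq> {}"
  proof -
    obtain u v where "(u, v) \<in> \<pi> -` V \<inter> B" "Im (u * v) \<noteq> 0"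
      by (rule open_meets_nonreal[OF W1 W2])
    hence "(u, v) \<in> W" unfolding W_def by simp
    thus ?thesis by blast
  qed
  moreover have "W \<subseteq> B" by (auto simp: W_def)
  moreover have "G q = 0" if "q \<in> W" for q
    using that PG V(4) by (auto simp: W_def)
  moreover obtain q where "q \<in> B" "p = \<pi> q" using p by auto
  ultimately show ?thesis using holo2_identity_convex[OF B, of G W q] G GP by blast
qed

text \<open>The points around which \<open>P\<close> holds and those around which it holds on no open set are two
  disjoint open sets; on each chart the function \<open>G\<close> whose zeros detect \<open>P\<close> shows that they
  cover \<open>T\<close>.\<close>

theorem sphere_propagation:
  fixes P :: "csphere \<times> csphere \<Rightarrow> bool"
  assumes T: "openin sphere2_top T" "T \<subseteq> Omega" and S: "connectedin sphere2_top S" "S \<subseteq> T"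
    and G1: "holomorphic2_on G1 (std_param -` T)" "\<And>q. q \<in> std_param -` T \<Longrightarrow> G1 q = 0 \<longleftrightarrow> P (std_param q)"
    and G2: "holomorphic2_on G2 (flip_param -` T)" "\<And>q. q \<in> flip_param -` T \<Longrightarrow> G2 q = 0 \<Longrightarrow> P (flip_param q)"
      "\<And>q. q \<in> flip_param -` T \<Longrightarrow> Im (fst q * snd q) \<noteq> 0 \<Longrightarrow> P (flip_param q) \<Longrightarrow> G2 q = 0"
    and start: "x \<in> S" "openin sphere2_top V" "x \<in> V" "\<And>p. p \<in> V \<Longrightarrow> P p" and p: "p \<in> S"
  shows "P p"
proof -
  define E1 where "E1 = \<Union> {U. openin sphere2_top U \<and> (\<forall>p\<in>U. P p)}"
  define E2 where "E2 = \<Union> {U. openin sphere2_top U \<and> (\<forall>V. openin sphere2_top V \<longrightarrow> V \<noteq> {} \<longrightarrow> V \<subseteq> U \<longrightarrow> \<not> (\<forall>p\<in>V. P p))}"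
  have op: "openin sphere2_top E1" "openin sphere2_top E2"
    unfolding E1_def E2_def by (auto intro!: openin_Union)
  have "E1 \<inter> E2 = {}"
  proof (rule ccontr)
    assume "E1 \<inter> E2 \<noteq> {}"
    then obtain q U1 U2 where U: "openin sphere2_top U1" "\<forall>p\<in>U1. P p" "openin sphere2_top U2"
      "\<forall>V. openin sphere2_top V \<longrightarrow> V \<noteq> {} \<longrightarrow> V \<subseteq> U2 \<longrightarrow> \<not> (\<forall>p\<in>V. P p)" "q \<in> U1" "q \<in> U2"
      unfolding E1_def E2_def by blast
    thus False using openin_Int[OF U(1,3)] by (metis IntD1 IntI Int_lower2 empty_iff)
  qed
  moreover have "T \<subseteq> E1 \<union> E2"
  proof
    fix q assume q: "q \<in> T"
    have *: "q \<in> E1 \<union> E2"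
      if \<pi>: "continuous_map euclidean sphere2_top \<pi>" "\<And>U. open U \<Longrightarrow> openin sphere2_top (\<pi> ` U)"
        and q': "q = \<pi> q'" and G: "holomorphic2_on G (\<pi> -` T)"
        "\<And>q. q \<in> \<pi> -` T \<Longrightarrow> G q = 0 \<Longrightarrow> P (\<pi> q)"
        "\<And>q. q \<in> \<pi> -` T \<Longrightarrow> Im (fst q * snd q) \<noteq> 0 \<Longrightarrow> P (\<pi> q) \<Longrightarrow> G q = 0" for \<pi> q' G
    proof -
      have "open (\<pi> -` T)" using \<pi>(1) T by (auto simp: continuous_map_openin_preimage_eq)
      then obtain e where e: "e > 0" "ball q' e \<subseteq> \<pi> -` T" using q q' unfolding open_contains_ball by blast
      have U: "openin sphere2_top (\<pi> ` ball q' e)" "q \<in> \<pi> ` ball q' e" using \<pi>(2) e q' by auto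
      show ?thesis
      proof (cases "\<exists>V. openin sphere2_top V \<and> V \<noteq> {} \<and> V \<subseteq> \<pi> ` ball q' e \<and> (\<forall>p\<in>V. P p)")
        case False
        thus ?thesis using U unfolding E2_def by blast
      next
        case True
        then obtain V where V: "openin sphere2_top V" "V \<noteq> {}" "V \<subseteq> \<pi> ` ball q' e" "\<And>p. p \<in> V \<Longrightarrow> P p" by blast
        have G': "\<And>q. q \<in> ball q' e \<Longrightarrow> holo2_at G q" "\<And>q. q \<in> ball q' e \<Longrightarrow> G q = 0 \<Longrightarrow> P (\<pi> q)"
          "\<And>q. q \<in> ball q' e \<Longrightarrow> Im (fst q * snd q) \<noteq> 0 \<Longrightarrow> P (\<pi> q) \<Longrightarrow> G q = 0"
          using G e(2) unfolding holomorphic2_on_iff by blast+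
        have "\<forall>p\<in>\<pi> ` ball q' e. P p"
          using chart_propagation[where \<pi> = \<pi> and B = "ball q' e" and G = G and P = P and V = V,
              OF \<pi>(1) open_ball convex_ball G' V] by blast
        thus ?thesis using U unfolding E1_def by blast
      qed
    qed
    show "q \<in> E1 \<union> E2"
    proof (rule Omega_charts[of q])
      show "q \<in> Omega" using q T by auto
    next
      fix q' assume eq: "q = std_param q'"
      show ?thesis
        by (rule *[where \<pi> = std_param and G = G1, OF continuous_std_param openin_std_param_image eq G1(1)])
           (use G1(2) in blast)+
    next
      fix u v assume eq: "q = flip_param (u, v)"
      show ?thesis
        by (rule *[where \<pi> = flip_param and G = G2, OF continuous_flip_param openin_flip_param_image eq G2(1)])
           (use G2(2,3) in blast)+
    qed
  qed
  moreover have "x \<in> E1" unfolding E1_def using start by blast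
  ultimately have cov: "S \<subseteq> E1 \<union> E2" "E1 \<inter> E2 \<inter> S = {}" "E1 \<inter> S \<noteq> {}"
    using S start(1) by blast+
  hence "E2 \<inter> S = {}"
    using S(1) op unfolding connectedin by blast
  hence "S \<subseteq> E1" using cov(1) by blast
  thus ?thesis using p unfolding E1_def by blast
qed

corollary holomorphic_Omega_unique:
  assumes f: "holomorphic_Omega f T" and g: "holomorphic_Omega g T"
    and T: "openin sphere2_top T" "T \<subseteq> Omega" and S: "connectedin sphere2_top S" "S \<subseteq> T"
    and start: "x \<in> S" "openin sphere2_top V" "x \<in> V" "\<And>p. p \<in> V \<Longrightarrow> f p = g p" and p: "p \<in> S"
  shows "f p = g p"
proof (rule sphere_propagation[OF T S, where P = "\<lambda>p. f p = g p"
    and ?G1.0 = "\<lambda>q. (f \<circ> std_param) q - (g \<circ> std_param) q"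
    and ?G2.0 = "\<lambda>q. (f \<circ> flip_param) q - (g \<circ> flip_param) q", OF _ _ _ _ _ start p])
  show "holomorphic2_on (\<lambda>q. (f \<circ> std_param) q - (g \<circ> std_param) q) (std_param -` T)"
       "holomorphic2_on (\<lambda>q. (f \<circ> flip_param) q - (g \<circ> flip_param) q) (flip_param -` T)"
    using f g unfolding holomorphic_Omega_def holomorphic2_on_iff by (blast intro: holo2_at_diff)+
qed auto

section \<open>Homogeneous eigenfunctions near the origin\<close>

text \<open>The Moebius involution of Pfaff's transformation. It exchanges 1 and infinity and
  preserves the slit plane.\<close>

definition pfaff :: "complex \<Rightarrow> complex" where "pfaff x = x / (x - 1)"

lemma pfaff_pfaff: "x \<noteq> 1 \<Longrightarrow> pfaff (pfaff x) = x"
  by (simp add: pfaff_def field_simps)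

lemma pfaff_0 [simp]: "pfaff 0 = 0" by (simp add: pfaff_def)

lemma one_minus_pfaff: "x \<noteq> 1 \<Longrightarrow> 1 - pfaff x = inverse (1 - x)"
  by (simp add: pfaff_def field_simps)

lemma pfaff_in_slit: "x \<in> slit \<Longrightarrow> pfaff x \<in> slit"
proof -
  assume x: "x \<in> slit"
  hence "x \<noteq> 1" using one_notin_slit by blast
  moreover have "inverse y \<in> \<real>\<^sub>\<le>\<^sub>0 \<Longrightarrow> y \<in> \<real>\<^sub>\<le>\<^sub>0" for y :: complex
  proof -
    assume "inverse y \<in> \<real>\<^sub>\<le>\<^sub>0"
    then obtain a where "inverse y = complex_of_real a" "a \<le> 0"
      by (auto simp: complex_nonpos_Reals_iff complex_eq_iff)
    hence "y = complex_of_real (inverse a)" by (metis inverse_inverse_eq of_real_inverse)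
    moreover have "inverse a \<le> 0" using \<open>a \<le> 0\<close> by simp
    ultimately show ?thesis by (simp only: complex_nonpos_Reals_iff Re_complex_of_real Im_complex_of_real)
  qed
  ultimately show ?thesis using x by (auto simp: slit_iff one_minus_pfaff)
qed

lemma holomorphic_pfaff: "1 \<notin> A \<Longrightarrow> pfaff holomorphic_on A"
  unfolding pfaff_def by (intro holomorphic_intros) auto

text \<open>The radial equation satisfied by \<open>h\<close> when \<open>z\<^sup>N h (z w)\<close> or \<open>w\<^sup>N h (z w)\<close> is an eigenfunction.\<close>

definition radial_ode :: "nat \<Rightarrow> complex \<Rightarrow> (complex \<Rightarrow> complex) \<Rightarrow> complex \<Rightarrow> bool" where
  "radial_ode N \<kappa> h x \<longleftrightarrow>
     (1 - x)\<^sup>2 * (x * deriv (deriv h) x + (of_nat N + 1) * deriv h x) = \<kappa> * h x"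

text \<open>The derivative of \<open>pfaff\<close> at s is -(1 - pfaff s)^2, so the factor (1 - x)^2
  of the radial equation disappears in the variable s.\<close>

lemma radial_ode_imp_hyp_ode:
  assumes h: "h holomorphic_on ball 0 R" "R > 0"
    and ode: "\<And>x. x \<in> ball 0 R \<Longrightarrow> radial_ode N \<kappa> h x"
  shows "(h \<circ> pfaff) analytic_on {0}" "eventually (hyp_ode (of_nat N + 1) \<kappa> (h \<circ> pfaff)) (nhds 0)"
proof -
  \<comment> \<open>The point 1 must be removed explicitly: division by zero gives
    \<open>pfaff 1 = 0\<close>, which lies in the ball.\<close>
  define U where "U = pfaff -` ball 0 R \<inter> (- {1})"
  have oU: "open U"
  proof -
    have "continuous_on (- {1}) pfaff"
      using holomorphic_pfaff[of "- {1}"] holomorphic_on_imp_continuous_on by auto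
    hence "open ((- {1}) \<inter> pfaff -` ball 0 R)"
      by (intro continuous_open_preimage) auto
    thus ?thesis by (simp add: U_def Int_commute)
  qed
  have U0: "0 \<in> U" using h by (simp add: U_def)
  define X where "X s = - 1 / (s - 1)^2" for s :: complex
  define X2 where "X2 s = 2 / (s - 1)^3" for s :: complex
  have s1: "(pfaff has_field_derivative X s) (at s)" "(X has_field_derivative X2 s) (at s)" if "s \<in> U" for s
  proof -
    have s: "s - 1 \<noteq> 0" using that by (auto simp: U_def)
    show "(pfaff has_field_derivative X s) (at s)"
      unfolding pfaff_def[abs_def] X_def using s
      by (auto intro!: derivative_eq_intros simp: divide_simps power2_eq_square)
    show "(X has_field_derivative X2 s) (at s)"
      unfolding X_def[abs_def] X2_def using s
      by (auto intro!: derivative_eq_intros simp: divide_simps) (simp add: power2_eq_square power3_eq_cube power4_eq_xxxx algebra_simps)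
  qed
  have U: "pfaff s \<in> ball 0 R" if "s \<in> U" for s using that by (simp add: U_def)
  have k: "(h \<circ> pfaff has_field_derivative (deriv h (pfaff s) * X s)) (at s)"
    "deriv (h \<circ> pfaff) s = deriv h (pfaff s) * X s"
    "deriv (deriv (h \<circ> pfaff)) s = deriv (deriv h) (pfaff s) * X s ^ 2 + deriv h (pfaff s) * X2 s" if s: "s \<in> U" for s
    unfolding o_def by (rule deriv2_compose[OF oU s open_ball h(1) U s1]; assumption)+
  have "(h \<circ> pfaff) holomorphic_on U"
    using k(1) by (auto simp: holomorphic_on_open[OF oU])
  thus "(h \<circ> pfaff) analytic_on {0}" using oU U0 analytic_at by blast
  have "hyp_ode (of_nat N + 1) \<kappa> (h \<circ> pfaff) s" if s: "s \<in> U" for s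
  proof -
    define t where "t = s - 1"
    have t: "t \<noteq> 0" "s = t + 1" using s by (auto simp: U_def t_def)
    define a where "a = deriv (deriv h) (pfaff s)"
    define b where "b = deriv h (pfaff s)"
    have r: "(1 - pfaff s)\<^sup>2 * (pfaff s * a + (of_nat N + 1) * b) = \<kappa> * h (pfaff s)"
      using ode[of "pfaff s"] s by (auto simp: radial_ode_def U_def a_def b_def)
    \<comment> \<open>With i for 1 / t, the claim becomes a polynomial identity modulo t i =
      1.\<close>
    define i where "i = 1 / t"
    have ti: "t * i = 1" using t by (simp add: i_def)
    have sg: "pfaff s = 1 + i" "X s = - (i^2)" "X2 s = 2 * i^3"
      using t by (auto simp: pfaff_def X_def X2_def i_def divide_simps)
    have "s * (1 - s) * (a * X s ^ 2 + b * X2 s) + (of_nat N + 1 - 2 * s) * (b * X s) =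
      - ((1 - pfaff s)\<^sup>2 * (pfaff s * a + (of_nat N + 1) * b))"
      unfolding sg unfolding t(2) using ti by algebra
    thus ?thesis unfolding hyp_ode_def k(2,3)[OF s] r by (simp add: a_def b_def)
  qed
  thus "eventually (hyp_ode (of_nat N + 1) \<kappa> (h \<circ> pfaff)) (nhds 0)"
    using oU U0 unfolding eventually_nhds by blast
qed

lemma radial_ode_unique:
  assumes h: "h holomorphic_on ball 0 R" "R > 0" "R \<le> 1"
    and ode: "\<And>x. x \<in> ball 0 R \<Longrightarrow> radial_ode N \<kappa> h x" and x: "x \<in> ball 0 R"
  shows "h x = h 0 * hyp_fun N \<kappa> (pfaff x)"
proof -
  have "eventually (\<lambda>s. (h \<circ> pfaff) s = (h \<circ> pfaff) 0 * hyp_fun N \<kappa> s) (nhds 0)"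
    by (rule hyp_ode_eq_hyp_fun; rule radial_ode_imp_hyp_ode[OF h(1,2) ode])
  then obtain V where V: "open V" "0 \<in> V" "\<And>s. s \<in> V \<Longrightarrow> h (pfaff s) = h 0 * hyp_fun N \<kappa> s"
    unfolding eventually_nhds by auto
  have sub: "ball 0 R \<subseteq> slit" using ball_subset_slit h(3) by (auto simp: subset_iff)
  have n1: "1 \<notin> ball (0::complex) R" using h(3) by (simp add: dist_norm)
  have c: "continuous_on (ball 0 R) pfaff"
    using holomorphic_pfaff[OF n1] by (rule holomorphic_on_imp_continuous_on)
  show ?thesis
  proof (rule analytic_continuation_open[where f = h and g = "\<lambda>x. h 0 * hyp_fun N \<kappa> (pfaff x)"
        and s = "ball 0 R \<inter> pfaff -` V" and s' = "ball 0 R"])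
    show "open (ball 0 R \<inter> pfaff -` V)" by (intro continuous_open_preimage c V) auto
    have "0 \<in> ball 0 R \<inter> pfaff -` V" using h V by auto
    thus "ball 0 R \<inter> pfaff -` V \<noteq> {}" by blast
    have "hyp_fun N \<kappa> \<circ> pfaff holomorphic_on ball 0 R"
      by (rule holomorphic_on_compose_gen[OF holomorphic_pfaff[OF n1] holomorphic_hyp_fun])
         (use sub pfaff_in_slit in blast)
    thus "(\<lambda>x. h 0 * hyp_fun N \<kappa> (pfaff x)) holomorphic_on ball 0 R"
      by (intro holomorphic_intros) (simp add: o_def)
    show "h x = h 0 * hyp_fun N \<kappa> (pfaff x)" if "x \<in> ball 0 R \<inter> pfaff -` V" for x
      proof -
      have "x \<noteq> 1" using that n1 by blast
      thus ?thesis using V(3)[of "pfaff x"] that pfaff_pfaff[of x] by simp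
    qed
  qed (use h x in auto)
qed

text \<open>For fixed z and w both sides of the homogeneity relation are holomorphic in \<eta>, so
  it extends from the unit circle to an annulus. Taking \<eta> = \<rho> / z there turns g (z, w)
  into (z / \<rho>)^N g (\<rho>, z w / \<rho>), and apart from z^N this depends on z w only.\<close>

lemma homogeneous_local_form:
  fixes g :: "complex \<times> complex \<Rightarrow> complex"
  assumes r: "r > 0" and g: "\<And>z w. norm z < r \<Longrightarrow> norm w < r \<Longrightarrow> holo2_at g (z, w)"
    and hom: "\<And>\<eta> z w. norm \<eta> = 1 \<Longrightarrow> norm z < r \<Longrightarrow> norm w < r \<Longrightarrow> g (\<eta> * z, w / \<eta>) = \<eta> ^ N * g (z, w)"
  obtains h where "h holomorphic_on ball 0 (r^2 / 2)"
    "\<And>z w. norm z < r / 2 \<Longrightarrow> norm w < r / 2 \<Longrightarrow> g (z, w) = z ^ N * h (z * w)"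
proof -
  define \<rho> where "\<rho> = complex_of_real (r / 2)"
  have \<rho>: "\<rho> \<noteq> 0" "norm \<rho> = r / 2" using r by (auto simp: \<rho>_def)
  define h where "h x = g (\<rho>, x / \<rho>) / \<rho> ^ N" for x
  have h: "h holomorphic_on ball 0 (r^2 / 2)"
    unfolding holomorphic_on_def
  proof
    fix x :: complex assume x: "x \<in> ball 0 (r^2 / 2)"
    have "holo2_at g (\<rho>, x / \<rho>)"
      using r \<rho> x by (intro g) (auto simp: norm_divide divide_simps power2_eq_square)
    hence "(\<lambda>x. g (\<rho>, x / \<rho>)) field_differentiable (at x)"
      by (rule holo2_at_curve) (use \<rho> in \<open>auto intro!: derivative_intros\<close>)
    hence "h field_differentiable (at x)"
      unfolding h_def[abs_def] using \<rho> by (intro derivative_intros) auto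
    thus "h field_differentiable at x within ball 0 (r^2 / 2)" by (rule field_differentiable_at_within)
  qed
  have nz: "g (z, w) = z ^ N * h (z * w)" if zw: "norm z < r / 2" "norm w < r / 2" "z \<noteq> 0" for z w
  proof -
    \<comment> \<open>The values of \<eta> for which both \<eta> z and w / \<eta> stay within radius
      r.\<close>
    define A where "A = {\<eta>::complex. norm w / r < norm \<eta> \<and> norm \<eta> < r / norm z}"
    define \<phi> where "\<phi> \<eta> = g (\<eta> * z, w / \<eta>) - \<eta> ^ N * g (z, w)" for \<eta>
    have Anz: "\<eta> \<noteq> 0" if "\<eta> \<in> A" for \<eta> using that r by (auto simp: A_def) (smt (verit) divide_nonneg_pos norm_ge_zero)
    have "\<phi> (\<rho> / z) = 0"
    proof (rule analytic_continuation[where f = \<phi> and S = A and U = "sphere 0 1" and \<xi> = 1])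
      show "\<phi> holomorphic_on A"
        unfolding holomorphic_on_def
      proof
        fix \<eta> assume \<eta>: "\<eta> \<in> A"
        note nz = Anz[OF \<eta>]
        have "holo2_at g (\<eta> * z, w / \<eta>)"
          using \<eta> nz zw r by (intro g) (auto simp: A_def norm_mult norm_divide field_simps)
        hence "(\<lambda>\<eta>. g (\<eta> * z, w / \<eta>)) field_differentiable (at \<eta>)"
          by (rule holo2_at_curve) (use nz in \<open>auto intro!: derivative_intros\<close>)
        hence "\<phi> field_differentiable (at \<eta>)"
          unfolding \<phi>_def[abs_def] by (intro derivative_intros)
        thus "\<phi> field_differentiable at \<eta> within A" by (rule field_differentiable_at_within)
      qed
      show "open A" unfolding A_def by (intro open_Collect_conj open_Collect_less continuous_intros)
      show "connected A"
        using connected_annulus(1)[where a = "0::complex" and ?r1.0 = "norm w / r" and ?r2.0 = "r / norm z"] by (simp add: A_def)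
      show "sphere 0 1 \<subseteq> A" using zw r by (auto simp: A_def divide_simps)
      show "1 \<in> A" using zw r by (auto simp: A_def divide_simps)
      show "(1::complex) islimpt sphere 0 1"
      proof (rule connected_imp_perfect)
        show "connected (sphere (0::complex) 1)" by (rule connected_sphere) auto
        show "sphere (0::complex) 1 \<noteq> {x}" for x
        proof
          assume "sphere (0::complex) 1 = {x}"
          hence "1 = x" "-1 = x" by (metis (no_types) dist_0_norm mem_sphere norm_one norm_minus_cancel singletonD)+
          thus False by (metis one_neq_neg_one)
        qed
      qed auto
      show "\<phi> \<eta> = 0" if "\<eta> \<in> sphere 0 1" for \<eta>
        using that hom[of \<eta> z w] zw r by (simp add: \<phi>_def)
      have "norm w * norm z < r * (r / 2)"
        using zw r by (intro mult_strict_mono) auto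
      thus "\<rho> / z \<in> A" using zw r \<rho> by (auto simp: A_def norm_divide divide_simps mult_ac)
    qed
    hence "g (\<rho>, z * w / \<rho>) = (\<rho> / z) ^ N * g (z, w)"
      using zw \<rho> by (simp add: \<phi>_def mult.commute)
    thus ?thesis using zw \<rho> by (simp add: h_def power_divide)
  qed
  have "g (z, w) = z ^ N * h (z * w)" if zw: "norm z < r / 2" "norm w < r / 2" for z w
  proof (cases "z = 0")
    case True
    define d where "d z = g (z, w) - z ^ N * h (z * w)" for z
    have "holo2_at g (0, w)" using zw r by (intro g) auto
    hence "(\<lambda>z. g (z, w)) field_differentiable (at 0)"
      by (rule holo2_at_curve) (auto intro!: derivative_intros)
    moreover have "(\<lambda>z. h (z * w)) field_differentiable (at 0)"
    proof (rule field_differentiable_compose[where f = "\<lambda>z. z * w" and g = h, unfolded o_def])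
      show "h field_differentiable at (0 * w)"
        using h r by (auto simp: holomorphic_on_def intro: holomorphic_on_imp_differentiable_at[OF h])
    qed (auto intro!: derivative_intros)
    ultimately have "d field_differentiable (at 0)"
      unfolding d_def[abs_def] by (intro derivative_intros)
    hence "isCont d 0" by (rule field_differentiable_imp_continuous_at)
    hence "(d \<longlongrightarrow> d 0) (at 0)" by (simp add: isCont_def)
    moreover have "eventually (\<lambda>z. d z = 0) (at 0)"
      unfolding eventually_at using nz zw(2) r by (intro exI[of _ "r / 2"]) (auto simp: d_def)
    hence "(d \<longlongrightarrow> 0) (at 0)" by (rule tendsto_eventually)
    ultimately have "d 0 = 0" by (rule LIM_unique)
    thus ?thesis using True by (simp add: d_def)
  qed (use nz that in auto)
  thus ?thesis using that[OF h] by blast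
qed

text \<open>Under (\<eta> z, w / \<eta>) the coordinates have weights 1 and -1; this is the monomial
  of weight n that contains no factor z w.\<close>

definition mono2 :: "int \<Rightarrow> complex \<Rightarrow> complex \<Rightarrow> complex" where
  "mono2 n z w = (if n \<ge> 0 then z ^ nat n else w ^ nat (- n))"

definition radial_mode :: "int \<Rightarrow> complex \<Rightarrow> complex \<times> complex \<Rightarrow> complex" where
  "radial_mode n \<kappa> = (\<lambda>(z, w). mono2 n z w * hyp_fun (nat \<bar>n\<bar>) \<kappa> (pfaff (z * w)))"

lemma mono2_altdef: "mono2 n z w = z ^ nat n * w ^ nat (- n)"
  by (simp add: mono2_def)

lemma Delta_mono2:
  assumes h: "h holomorphic_on ball 0 (\<delta>^2)"
    and g: "\<And>z w. norm z < \<delta> \<Longrightarrow> norm w < \<delta> \<Longrightarrow> g (z, w) = mono2 n z w * h (z * w)"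
    and zw: "norm z < \<delta>" "norm w < \<delta>"
  shows "Delta_chart g (z, w) = 4 * (1 - z * w)\<^sup>2 *
    (mono2 n z w * (z * w * deriv (deriv h) (z * w) + (of_nat (nat \<bar>n\<bar>) + 1) * deriv h (z * w)))"
proof -
  have prod: "z * w \<in> ball 0 (\<delta>^2)" if "norm z < \<delta>" for z :: complex
    using mult_strict_mono'[OF that zw(2)] by (simp add: norm_mult power2_eq_square)
  have h1: "(h has_field_derivative deriv h x) (at x)"
    "(deriv h has_field_derivative deriv (deriv h) x) (at x)" if "x \<in> ball 0 (\<delta>^2)" for x
    using that h by (auto intro!: holomorphic_derivI[of _ "ball 0 (\<delta>^2)"] holomorphic_deriv)
  define A B where "A = nat n" and "B = nat (- n)"
  define Z W where "Z = of_nat A * z ^ (A - 1)" and "W = of_nat B * w ^ (B - 1)"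
  \<comment> \<open>Truncated subtraction in the exponent is harmless at k = 0, where the factor k
    makes both sides vanish.\<close>
  have pw: "of_nat k * x ^ (k - 1) * x = of_nat k * x ^ k" for k :: nat and x :: complex
    by (cases k) auto
  \<comment> \<open>One of the exponents A and B is 0. The third fact removes the mixed term Z W h,
    which would remain after differentiating both powers.\<close>
  have ZW: "Z * z = of_nat A * z ^ A" "W * w = of_nat B * w ^ B" "Z = 0 \<or> W = 0"
    unfolding Z_def W_def pw using linear[of n 0] by (auto simp: A_def B_def)
  have "nat \<bar>n\<bar> = A + B" by (simp add: A_def B_def)
  hence AB: "of_nat (nat \<bar>n\<bar>) = (of_nat A + of_nat B :: complex)" by (simp only: of_nat_add)
  have d1: "deriv (\<lambda>w. g (z, w)) w = z ^ A * (w ^ B * (deriv h (z * w) * z) + W * h (z * w))" if z: "norm z < \<delta>" for z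
  proof -
    have "eventually (\<lambda>w. g (z, w) = z ^ A * (w ^ B * h (z * w))) (nhds w)"
      using eventually_nhds_in_open[of "ball 0 \<delta>" w] zw
      by (auto elim!: eventually_mono simp: g z mono2_altdef A_def B_def)
    hence "deriv (\<lambda>w. g (z, w)) w = deriv (\<lambda>w. z ^ A * (w ^ B * h (z * w))) w" by (rule deriv_cong_ev) simp
    also have "((\<lambda>w. h (z * w)) has_field_derivative (deriv h (z * w) * z)) (at w)"
      by (rule DERIV_chain2[where f = h and g = "\<lambda>w. z * w", OF h1(1)[OF prod[OF z]]]) (auto intro!: derivative_eq_intros)
    hence "((\<lambda>w. z ^ A * (w ^ B * h (z * w))) has_field_derivative (z ^ A * (w ^ B * (deriv h (z * w) * z) + W * h (z * w)))) (at w)"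
      by (intro DERIV_cmult DERIV_mult') (auto intro!: derivative_eq_intros simp: W_def)
    hence "deriv (\<lambda>w. z ^ A * (w ^ B * h (z * w))) w = z ^ A * (w ^ B * (deriv h (z * w) * z) + W * h (z * w))"
      by (rule DERIV_imp_deriv)
    finally show ?thesis .
  qed
  have "eventually (\<lambda>z. deriv (\<lambda>w. g (z, w)) w = z ^ A * (w ^ B * (deriv h (z * w) * z) + W * h (z * w))) (nhds z)"
    by (rule eventually_mono[OF eventually_nhds_in_open[of "ball 0 \<delta>" z]]) (use zw d1 in auto)
  hence "deriv (\<lambda>z. deriv (\<lambda>w. g (z, w)) w) z = deriv (\<lambda>z. z ^ A * (w ^ B * (deriv h (z * w) * z) + W * h (z * w))) z"
    by (rule deriv_cong_ev) simp
  also have d: "((\<lambda>z. deriv h (z * w)) has_field_derivative (deriv (deriv h) (z * w) * w)) (at z)"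
    "((\<lambda>z. h (z * w)) has_field_derivative (deriv h (z * w) * w)) (at z)"
    by (rule DERIV_chain2[where f = "deriv h" and g = "\<lambda>z. z * w", OF h1(2)[OF prod[OF zw(1)]]]
        DERIV_chain2[where f = h and g = "\<lambda>z. z * w", OF h1(1)[OF prod[OF zw(1)]]],
        auto intro!: derivative_eq_intros)+
  have "((\<lambda>z. z ^ A) has_field_derivative Z) (at z)" by (auto intro!: derivative_eq_intros simp: Z_def)
  hence "((\<lambda>z. z ^ A * (w ^ B * (deriv h (z * w) * z) + W * h (z * w))) has_field_derivative
      (z ^ A * (w ^ B * (deriv h (z * w) * 1 + (deriv (deriv h) (z * w) * w) * z) + W * (deriv h (z * w) * w))
       + Z * (w ^ B * (deriv h (z * w) * z) + W * h (z * w)))) (at z)"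
    by (intro DERIV_add DERIV_cmult DERIV_mult' d DERIV_ident)
  hence "deriv (\<lambda>z. z ^ A * (w ^ B * (deriv h (z * w) * z) + W * h (z * w))) z =
      z ^ A * w ^ B * (deriv h (z * w) + z * w * deriv (deriv h) (z * w)) + z ^ A * (W * w) * deriv h (z * w)
       + (Z * z) * w ^ B * deriv h (z * w)"
    using ZW(3) by (auto simp: DERIV_imp_deriv algebra_simps)
  finally show ?thesis unfolding ZW AB
    by (simp add: Delta_chart_def mono2_altdef A_def[symmetric] B_def[symmetric] algebra_simps)
qed

theorem homogeneous_eigenfunction_local:
  assumes r: "r > 0" and g: "\<And>z w. norm z < r \<Longrightarrow> norm w < r \<Longrightarrow> holo2_at g (z, w)"
    and hom: "\<And>\<eta> z w. norm \<eta> = 1 \<Longrightarrow> norm z < r \<Longrightarrow> norm w < r \<Longrightarrow> g (\<eta> * z, w / \<eta>) = \<eta> powi n * g (z, w)"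
    and eig: "\<And>z w. norm z < r \<Longrightarrow> norm w < r \<Longrightarrow> Delta_chart g (z, w) = 4 * \<kappa> * g (z, w)"
  obtains c \<delta> where "\<delta> > 0" "\<delta> \<le> r"
    "\<And>z w. norm z < \<delta> \<Longrightarrow> norm w < \<delta> \<Longrightarrow> g (z, w) = c * radial_mode n \<kappa> (z, w)"
proof -
  define N where "N = nat \<bar>n\<bar>"
  \<comment> \<open>The bound r / 2 keeps z w where h is known to be holomorphic, and the bound 1
    keeps z w inside the unit disc, away from the singular point 1.\<close>
  define \<delta> where "\<delta> = min (r / 2) 1"
  have \<delta>: "\<delta> > 0" "\<delta> \<le> r / 2" "\<delta> \<le> 1" using r by (auto simp: \<delta>_def)
  have d2: "\<delta>^2 \<le> r^2 / 2" "\<delta>^2 \<le> 1" "0 < \<delta>^2"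
    using power_mono[OF \<delta>(2), of 2] power_mono[OF \<delta>(3), of 2] \<delta> by (auto simp: power_divide) (smt (verit) zero_le_power2 field_sum_of_halves)
  have "\<exists>h. h holomorphic_on ball 0 (r^2 / 2) \<and>
     (\<forall>z w. norm z < r / 2 \<longrightarrow> norm w < r / 2 \<longrightarrow> g (z, w) = mono2 n z w * h (z * w))"
  proof (cases "n \<ge> 0")
    case True
    have "\<eta> powi n = \<eta> ^ N" for \<eta> :: complex using True by (simp add: power_int_def N_def)
    then obtain h where "h holomorphic_on ball 0 (r^2 / 2)"
      "\<And>z w. norm z < r / 2 \<Longrightarrow> norm w < r / 2 \<Longrightarrow> g (z, w) = z ^ N * h (z * w)"
      using homogeneous_local_form[OF r g, of N] hom by metis
    thus ?thesis using True by (intro exI[of _ h]) (simp add: mono2_def N_def)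
  next
    case False
    \<comment> \<open>Exchanging z and w replaces \<eta> by its inverse, which turns the negative
      weight n into N.\<close>
    have hom': "(g \<circ> prod.swap) (\<eta> * z, w / \<eta>) = \<eta> ^ N * (g \<circ> prod.swap) (z, w)"
      if "norm \<eta> = 1" "norm z < r" "norm w < r" for \<eta> z w
    proof -
      have "\<eta> \<noteq> 0" using that by auto
      hence "g (inverse \<eta> * w, z / inverse \<eta>) = inverse \<eta> powi n * g (w, z)"
        using that by (intro hom) (auto simp: norm_inverse)
      moreover have "inverse \<eta> powi n = \<eta> ^ N"
        using False by (simp add: power_int_def N_def)
      ultimately show ?thesis by (simp add: divide_inverse mult_ac)
    qed
    have sw: "holo2_at (g \<circ> prod.swap) (z, w)" if "norm z < r" "norm w < r" for z w
    proof -
      obtain a b where ab: "(g has_derivative (\<lambda>(h, k). a * h + b * k)) (at (w, z))"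
        using g[OF \<open>norm w < r\<close> \<open>norm z < r\<close>] unfolding holo2_at_def by blast
      have "(prod.swap has_derivative prod.swap) (at (z, w))"
        unfolding prod.swap_def[abs_def] by (auto intro!: derivative_eq_intros)
      moreover have "(g has_derivative (\<lambda>(h, k). a * h + b * k)) (at (prod.swap (z, w)))" using ab by simp
      ultimately have "((\<lambda>x. g (prod.swap x)) has_derivative (\<lambda>x. case prod.swap x of (h, k) \<Rightarrow> a * h + b * k)) (at (z, w))"
        by (rule has_derivative_compose)
      hence "((g \<circ> prod.swap) has_derivative (\<lambda>(h, k). b * h + a * k)) (at (z, w))"
        unfolding o_def by (rule has_derivative_eq_rhs) (auto simp: add_ac)
      thus ?thesis unfolding holo2_at_def by blast
    qed
    have "\<exists>h. h holomorphic_on ball 0 (r^2 / 2) \<and>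
      (\<forall>z w. norm z < r / 2 \<longrightarrow> norm w < r / 2 \<longrightarrow> (g \<circ> prod.swap) (z, w) = z ^ N * h (z * w))"
    proof (rule homogeneous_local_form[OF r, of "g \<circ> prod.swap" N])
      show "holo2_at (g \<circ> prod.swap) (z, w)" if "norm z < r" "norm w < r" for z w
        using that by (rule sw)
      show "(g \<circ> prod.swap) (\<eta> * z, w / \<eta>) = \<eta> ^ N * (g \<circ> prod.swap) (z, w)"
        if "norm \<eta> = 1" "norm z < r" "norm w < r" for \<eta> z w
        using that by (rule hom')
    qed blast
    then obtain h where h: "h holomorphic_on ball 0 (r^2 / 2)"
      "\<And>z w. norm z < r / 2 \<Longrightarrow> norm w < r / 2 \<Longrightarrow> (g \<circ> prod.swap) (z, w) = z ^ N * h (z * w)"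
      by blast
    have "g (z, w) = mono2 n z w * h (z * w)" if "norm z < r / 2" "norm w < r / 2" for z w
      using that h(2)[of w z] False by (simp add: mono2_def N_def mult.commute)
    thus ?thesis using h(1) by blast
  qed
  then obtain h where h: "h holomorphic_on ball 0 (r^2 / 2)"
    "\<And>z w. norm z < r / 2 \<Longrightarrow> norm w < r / 2 \<Longrightarrow> g (z, w) = mono2 n z w * h (z * w)" by blast
  have h': "h holomorphic_on ball 0 (\<delta>^2)"
    using h(1) by (rule holomorphic_on_subset) (use d2 in auto)
  have g': "g (z, w) = mono2 n z w * h (z * w)" if "norm z < \<delta>" "norm w < \<delta>" for z w
    using that \<delta> h(2) by simp
  have ode: "radial_ode N \<kappa> h x" if x: "x \<in> ball 0 (\<delta>^2 / 2)" for x
  proof -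
    \<comment> \<open>For each x a single point with z w = x suffices to read off the radial
      equation. The coordinate that occurs in the monomial is set to d, so that the monomial can be
      cancelled even at x = 0.\<close>
    define d where "d = complex_of_real (\<delta> / 2)"
    define z w where "z = (if n \<ge> 0 then d else x / d)" and "w = (if n \<ge> 0 then x / d else d)"
    have d: "d \<noteq> 0" "norm d = \<delta> / 2" using \<delta> by (auto simp: d_def)
    have "norm (x / d) < \<delta>" "norm d < \<delta>"
      using \<delta> x d by (auto simp: norm_divide divide_simps power2_eq_square)
    hence zw: "norm z < \<delta>" "norm w < \<delta>" "z * w = x" using d by (auto simp: z_def w_def)
    have m: "mono2 n z w \<noteq> 0" using d by (auto simp: mono2_def z_def w_def)
    have "Delta_chart g (z, w) = 4 * (1 - z * w)\<^sup>2 *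
      (mono2 n z w * (z * w * deriv (deriv h) (z * w) + (of_nat (nat \<bar>n\<bar>) + 1) * deriv h (z * w)))"
      by (rule Delta_mono2[OF h' g' zw(1,2)])
    moreover have "Delta_chart g (z, w) = 4 * \<kappa> * (mono2 n z w * h x)"
      using eig[of z w] g'[OF zw(1,2)] zw \<delta> by simp
    ultimately have "4 * (1 - x)\<^sup>2 * (mono2 n z w * (x * deriv (deriv h) x + (of_nat N + 1) * deriv h x)) = 4 * \<kappa> * (mono2 n z w * h x)"
      unfolding zw(3) N_def by (rule trans[OF sym])
    hence "(4 * mono2 n z w) * ((1 - x)\<^sup>2 * (x * deriv (deriv h) x + (of_nat N + 1) * deriv h x)) =
        (4 * mono2 n z w) * (\<kappa> * h x)"
      by (simp only: mult_ac)
    thus ?thesis using m unfolding radial_ode_def by (simp only: mult_cancel_left) auto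
  qed
  have hx: "h x = h 0 * hyp_fun N \<kappa> (pfaff x)" if "x \<in> ball 0 (\<delta>^2 / 2)" for x
  proof (rule radial_ode_unique[OF holomorphic_on_subset[OF h'] _ _ ode that])
    show "ball 0 (\<delta>\<^sup>2 / 2) \<subseteq> ball (0::complex) (\<delta>\<^sup>2)" "0 < \<delta>\<^sup>2 / 2" "\<delta>\<^sup>2 / 2 \<le> 1"
      using d2(2,3) by (intro subset_ball, linarith+)
  qed
  have "g (z, w) = h 0 * radial_mode n \<kappa> (z, w)" if "norm z < \<delta> / 2" "norm w < \<delta> / 2" for z w
  proof -
    have "z * w \<in> ball 0 (\<delta>^2 / 2)"
      using mult_strict_mono'[OF that] d2 by (simp add: norm_mult power2_eq_square)
    moreover have "g (z, w) = mono2 n z w * h (z * w)" using that g' \<delta> by simp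
    ultimately show ?thesis unfolding radial_mode_def N_def[symmetric] by (simp add: hx[of "z * w"])
  qed
  thus ?thesis using that[of "\<delta> / 2" "h 0"] \<delta> by auto
qed

section \<open>Poisson Fourier modes\<close>

text \<open>The Taylor coefficients of (1 - x)^(-\<mu>).\<close>

definition binom_coeff :: "complex \<Rightarrow> nat \<Rightarrow> complex" where
  "binom_coeff \<mu> k = pochhammer \<mu> k / fact k"

lemma binom_coeff_gbinomial: "binom_coeff \<mu> k = (- 1) ^ k * ((- \<mu>) gchoose k)"
  by (simp add: binom_coeff_def gbinomial_pochhammer)

lemma binom_coeff_Suc: "of_nat (Suc k) * binom_coeff \<mu> (Suc k) = (\<mu> + of_nat k) * binom_coeff \<mu> k"
  by (simp add: binom_coeff_def pochhammer_Suc divide_simps del: of_nat_Suc)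

lemma binom_coeff_sums: "norm x < 1 \<Longrightarrow> (\<lambda>k. binom_coeff \<mu> k * x ^ k) sums (1 / (1 - x) powr \<mu>)"
  using gen_binomial_complex[of "- x" "- \<mu>"]
  by (simp add: binom_coeff_gbinomial power_minus[of x] powr_minus divide_inverse mult_ac)

lemma conv_radius_binom_coeff: "conv_radius (binom_coeff \<mu>) \<ge> 1"
proof -
  have "conv_radius (\<lambda>n. (-1) ^ n * ((- \<mu>) gchoose n)) = conv_radius (\<lambda>n. (- \<mu>) gchoose n)"
    by (simp add: conv_radius_def norm_mult norm_power)
  thus ?thesis by (simp add: binom_coeff_gbinomial[abs_def] conv_radius_gchoose)
qed

lemma summable_norm_binom_coeff: "0 \<le> t \<Longrightarrow> t < 1 \<Longrightarrow> summable (\<lambda>k. norm (binom_coeff \<mu> k) * t ^ k)"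
  using abs_summable_in_conv_radius[of "of_real t" "binom_coeff \<mu>"] conv_radius_binom_coeff[of \<mu>]
  by (simp add: norm_mult norm_power less_le_trans[of "ereal t" 1])

text \<open>All factors \<mu> + i of the Pochhammer symbol have positive real part. The lemma
  permits division by the constant between the Poisson mode and \<open>radial_mode\<close>.\<close>

lemma binom_coeff_nonzero: "Re \<mu> > 0 \<Longrightarrow> binom_coeff \<mu> k \<noteq> 0"
proof -
  assume "Re \<mu> > 0"
  hence "\<mu> \<noteq> - of_nat i" for i by (auto simp: complex_eq_iff)
  thus ?thesis by (auto simp: binom_coeff_def pochhammer_eq_0_iff)
qed

text \<open>Equals \<open>binom_coeff \<mu> N\<close> times 2F1 (\<mu>, \<mu> + N; N + 1; x). It
  collects the products of binomial coefficients whose indices differ by N.\<close>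

definition poisson_series :: "complex \<Rightarrow> nat \<Rightarrow> complex \<Rightarrow> complex" where
  "poisson_series \<mu> N x = (\<Sum>k. binom_coeff \<mu> k * binom_coeff \<mu> (k + N) * x ^ k)"

lemma poisson_series_radius: "conv_radius (\<lambda>k. binom_coeff \<mu> k * binom_coeff \<mu> (k + N)) \<ge> 1"
proof (rule conv_radius_geI_ex')
  fix r :: real assume r: "0 < r" "ereal r < 1"
  \<comment> \<open>The square root splits \<open>r ^ k\<close> evenly: one factor
    \<open>t ^ k\<close> makes the first coefficients summable, the other keeps the second ones
    bounded.\<close>
  define t where "t = sqrt r"
  have t: "0 < t" "t < 1" "t * t = r" using r by (auto simp: t_def)
  have s: "summable (\<lambda>k. norm (binom_coeff \<mu> k) * t ^ k)" using t by (intro summable_norm_binom_coeff) auto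
  hence "Bseq (\<lambda>k. norm (binom_coeff \<mu> k) * t ^ k)"
    by (intro convergent_imp_Bseq) (auto simp: convergent_def dest: summable_LIMSEQ_zero)
  then obtain M where M: "\<And>k. norm (norm (binom_coeff \<mu> k) * t ^ k) \<le> M" unfolding Bseq_def by blast
  have b: "norm (binom_coeff \<mu> (k + N)) * t ^ k \<le> M / t ^ N" for k
    using M[of "k + N"] t by (simp add: power_add field_simps)
  show "summable (\<lambda>k. binom_coeff \<mu> k * binom_coeff \<mu> (k + N) * of_real r ^ k)"
  proof (rule summable_comparison_test'[where N = 0])
    show "summable (\<lambda>k. norm (binom_coeff \<mu> k) * t ^ k * (M / t ^ N))" by (intro summable_mult2 s)
    fix k
    have "norm (binom_coeff \<mu> k * binom_coeff \<mu> (k + N) * of_real r ^ k) =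
        (norm (binom_coeff \<mu> k) * t ^ k) * (norm (binom_coeff \<mu> (k + N)) * t ^ k)"
      using t by (simp add: norm_mult norm_power flip: t(3)) (simp add: power_mult_distrib mult_ac)
    also have "\<dots> \<le> (norm (binom_coeff \<mu> k) * t ^ k) * (M / t ^ N)"
      using t by (intro mult_left_mono b) auto
    finally show "norm (binom_coeff \<mu> k * binom_coeff \<mu> (k + N) * of_real r ^ k) \<le>
       norm (binom_coeff \<mu> k) * t ^ k * (M / t ^ N)" .
  qed
qed

lemma poisson_series_ode:
  fixes \<mu> :: complex and N :: nat
  defines "Q \<equiv> poisson_series \<mu> N"
  shows "Q holomorphic_on ball 0 1"
    and "x \<in> ball 0 1 \<Longrightarrow> x * (1 - x) * deriv (deriv Q) x +
      (of_nat N + 1 - (2 * \<mu> + of_nat N + 1) * x) * deriv Q x - \<mu> * (\<mu> + of_nat N) * Q x = 0"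
proof -
  define F where "F = Abs_fps (\<lambda>k. binom_coeff \<mu> k * binom_coeff \<mu> (k + N))"
  have rF: "fps_conv_radius F \<ge> 1"
    using poisson_series_radius by (simp add: F_def fps_conv_radius_def)
  have Q: "Q = eval_fps F" by (auto simp: Q_def poisson_series_def eval_fps_def F_def)
  have "ball 0 1 \<subseteq> eball (0::complex) (fps_conv_radius F)"
    using less_le_trans[OF _ rF] by (auto simp: in_eball_iff)
  thus hQ: "Q holomorphic_on ball 0 1" unfolding Q by (intro holomorphic_intros)
  have "fps_conv_radius F > 0" by (rule less_le_trans[OF _ rF]) simp
  hence eQ: "Q has_fps_expansion F" unfolding Q by (rule eval_fps_has_fps_expansion)
  define E where "E x = x * deriv (deriv Q) x - x * (x * deriv (deriv Q) x) +
     (of_nat N + 1) * deriv Q x - (2 * \<mu> + of_nat N + 1) * (x * deriv Q x) - (\<mu> * (\<mu> + of_nat N)) * Q x" for x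
  define G where "G = fps_X * fps_deriv (fps_deriv F) - fps_X * (fps_X * fps_deriv (fps_deriv F)) +
     fps_const (of_nat N + 1) * fps_deriv F - fps_const (2 * \<mu> + of_nat N + 1) * (fps_X * fps_deriv F)
     - fps_const (\<mu> * (\<mu> + of_nat N)) * F"
  have EG: "E has_fps_expansion G"
    unfolding E_def G_def by (intro fps_expansion_intros eQ)
  have rec: "of_nat (Suc j) * of_nat (Suc (j + N)) * fps_nth F (Suc j) = (\<mu> + of_nat j) * (\<mu> + of_nat (j + N)) * fps_nth F j" for j
  proof -
    have "of_nat (Suc j) * of_nat (Suc (j + N)) * fps_nth F (Suc j) =
       (of_nat (Suc j) * binom_coeff \<mu> (Suc j)) * (of_nat (Suc (j + N)) * binom_coeff \<mu> (Suc (j + N)))"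
      by (simp add: F_def mult_ac)
    also have "\<dots> = (\<mu> + of_nat j) * (\<mu> + of_nat (j + N)) * fps_nth F j"
      unfolding binom_coeff_Suc by (simp add: F_def mult_ac)
    finally show ?thesis .
  qed
  have "G = 0"
  proof (rule fps_ext)
    fix j
    have "fps_nth G j = of_nat (Suc j) * of_nat (Suc (j + N)) * fps_nth F (Suc j) - (\<mu> + of_nat j) * (\<mu> + of_nat (j + N)) * fps_nth F j"
      unfolding G_def by (cases j; cases "j - 1") (auto simp: algebra_simps)
    thus "fps_nth G j = fps_nth 0 j" unfolding rec by simp
  qed
  hence E0: "E has_fps_expansion 0" using EG by simp
  have hE: "E holomorphic_on ball 0 1" unfolding E_def by (intro holomorphic_intros hQ) auto
  show "x * (1 - x) * deriv (deriv Q) x +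
      (of_nat N + 1 - (2 * \<mu> + of_nat N + 1) * x) * deriv Q x - \<mu> * (\<mu> + of_nat N) * Q x = 0"
    if x: "x \<in> ball 0 1"
  proof -
    have "E x = 0" using has_fps_expansion_0_analytic_continuation[OF E0 hE _ _ _ x] by auto
    thus ?thesis by (simp add: E_def algebra_simps)
  qed
qed

text \<open>Pfaff's transformation of 2F1 (\<mu>, \<mu> + N; N + 1; x), whose second parameter
  becomes N + 1 - (\<mu> + N) = 1 - \<mu>. The left side is shown to satisfy the radial equation,
  and its value at 0 fixes the constant.\<close>

lemma poisson_radial:
  assumes x: "x \<in> ball 0 1"
  shows "(1 - x) powr \<mu> * poisson_series \<mu> N x =
    binom_coeff \<mu> N * hyp_fun N (\<mu> * (\<mu> - 1)) (pfaff x)"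
proof -
  define Q where "Q = poisson_series \<mu> N"
  define h where "h x = (1 - x) powr \<mu> * Q x" for x
  note hQ = poisson_series_ode(1)[of \<mu> N, folded Q_def]
  have Q1: "(Q has_field_derivative deriv Q x) (at x)"
    "(deriv Q has_field_derivative deriv (deriv Q) x) (at x)" if "x \<in> ball 0 1" for x
    using that hQ by (auto intro!: holomorphic_derivI[of _ "ball 0 1"] holomorphic_deriv)
  have nz: "1 - x \<notin> \<real>\<^sub>\<le>\<^sub>0" "1 - x \<noteq> 0" if "x \<in> ball 0 1" for x :: complex
    using that ball_subset_slit slit_iff by auto
  have p: "((\<lambda>x. (1 - x) powr \<mu>) has_field_derivative (- \<mu> * (1 - x) powr \<mu> / (1 - x))) (at x)" if "x \<in> ball 0 1" for x
  proof -
    have "((\<lambda>x. (1 - x) powr \<mu>) has_field_derivative (\<mu> * (1 - x) powr (\<mu> - 1) * (- 1))) (at x)"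
      by (rule DERIV_chain2[where f = "\<lambda>z. z powr \<mu>" and g = "\<lambda>x. 1 - x", OF has_field_derivative_powr[OF nz(1)[OF that]]])
         (auto intro!: derivative_eq_intros)
    thus ?thesis using nz(2)[OF that] by (simp add: powr_diff)
  qed
  \<comment> \<open>Y is h' without the factor (1 - x)^\<mu>, so that no powers other than (1 -
    x)^\<mu> itself have to be differentiated again.\<close>
  define Y where "Y x = deriv Q x - \<mu> * Q x / (1 - x)" for x
  have h1: "(h has_field_derivative (1 - x) powr \<mu> * Y x) (at x)" if x: "x \<in> ball 0 1" for x
    using DERIV_mult'[OF p[OF x] Q1(1)[OF x]] nz(2)[OF x]
    unfolding h_def[abs_def] Y_def by (simp add: algebra_simps)
  have Y1: "(Y has_field_derivative (deriv (deriv Q) x - (\<mu> * deriv Q x / (1 - x) + \<mu> * Q x / (1 - x)^2))) (at x)"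
    if x: "x \<in> ball 0 1" for x
    unfolding Y_def[abs_def] by (rule derivative_eq_intros Q1[OF x] refl nz(2)[OF x])+
      (use nz(2)[OF x] in \<open>simp add: divide_simps power2_eq_square; simp add: algebra_simps\<close>)
  have h1': "deriv h x = (1 - x) powr \<mu> * Y x" if "x \<in> ball 0 1" for x
    using h1[OF that] by (rule DERIV_imp_deriv)
  have h2: "deriv (deriv h) x = (1 - x) powr \<mu> * ((deriv (deriv Q) x - (\<mu> * deriv Q x / (1 - x) + \<mu> * Q x / (1 - x)^2)) - \<mu> / (1 - x) * Y x)"
    if x: "x \<in> ball 0 1" for x
  proof -
    have "eventually (\<lambda>x. deriv h x = (1 - x) powr \<mu> * Y x) (nhds x)"
      using eventually_nhds_in_open[of "ball 0 1" x] x h1' by (auto elim!: eventually_mono)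
    hence "deriv (deriv h) x = deriv (\<lambda>x. (1 - x) powr \<mu> * Y x) x" by (rule deriv_cong_ev) simp
    also have "\<dots> = (1 - x) powr \<mu> * (deriv (deriv Q) x - (\<mu> * deriv Q x / (1 - x) + \<mu> * Q x / (1 - x)^2))
        + (- \<mu> * (1 - x) powr \<mu> / (1 - x)) * Y x"
      by (rule DERIV_imp_deriv, rule DERIV_mult'[OF p[OF x] Y1[OF x]])
    finally show ?thesis by (simp add: algebra_simps)
  qed
  have hh: "h holomorphic_on ball 0 1"
    using h1 unfolding holomorphic_on_open[OF open_ball] by blast
  have "radial_ode N (\<mu> * (\<mu> - 1)) h x" if x: "x \<in> ball 0 1" for x
  proof -
    define i where "i = 1 / (1 - x)"
    have i: "(1 - x) * i = 1" using nz(2)[OF x] by (simp add: i_def)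
    define A where "A = deriv (deriv Q) x"
    define B where "B = deriv Q x"
    define C where "C = Q x"
    have ode: "x * (1 - x) * A + (of_nat N + 1 - (2 * \<mu> + of_nat N + 1) * x) * B - \<mu> * (\<mu> + of_nat N) * C = 0"
      using poisson_series_ode(2)[OF x, of \<mu> N] by (simp add: A_def B_def C_def Q_def)
    have "(1 - x)\<^sup>2 * (x * ((A - (\<mu> * B * i + \<mu> * C * i^2)) - \<mu> * i * (B - \<mu> * C * i)) + (of_nat N + 1) * (B - \<mu> * C * i))
        - \<mu> * (\<mu> - 1) * C = (1 - x) * (x * (1 - x) * A + (of_nat N + 1 - (2 * \<mu> + of_nat N + 1) * x) * B - \<mu> * (\<mu> + of_nat N) * C)"
      using i by algebra
    hence eq: "(1 - x)\<^sup>2 * (x * ((A - (\<mu> * B * i + \<mu> * C * i^2)) - \<mu> * i * (B - \<mu> * C * i)) + (of_nat N + 1) * (B - \<mu> * C * i))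
        = \<mu> * (\<mu> - 1) * C" unfolding ode by simp
    have Yi: "Y x = B - \<mu> * C * i" by (simp add: Y_def B_def C_def i_def)
    have d2: "deriv (deriv h) x = (1 - x) powr \<mu> * ((A - (\<mu> * B * i + \<mu> * C * i^2)) - \<mu> * i * (B - \<mu> * C * i))"
      unfolding h2[OF x] Yi by (simp add: A_def B_def C_def i_def power_divide)
    have "(1 - x)\<^sup>2 * (x * deriv (deriv h) x + (of_nat N + 1) * deriv h x) =
      (1 - x) powr \<mu> * ((1 - x)\<^sup>2 * (x * ((A - (\<mu> * B * i + \<mu> * C * i^2)) - \<mu> * i * (B - \<mu> * C * i)) + (of_nat N + 1) * (B - \<mu> * C * i)))"
      unfolding d2 h1'[OF x] Yi by (simp only: distrib_left mult_ac)
    also have "\<dots> = \<mu> * (\<mu> - 1) * h x" unfolding eq by (simp add: h_def C_def)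
    finally show ?thesis by (simp add: radial_ode_def)
  qed
  from radial_ode_unique[OF hh _ _ this x]
  have "h x = h 0 * hyp_fun N (\<mu> * (\<mu> - 1)) (pfaff x)" by auto
  moreover have "h 0 = binom_coeff \<mu> N"
    by (simp add: h_def Q_def poisson_series_def binom_coeff_def[of \<mu> 0])
  ultimately show ?thesis by (simp add: h_def Q_def)
qed

section \<open>The Fourier integral of the Poisson kernel\<close>

lemma integral_series_sums:
  fixes a :: "nat \<Rightarrow> complex" and \<phi> :: "nat \<Rightarrow> real \<Rightarrow> complex"
  assumes a: "summable (\<lambda>k. norm (a k))" and \<phi>: "\<And>k t. norm (\<phi> k t) \<le> 1"
    "\<And>k. continuous_on {x..y} (\<phi> k)" and g: "continuous_on {x..y} g"
  shows "(\<lambda>k. a k * integral {x..y} (\<lambda>t. \<phi> k t * g t)) sums integral {x..y} (\<lambda>t. (\<Sum>k. a k * \<phi> k t) * g t)"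
proof -
  have "bounded (g ` {x..y})"
    using g by (intro compact_imp_bounded compact_continuous_image) auto
  then obtain B where B: "B > 0" "\<And>t. t \<in> {x..y} \<Longrightarrow> norm (g t) \<le> B" by (auto simp: bounded_pos)
  have "uniform_limit {x..y} (\<lambda>n t. \<Sum>k<n. a k * \<phi> k t * g t) (\<lambda>t. \<Sum>k. a k * \<phi> k t * g t) sequentially"
  proof (rule Weierstrass_m_test)
    show "norm (a n * \<phi> n t * g t) \<le> norm (a n) * B" if "t \<in> {x..y}" for n t
      using \<phi>(1)[of n t] B that unfolding norm_mult
      by (intro mult_mono) (auto simp: mult_left_le)
  qed (intro summable_mult2 a)
  hence u: "uniform_limit (cbox x y) (\<lambda>n t. \<Sum>k<n. a k * \<phi> k t * g t) (\<lambda>t. \<Sum>k. a k * \<phi> k t * g t) sequentially"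
    by simp
  have c: "continuous_on (cbox x y) (\<lambda>t. \<Sum>k<n. a k * \<phi> k t * g t)" for n
    using \<phi>(2) g by (auto intro!: continuous_intros)
  obtain I J where IJ: "\<And>n. ((\<lambda>t. \<Sum>k<n. a k * \<phi> k t * g t) has_integral I n) (cbox x y)"
    "((\<lambda>t. \<Sum>k. a k * \<phi> k t * g t) has_integral J) (cbox x y)" "I \<longlonglongrightarrow> J"
    using uniform_limit_integral_cbox[OF u c] by auto
  have int: "(\<lambda>t. \<phi> k t * g t) integrable_on {x..y}" for k
    using \<phi>(2) g by (intro integrable_continuous_real continuous_intros)
  have "I = (\<lambda>n. \<Sum>k<n. a k * integral {x..y} (\<lambda>t. \<phi> k t * g t))"
  proof
    fix n
    have "I n = integral {x..y} (\<lambda>t. \<Sum>k<n. a k * (\<phi> k t * g t))"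
      using IJ(1)[of n] by (simp add: integral_unique mult.assoc)
    also have "\<dots> = (\<Sum>k<n. integral {x..y} (\<lambda>t. a k * (\<phi> k t * g t)))"
      by (rule integral_sum) (auto intro!: integrable_on_mult_right int)
    finally show "I n = (\<Sum>k<n. a k * integral {x..y} (\<lambda>t. \<phi> k t * g t))" by simp
  qed
  hence "(\<lambda>n. \<Sum>k<n. a k * integral {x..y} (\<lambda>t. \<phi> k t * g t)) \<longlonglongrightarrow> J"
    using IJ(3) by simp
  moreover have "J = integral {x..y} (\<lambda>t. (\<Sum>k. a k * \<phi> k t) * g t)"
  proof -
    have "(\<Sum>k. a k * \<phi> k t * g t) = (\<Sum>k. a k * \<phi> k t) * g t" for t
    proof (rule suminf_mult2[symmetric])
      show "summable (\<lambda>k. a k * \<phi> k t)"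
        by (rule summable_comparison_test'[OF a]) (simp add: norm_mult \<phi> mult_left_le)
    qed
    thus ?thesis using IJ(2) by (simp add: integral_unique)
  qed
  ultimately show ?thesis by (simp add: sums_def)
qed

lemma integral_exp_int:
  "integral {0..2*pi} (\<lambda>t. exp (\<i> * of_int m * of_real t)) = (if m = 0 then 2 * of_real pi else 0)"
proof (cases "m = 0")
  case False
  have "((\<lambda>t. exp (\<i> * of_int m * of_real t)) has_integral
     (exp (\<i> * of_int m * of_real (2 * pi)) / (\<i> * of_int m) - exp (\<i> * of_int m * of_real 0) / (\<i> * of_int m))) {0..2*pi}"
  proof (rule fundamental_theorem_of_calculus)
    fix t :: real
    have "((\<lambda>z. exp (\<i> * of_int m * z) / (\<i> * of_int m)) has_field_derivative exp (\<i> * of_int m * of_real t)) (at (of_real t))"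
      using False by (auto intro!: derivative_eq_intros)
    hence "((\<lambda>t. exp (\<i> * of_int m * of_real t) / (\<i> * of_int m)) has_vector_derivative exp (\<i> * of_int m * of_real t)) (at t)"
      by (rule has_vector_derivative_real_field)
    thus "((\<lambda>t. exp (\<i> * of_int m * of_real t) / (\<i> * of_int m)) has_vector_derivative exp (\<i> * of_int m * of_real t)) (at t within {0..2*pi})"
      by (rule has_vector_derivative_at_within)
  qed auto
  moreover have "exp (\<i> * of_int m * of_real (2 * pi)) = 1"
    using exp_integer_2pi[of "of_int m"] by (simp add: mult_ac)
  ultimately show ?thesis using False by (simp add: integral_unique)
qed (simp add: scaleR_conv_of_real)

text \<open>Both kernel factors are binomial series in exp (i t) and exp (-i t). For the k-th term
  of the w series, orthogonality of the exponentials leaves only the term with index k + N of the z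
  series, and the surviving products sum to z^N times \<open>poisson_series\<close>.\<close>

lemma poisson_integral:
  assumes zw: "norm z < 1" "norm w < 1"
  shows "integral {0..2*pi} (\<lambda>t. exp (\<i> * of_nat N * of_real t) /
       ((1 - z * exp (- \<i> * of_real t)) powr \<mu> * (1 - w * exp (\<i> * of_real t)) powr \<mu>)) =
     2 * of_real pi * z ^ N * poisson_series \<mu> N (z * w)"
proof -
  define b where "b = binom_coeff \<mu>"
  have sb: "summable (\<lambda>k. norm (b k * x ^ k))" if "norm x < 1" for x
    using summable_norm_binom_coeff[of "norm x" \<mu>] that by (simp add: b_def norm_mult norm_power)
  have e1: "norm (exp (\<i> * of_real t)) = 1" "norm (exp (- \<i> * of_real t)) = 1" for t
    by (simp_all add: norm_exp_eq_Re)
  have ser: "1 / (1 - x * e) powr \<mu> = (\<Sum>k. b k * x ^ k * e ^ k)" if "norm x < 1" "norm e = 1" for x e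
    using binom_coeff_sums[of "x * e" \<mu>] that
    by (simp add: b_def norm_mult sums_iff power_mult_distrib mult_ac)
  have nz: "1 - x * e \<notin> \<real>\<^sub>\<le>\<^sub>0" if "norm x < 1" "norm e = 1" for x e :: complex
    using subsetD[OF ball_subset_slit, of "x * e"] slit_iff[of "x * e"] that by (simp add: norm_mult)
  define g where "g t = exp (\<i> * of_nat N * of_real t) / (1 - z * exp (- \<i> * of_real t)) powr \<mu>" for t :: real
  have cont_g: "continuous_on {0..2*pi} (\<lambda>t. 1 / (1 - z * exp (- \<i> * of_real t)) powr \<mu>)"
  proof -
    have "continuous_on (- \<real>\<^sub>\<le>\<^sub>0) (\<lambda>y. y powr \<mu>)"
      by (intro continuous_at_imp_continuous_on ballI DERIV_isCont[OF has_field_derivative_powr]) auto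
    hence "continuous_on {0..2*pi} (\<lambda>t. (1 - z * exp (- \<i> * of_real t)) powr \<mu>)"
      by (rule continuous_on_compose2) (use nz[OF zw(1) e1(2)] in \<open>auto intro!: continuous_intros\<close>)
    moreover have "1 - z * exp (- \<i> * of_real t) \<noteq> 0" for t
      using nz[OF zw(1) e1(2), of t] by (metis nonpos_Reals_zero_I)
    ultimately show ?thesis by (intro continuous_on_divide continuous_on_const) (auto simp: powr_def)
  qed
  have inner: "integral {0..2*pi} (\<lambda>t. exp (\<i> * of_real t) ^ k * g t) = 2 * of_real pi * (b (k + N) * z ^ (k + N))" for k
  proof -
    define m where "m = k + N"
    have A: "(\<lambda>t. (\<Sum>j. b j * z ^ j * exp (- \<i> * of_real t) ^ j) * exp (\<i> * of_real t) ^ m) = (\<lambda>t. exp (\<i> * of_real t) ^ k * g t)"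
    proof
      fix t
      have "exp (\<i> * of_nat N * of_real t) = exp (\<i> * of_real t) ^ N"
        by (simp add: exp_of_nat_mult[symmetric] mult_ac)
      thus "(\<Sum>j. b j * z ^ j * exp (- \<i> * of_real t) ^ j) * exp (\<i> * of_real t) ^ m = exp (\<i> * of_real t) ^ k * g t"
        unfolding ser[OF zw(1) e1(2), symmetric] g_def m_def by (simp add: power_add mult_ac)
    qed
    have B: "(\<lambda>t. exp (- \<i> * of_real t) ^ j * exp (\<i> * of_real t) ^ m) = (\<lambda>t. exp (\<i> * of_int (int m - int j) * of_real t))" for j
    proof
      fix t
      have "exp (- \<i> * of_real t) ^ j * exp (\<i> * of_real t) ^ m = exp (of_nat j * (- \<i> * of_real t) + of_nat m * (\<i> * of_real t))"
        by (simp only: exp_of_nat_mult exp_add)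
      thus "exp (- \<i> * of_real t) ^ j * exp (\<i> * of_real t) ^ m = exp (\<i> * of_int (int m - int j) * of_real t)"
        by (simp add: algebra_simps)
    qed
    have "(\<lambda>j. b j * z ^ j * integral {0..2*pi} (\<lambda>t. exp (- \<i> * of_real t) ^ j * exp (\<i> * of_real t) ^ m)) sums
       integral {0..2*pi} (\<lambda>t. (\<Sum>j. b j * z ^ j * exp (- \<i> * of_real t) ^ j) * exp (\<i> * of_real t) ^ m)"
      by (rule integral_series_sums[OF sb[OF zw(1)]]) (auto simp: norm_power e1 intro!: continuous_intros)
    hence "(\<lambda>j. b j * z ^ j * (if int m - int j = 0 then 2 * of_real pi else 0)) sums
       integral {0..2*pi} (\<lambda>t. exp (\<i> * of_real t) ^ k * g t)"
      unfolding A B integral_exp_int .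
    also have "(\<lambda>j. b j * z ^ j * (if int m - int j = 0 then 2 * of_real pi else 0)) =
       (\<lambda>j. if j = m then 2 * of_real pi * (b m * z ^ m) else 0)" by (auto simp: fun_eq_iff)
    finally have "(\<lambda>j. if j = m then 2 * of_real pi * (b m * z ^ m) else 0) sums integral {0..2*pi} (\<lambda>t. exp (\<i> * of_real t) ^ k * g t)" .
    thus ?thesis using sums_unique2[OF sums_single[of m "\<lambda>_. 2 * of_real pi * (b m * z ^ m)"]] by (simp add: m_def)
  qed
  have "(\<lambda>k. b k * w ^ k * integral {0..2*pi} (\<lambda>t. exp (\<i> * of_real t) ^ k * g t)) sums
     integral {0..2*pi} (\<lambda>t. (\<Sum>k. b k * w ^ k * exp (\<i> * of_real t) ^ k) * g t)"
  proof (rule integral_series_sums[OF sb[OF zw(2)]])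
    have "continuous_on {0..2*pi} (\<lambda>t. exp (\<i> * of_nat N * of_real t) * (1 / (1 - z * exp (- \<i> * of_real t)) powr \<mu>))"
      by (intro continuous_on_mult cont_g) (auto intro!: continuous_intros)
    thus "continuous_on {0..2*pi} g" by (simp add: g_def[abs_def])
  qed (auto simp: norm_power e1 intro!: continuous_intros)
  also have "(\<lambda>t. (\<Sum>k. b k * w ^ k * exp (\<i> * of_real t) ^ k) * g t) = (\<lambda>t. exp (\<i> * of_nat N * of_real t) /
       ((1 - z * exp (- \<i> * of_real t)) powr \<mu> * (1 - w * exp (\<i> * of_real t)) powr \<mu>))"
    unfolding ser[OF zw(2) e1(1), symmetric] g_def by (simp add: mult_ac)
  finally have "(\<lambda>k. 2 * of_real pi * z ^ N * (b k * b (k + N) * (z * w) ^ k)) sums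
     integral {0..2*pi} (\<lambda>t. exp (\<i> * of_nat N * of_real t) /
       ((1 - z * exp (- \<i> * of_real t)) powr \<mu> * (1 - w * exp (\<i> * of_real t)) powr \<mu>))"
    unfolding inner by (simp add: power_add power_mult_distrib mult_ac)
  moreover have "(\<lambda>k. 2 * of_real pi * z ^ N * (b k * b (k + N) * (z * w) ^ k)) sums
     (2 * of_real pi * z ^ N * poisson_series \<mu> N (z * w))"
  proof (rule sums_mult)
    have "norm z * norm w < 1" using mult_strict_mono'[OF zw] by simp
    hence "ereal (norm (z * w)) < conv_radius (\<lambda>k. binom_coeff \<mu> k * binom_coeff \<mu> (k + N))"
      by (intro less_le_trans[OF _ poisson_series_radius]) (simp add: norm_mult)
    thus "(\<lambda>k. b k * b (k + N) * (z * w) ^ k) sums poisson_series \<mu> N (z * w)"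
      unfolding poisson_series_def b_def by (intro summable_sums summable_in_conv_radius)
  qed
  ultimately show ?thesis by (rule sums_unique2)
qed

text \<open>Substituting 2 pi - t for t exchanges exp (i t) and exp (-i t), and with them z and
  w.\<close>

lemma poisson_mode_bidisk_swap:
  "poisson_mode_bidisk \<mu> n z w = poisson_mode_bidisk \<mu> (- n) w z"
proof -
  define F where "F t = exp (\<i> * of_int n * of_real t) /
       ((1 - w * exp (- \<i> * of_real t)) powr \<mu> * (1 - z * exp (\<i> * of_real t)) powr \<mu>)" for t :: real
  have per: "exp (\<i> * (2 * of_real pi - of_real t)) = exp (- \<i> * of_real t)"
     "exp (- \<i> * (2 * of_real pi - of_real t)) = exp (\<i> * of_real t)" 
     "exp (\<i> * of_int n * (2 * of_real pi - of_real t)) = exp (- \<i> * of_int n * of_real t)" for t :: real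
  proof -
    have "exp (\<i> * of_int k * (2 * of_real pi - of_real t)) = exp (- \<i> * of_int k * of_real t)" for k
    proof -
      have "exp (\<i> * of_int k * (2 * of_real pi - of_real t)) = exp (2 * of_int k * of_real pi * \<i>) * exp (- \<i> * of_int k * of_real t)"
        unfolding exp_add[symmetric] by (simp add: algebra_simps)
      thus ?thesis using exp_integer_2pi[of "of_int k"] by (simp add: mult_ac)
    qed
    from this[of 1] this[of "-1"] this[of n] show
     "exp (\<i> * (2 * of_real pi - of_real t)) = exp (- \<i> * of_real t)"
     "exp (- \<i> * (2 * of_real pi - of_real t)) = exp (\<i> * of_real t)" 
     "exp (\<i> * of_int n * (2 * of_real pi - of_real t)) = exp (- \<i> * of_int n * of_real t)" by simp_all
  qed
  have "integral {0..2*pi} F = integral {0..2*pi} (\<lambda>t. F (2 * pi - t))"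
    using Henstock_Kurzweil_Integration.integral_reflect_real[of 0 "- (2*pi)" "\<lambda>t. F (2 * pi + t)"]
      integral_shift_Icc_real[of "- (2*pi)" 0 F "2*pi"] by (simp add: o_def)
  also have "(\<lambda>t. F (2 * pi - t)) = (\<lambda>t. exp (- \<i> * of_int n * of_real t) /
       ((1 - z * exp (- \<i> * of_real t)) powr \<mu> * (1 - w * exp (\<i> * of_real t)) powr \<mu>))"
    unfolding F_def of_real_diff of_real_mult of_real_numeral per by (simp add: mult_ac)
  finally show ?thesis by (simp add: poisson_mode_bidisk_def F_def[abs_def] mult.commute)
qed

text \<open>The sign of the index is reversed because the factor exp (i N t) in the integral, which
  selects z^N, belongs to the mode of index -N.\<close>

theorem poisson_mode_bidisk_eq:
  assumes zw: "norm z < 1" "norm w < 1"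
  shows "poisson_mode_bidisk \<mu> (- n) z w =
    binom_coeff \<mu> (nat \<bar>n\<bar>) * radial_mode n (\<mu> * (\<mu> - 1)) (z, w)"
proof -
  have *: "poisson_mode_bidisk \<mu> (- int N) z w = binom_coeff \<mu> N * (z ^ N * hyp_fun N (\<mu> * (\<mu> - 1)) (pfaff (z * w)))"
    if "norm z < 1" "norm w < 1" for N z w
  proof -
    have "norm z * norm w < 1" using mult_strict_mono'[OF that] by simp
    hence "z * w \<in> ball 0 1" by (simp add: norm_mult)
    from poisson_radial[OF this, of \<mu> N] show ?thesis
      using poisson_integral[OF that, of N \<mu>] by (simp add: poisson_mode_bidisk_def)
  qed
  show ?thesis
  proof (cases "n \<ge> 0")
    case True
    thus ?thesis using *[OF zw, of "nat n"] by (simp add: radial_mode_def mono2_def)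
  next
    case False
    thus ?thesis using *[OF zw(2,1), of "nat (- n)"] poisson_mode_bidisk_swap[of \<mu> "- n" z w]
      by (simp add: radial_mode_def mono2_def mult.commute)
  qed
qed

section \<open>Domains and extensions\<close>

lemma std_param_in_Omega_star: "std_param (z, w) \<in> Omega_star \<longleftrightarrow> z * w \<in> slit"
  by (auto simp: std_param_def Omega_star_def slit_def)

lemma Omega_star_eq: "Omega_star = std_param ` {q. fst q * snd q \<in> slit}"
  by (force simp: std_param_def Omega_star_def slit_def)

lemma Omega_star_subset_Omega: "Omega_star \<subseteq> Omega"
  unfolding Omega_star_eq by (auto simp: std_param_in_Omega)

lemma openin_Omega_star: "openin sphere2_top Omega_star"
  unfolding Omega_star_eq
proof (rule openin_std_param_image)
  have "{q. fst q * snd q \<in> slit} = (\<lambda>q::complex \<times> complex. fst q * snd q) -` slit" by auto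
  thus "open {q::complex \<times> complex. fst q * snd q \<in> slit}"
    by (simp only:) (intro open_vimage open_slit continuous_intros)
qed

lemma vimage_Omega: "std_param -` Omega = {q. fst q * snd q \<noteq> 1}" "flip_param -` Omega = {q. fst q * snd q \<noteq> 1}"
  by (simp_all add: set_eq_iff std_param_in_Omega flip_param_in_Omega)

lemma vimage_Omega_plus: "std_param -` Omega_plus = {q. fst q * snd q \<noteq> 1}"
  "flip_param -` Omega_plus = {q. fst q * snd q \<noteq> 1 \<and> fst q \<noteq> 0}"
  using vimage_Omega by (auto simp: Omega_plus_def std_param_def flip_param_def set_eq_iff split: if_splits)

lemma vimage_Omega_minus: "std_param -` Omega_minus = {q. fst q * snd q \<noteq> 1}"
  "flip_param -` Omega_minus = {q. fst q * snd q \<noteq> 1 \<and> snd q \<noteq> 0}"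
  using vimage_Omega by (auto simp: Omega_minus_def std_param_def flip_param_def set_eq_iff split: if_splits)

lemma not_in_Omega_plus:
  assumes "q \<in> Omega" "q \<notin> Omega_plus"
  obtains v where "q = flip_param (0, v)"
  using assms(1)
proof (rule Omega_charts)
  fix q' assume "q = std_param q'"
  thus ?thesis using assms vimage_Omega(1) vimage_Omega_plus(1) by blast
next
  fix u v assume "q = flip_param (u, v)"
  moreover have "u = 0"
    using assms \<open>q = flip_param (u, v)\<close> vimage_Omega(2) vimage_Omega_plus(2) by (auto simp: set_eq_iff)
  ultimately show ?thesis using that by blast
qed

lemma not_in_Omega_minus:
  assumes "q \<in> Omega" "q \<notin> Omega_minus"
  obtains u where "q = flip_param (u, 0)"
  using assms(1)
proof (rule Omega_charts)
  fix q' assume "q = std_param q'"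
  thus ?thesis using assms vimage_Omega(1) vimage_Omega_minus(1) by blast
next
  fix u v assume "q = flip_param (u, v)"
  moreover have "v = 0"
    using assms \<open>q = flip_param (u, v)\<close> vimage_Omega(2) vimage_Omega_minus(2) by (auto simp: set_eq_iff)
  ultimately show ?thesis using that by blast
qed

lemma openin_Omegas:
  "openin sphere2_top Omega" "openin sphere2_top Omega_plus" "openin sphere2_top Omega_minus"
proof -
  have o: "open {q::complex \<times> complex. fst q * snd q \<noteq> 1}" "open {q::complex \<times> complex. fst q \<noteq> 0}"
    "open {q::complex \<times> complex. snd q \<noteq> 0}"
    by (intro open_Collect_neq continuous_intros)+
  have c: "{q. P q \<and> Q q} = {q. P q} \<inter> {q. Q q}" for P Q :: "complex \<times> complex \<Rightarrow> bool" by auto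
  have s: "Omega_plus \<subseteq> Omega" "Omega_minus \<subseteq> Omega" by (auto simp: Omega_plus_def Omega_minus_def)
  show "openin sphere2_top Omega"
    by (subst openin_sphere2_iff) (auto simp: vimage_Omega o)
  show "openin sphere2_top Omega_plus"
    by (subst openin_sphere2_iff[OF s(1)]) (auto simp only: vimage_Omega_plus c o intro!: open_Int)
  show "openin sphere2_top Omega_minus"
    by (subst openin_sphere2_iff[OF s(2)]) (auto simp only: vimage_Omega_minus c o intro!: open_Int)
qed

text \<open>Scaling both coordinates by t scales their product by t^2, so starlikeness of
  \<open>slit\<close> carries over.\<close>

lemma connectedin_Omega_star: "connectedin sphere2_top Omega_star"
proof -
  have "starlike {q::complex \<times> complex. fst q * snd q \<in> slit}"
    unfolding starlike_def
  proof (intro bexI[of _ "(0, 0)"] ballI subsetI)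
    fix p q :: "complex \<times> complex"
    assume p: "p \<in> {q. fst q * snd q \<in> slit}" and "q \<in> closed_segment (0, 0) p"
    then obtain t where t: "0 \<le> t" "t \<le> 1" "q = t *\<^sub>R p"
      by (auto simp: closed_segment_def zero_prod_def[symmetric])
    have "fst q * snd q = complex_of_real (t * t) * (fst p * snd p)"
      unfolding t(3) by (simp add: scaleR_conv_of_real)
    moreover have "t * t \<le> 1" using t by (simp add: mult_le_one)
    ultimately show "q \<in> {q. fst q * snd q \<in> slit}"
      using starlike_slit[of "t * t" "fst p * snd p"] p t by simp
  qed auto
  hence "connectedin euclidean {q::complex \<times> complex. fst q * snd q \<in> slit}"
    by (simp add: starlike_imp_connected)
  thus ?thesis
    unfolding Omega_star_eq by (rule connectedin_continuous_map_image[OF continuous_std_param])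
qed

lemma Im_inverse_nonzero: "Im x \<noteq> 0 \<Longrightarrow> Im (inverse x) \<noteq> 0"
  using Reals_inverse[of "inverse x"] by (auto simp: complex_is_Real_iff)

lemma openin_meets_Omega_star:
  assumes V: "openin sphere2_top V" "p \<in> V" "p \<in> Omega"
  obtains z w where "std_param (z, w) \<in> V" "Im (z * w) \<noteq> 0"
  using V(3)
proof (rule Omega_charts)
  fix q assume "p = std_param q"
  hence ne: "std_param -` V \<noteq> {}" using V(2) by auto
  obtain u v where "(u, v) \<in> std_param -` V" "Im (u * v) \<noteq> 0"
    by (rule open_meets_nonreal[OF open_std_vimage[OF V(1)] ne])
  thus ?thesis using that by blast
next
  fix u v assume "p = flip_param (u, v)"
  hence ne: "flip_param -` V \<noteq> {}" using V(2) by auto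
  obtain u v where uv: "(u, v) \<in> flip_param -` V" "Im (u * v) \<noteq> 0"
    by (rule open_meets_nonreal[OF open_flip_vimage[OF V(1)] ne])
  have nz: "u \<noteq> 0" "v \<noteq> 0" using uv(2) by auto
  have "std_param (1 / v, 1 / u) \<in> V" using uv(1) nz by (simp add: flip_param_eq_std)
  moreover have "Im (1 / v * (1 / u)) \<noteq> 0"
    using Im_inverse_nonzero[OF uv(2)] by (simp only: inverse_eq_divide times_divide_times_eq mult_1 mult.commute not_False_eq_True)
  ultimately show ?thesis using that by blast
qed

text \<open>Points with nonreal product are dense, so \<open>Omega\<close> lies in the closure of
  the connected set \<open>Omega_star\<close>; every set in between is connected.\<close>

lemma subdomain_intermediate:
  assumes "Omega_star \<subseteq> T" "T \<subseteq> Omega" "openin sphere2_top T"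
  shows "subdomain T"
proof -
  have "Omega \<subseteq> sphere2_top closure_of Omega_star"
  proof
    fix p assume p: "p \<in> Omega"
    show "p \<in> sphere2_top closure_of Omega_star"
      unfolding in_closure_of
    proof (intro conjI allI impI)
      fix V assume V: "p \<in> V \<and> openin sphere2_top V"
      obtain z w where "std_param (z, w) \<in> V" "Im (z * w) \<noteq> 0"
        using openin_meets_Omega_star[of V p] V p by blast
      thus "\<exists>y. y \<in> Omega_star \<and> y \<in> V"
        using std_param_in_Omega_star slit_nonreal by blast
    qed simp
  qed
  hence "connectedin sphere2_top T"
    using connectedin_intermediate_closure_of[OF connectedin_Omega_star assms(1)] assms(2) by blast
  moreover have "std_param (0, 0) \<in> Omega_star" by (simp add: std_param_in_Omega_star)
  ultimately show ?thesis using assms unfolding subdomain_def by blast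
qed

lemma Omega_star_subset:
  "Omega_star \<subseteq> Omega_plus" "Omega_star \<subseteq> Omega_minus"
  using Omega_star_subset_Omega by (auto simp: Omega_star_def Omega_plus_def Omega_minus_def)

lemma subdomain_Omegas:
  "subdomain Omega_star" "subdomain Omega" "subdomain Omega_plus" "subdomain Omega_minus"
  by (intro subdomain_intermediate openin_Omega_star openin_Omegas Omega_star_subset_Omega Omega_star_subset order.refl;
      auto simp: Omega_plus_def Omega_minus_def)+

lemma bidisk_eq: "bidisk r = std_param ` (ball 0 r \<times> ball 0 r)"
  by (force simp: bidisk_def std_param_def)

lemma openin_bidisk: "openin sphere2_top (bidisk r)"
  unfolding bidisk_eq by (intro openin_std_param_image open_Times open_ball)

lemma std_param_in_bidisk: "std_param (z, w) \<in> bidisk r \<longleftrightarrow> norm z < r \<and> norm w < r"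
  by (auto simp: bidisk_def std_param_def)

lemma bidisk_subset_Omega_star: "bidisk 1 \<subseteq> Omega_star"
proof
  fix p assume "p \<in> bidisk 1"
  then obtain z w where p: "p = std_param (z, w)" "norm z < 1" "norm w < 1"
    by (auto simp: bidisk_def std_param_def)
  have "norm z * norm w < 1" using mult_strict_mono'[OF p(2,3)] by simp
  hence "z * w \<in> slit" using ball_subset_slit by (auto simp: norm_mult)
  thus "p \<in> Omega_star" by (simp add: p std_param_in_Omega_star)
qed

lemma origin_in_bidisk: "r > 0 \<Longrightarrow> sph_origin \<in> bidisk r"
  using std_param_in_bidisk[of 0 0 r] by (simp add: sph_origin_def std_param_def)

section \<open>Functions on the sphere product assembled from chart expressions\<close>

lemma holo2_at_compose_pair:
  assumes "holo2_at G (\<phi> q, \<psi> q)" "holo2_at \<phi> q" "holo2_at \<psi> q"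
  shows "holo2_at (\<lambda>q. G (\<phi> q, \<psi> q)) q"
proof -
  obtain a b c d e k where d: "(G has_derivative (\<lambda>(h, k). a * h + b * k)) (at (\<phi> q, \<psi> q))"
    "(\<phi> has_derivative (\<lambda>(h, k). c * h + d * k)) (at q)" "(\<psi> has_derivative (\<lambda>(h, k'). e * h + k * k')) (at q)"
    using assms unfolding holo2_at_def by metis
  have "((\<lambda>q. G (\<phi> q, \<psi> q)) has_derivative (\<lambda>x. case ((case x of (h, k) \<Rightarrow> c * h + d * k), (case x of (h, k') \<Rightarrow> e * h + k * k'))
     of (h, k) \<Rightarrow> a * h + b * k)) (at q)"
    by (rule has_derivative_compose[OF has_derivative_Pair[OF d(2,3)] d(1)])
  hence "((\<lambda>q. G (\<phi> q, \<psi> q)) has_derivative (\<lambda>(x, y). (a * c + b * e) * x + (a * d + b * k) * y)) (at q)"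
    by (rule has_derivative_eq_rhs) (auto simp: algebra_simps)
  thus ?thesis unfolding holo2_at_def by blast
qed

lemma holomorphic_Omega_subset: "holomorphic_Omega f A \<Longrightarrow> B \<subseteq> A \<Longrightarrow> holomorphic_Omega f B"
  unfolding holomorphic_Omega_def holomorphic2_on_def by blast

lemma holomorphic_Omega_cmult: "holomorphic_Omega f A \<Longrightarrow> holomorphic_Omega (\<lambda>p. c * f p) A"
  unfolding holomorphic_Omega_def holomorphic2_on_iff
  using holo2_at_mult[OF holo2_at_const] by (auto simp: o_def)

lemma holomorphic_Omega_cong:
  assumes "openin sphere2_top A" "\<And>p. p \<in> A \<Longrightarrow> f p = g p" "holomorphic_Omega f A"
  shows "holomorphic_Omega g A"
proof -
  have "holo2_at (g \<circ> std_param) q" if "q \<in> std_param -` A" for q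
    using assms(3) that holo2_at_cong[OF open_std_vimage[OF assms(1)] that, of "f \<circ> std_param" "g \<circ> std_param"] assms(2)
    by (auto simp: holomorphic_Omega_def holomorphic2_on_iff)
  moreover have "holo2_at (g \<circ> flip_param) q" if "q \<in> flip_param -` A" for q
    using assms(3) that holo2_at_cong[OF open_flip_vimage[OF assms(1)] that, of "f \<circ> flip_param" "g \<circ> flip_param"] assms(2)
    by (auto simp: holomorphic_Omega_def holomorphic2_on_iff)
  ultimately show ?thesis by (simp add: holomorphic_Omega_def holomorphic2_on_iff)
qed

lemma holomorphic_Omega_Un:
  "holomorphic_Omega f A \<Longrightarrow> holomorphic_Omega f B \<Longrightarrow> holomorphic_Omega f (A \<union> B)"
  unfolding holomorphic_Omega_def holomorphic2_on_def by blast

text \<open>Finite points are always read in the standard chart and the flip coordinates serve only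
  points with an infinite coordinate. Hence \<open>holomorphic_glue\<close> asks for agreement on
  the overlap.\<close>

definition glue :: "(complex \<times> complex \<Rightarrow> complex) \<Rightarrow> (complex \<times> complex \<Rightarrow> complex) \<Rightarrow> csphere \<times> csphere \<Rightarrow> complex" where
  "glue G1 G2 p = (case p of (Some z, Some w) \<Rightarrow> G1 (z, w)
     | (z, w) \<Rightarrow> G2 (the (sph_inverse w), the (sph_inverse z)))"

lemma glue_std: "glue G1 G2 (std_param q) = G1 q"
  by (simp add: glue_def std_param_def case_prod_unfold)

lemma glue_flip: "glue G1 G2 (flip_param (u, v)) = (if u \<noteq> 0 \<and> v \<noteq> 0 then G1 (1 / v, 1 / u) else G2 (u, v))"
  by (auto simp: glue_def flip_param_def)

lemma holomorphic_glue:
  assumes T: "openin sphere2_top T"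
    and G1: "\<And>q. q \<in> std_param -` T \<Longrightarrow> holo2_at G1 q"
    and G2: "\<And>q. q \<in> flip_param -` T \<Longrightarrow> holo2_at G2 q"
    and eq: "\<And>u v. (u, v) \<in> flip_param -` T \<Longrightarrow> u \<noteq> 0 \<Longrightarrow> v \<noteq> 0 \<Longrightarrow> G1 (1 / v, 1 / u) = G2 (u, v)"
  shows "holomorphic_Omega (glue G1 G2) T"
proof -
  have "holo2_at (glue G1 G2 \<circ> flip_param) q" if q: "q \<in> flip_param -` T" for q
  proof -
    have "(glue G1 G2 \<circ> flip_param) q' = G2 q'" if "q' \<in> flip_param -` T" for q'
      using that eq by (cases q') (auto simp: glue_flip)
    thus ?thesis using holo2_at_cong[OF open_flip_vimage[OF T] q, of "glue G1 G2 \<circ> flip_param" G2] G2[OF q] by blast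
  qed
  thus ?thesis using G1 by (simp add: holomorphic_Omega_def holomorphic2_on_iff o_def glue_std)
qed

lemma mono2_nonzero: "z \<noteq> 0 \<Longrightarrow> w \<noteq> 0 \<Longrightarrow> mono2 n z w \<noteq> 0"
  by (simp add: mono2_def)

lemma mono2_inverse: "mono2 n (1 / v) (1 / u) = 1 / mono2 n v u"
  by (simp add: mono2_def power_divide)

lemma mono2_mult: "mono2 n (z * a) (w * a) = mono2 n z w * a ^ nat \<bar>n\<bar>"
  by (simp add: mono2_def power_mult_distrib)

lemma holo2_at_mono2: "holo2_at \<phi> q \<Longrightarrow> holo2_at \<psi> q \<Longrightarrow> holo2_at (\<lambda>q. mono2 n (\<phi> q) (\<psi> q)) q"
  by (cases "n \<ge> 0") (auto simp: mono2_def intro: holo2_at_power)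

lemma holo2_at_prod: "holo2_at (\<lambda>q. fst q * snd q) q"
  by (intro holo2_intros)

lemma holo2_at_radial_mode:
  assumes "fst q * snd q \<in> slit"
  shows "holo2_at (radial_mode n \<kappa>) q"
proof -
  have "(hyp_fun (nat \<bar>n\<bar>) \<kappa> \<circ> pfaff) holomorphic_on slit"
    by (rule holomorphic_on_compose_gen[OF holomorphic_pfaff[OF one_notin_slit] holomorphic_hyp_fun])
       (use pfaff_in_slit in blast)
  hence "(hyp_fun (nat \<bar>n\<bar>) \<kappa> \<circ> pfaff) field_differentiable (at (fst q * snd q))"
    using holomorphic_on_imp_differentiable_at open_slit assms by blast
  hence "holo2_at (\<lambda>q. (hyp_fun (nat \<bar>n\<bar>) \<kappa> \<circ> pfaff) (fst q * snd q)) q"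
    by (rule holo2_at_compose[OF holo2_at_prod])
  hence "holo2_at (\<lambda>q. mono2 n (fst q) (snd q) * (hyp_fun (nat \<bar>n\<bar>) \<kappa> \<circ> pfaff) (fst q * snd q)) q"
    by (intro holo2_at_mult holo2_at_mono2 holo2_at_fst holo2_at_snd)
  thus ?thesis by (simp add: radial_mode_def case_prod_unfold)
qed

definition mode_star :: "int \<Rightarrow> complex \<Rightarrow> csphere \<times> csphere \<Rightarrow> complex" where
  "mode_star n \<kappa> = glue (radial_mode n \<kappa>) (\<lambda>(u, v). radial_mode n \<kappa> (1 / v, 1 / u))"

lemma mode_star_std: "mode_star n \<kappa> (std_param q) = radial_mode n \<kappa> q"
  by (simp add: mode_star_def glue_std)

lemma flip_in_Omega_star:
  assumes "flip_param (u, v) \<in> Omega_star"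
  shows "u \<noteq> 0" "v \<noteq> 0" "1 / v * (1 / u) \<in> slit"
proof -
  show uv: "u \<noteq> 0" "v \<noteq> 0" using assms by (auto simp: Omega_star_def flip_param_def split: if_splits)
  show "1 / v * (1 / u) \<in> slit"
    using assms std_param_in_Omega_star[of "1 / v" "1 / u"] flip_param_eq_std[OF uv] by simp
qed

lemma holomorphic_mode_star: "holomorphic_Omega (mode_star n \<kappa>) Omega_star"
  unfolding mode_star_def
proof (rule holomorphic_glue[OF openin_Omega_star])
  fix q assume "q \<in> std_param -` Omega_star"
  thus "holo2_at (radial_mode n \<kappa>) q"
    by (intro holo2_at_radial_mode) (cases q, simp add: std_param_in_Omega_star)
next
  fix q assume "q \<in> flip_param -` Omega_star"
  hence uv: "fst q \<noteq> 0" "snd q \<noteq> 0" "1 / snd q * (1 / fst q) \<in> slit"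
    using flip_in_Omega_star[of "fst q" "snd q"] by auto
  have "holo2_at (\<lambda>q. radial_mode n \<kappa> (1 / snd q, 1 / fst q)) q"
    by (rule holo2_at_compose_pair; (rule holo2_at_radial_mode | intro holo2_intros)) (use uv in auto)
  thus "holo2_at (\<lambda>(u, v). radial_mode n \<kappa> (1 / v, 1 / u)) q" by (simp add: case_prod_unfold)
qed auto

text \<open>The explicit function Q first shows that the choice in \<open>poisson_mode\<close> has a
  witness; the identity theorem on \<open>Omega_star\<close> then forces the chosen function to
  equal Q.\<close>

lemma poisson_mode_eq:
  assumes p: "p \<in> Omega_star"
  shows "poisson_mode \<mu> (- n) p = binom_coeff \<mu> (nat \<bar>n\<bar>) * mode_star n (\<mu> * (\<mu> - 1)) p"
proof -
  define Q where "Q p = binom_coeff \<mu> (nat \<bar>n\<bar>) * mode_star n (\<mu> * (\<mu> - 1)) p" for p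
  have std: "(Some z, Some w) = std_param (z, w)" for z w by (simp add: std_param_def)
  have Q: "holomorphic_Omega Q Omega_star"
    unfolding Q_def by (rule holomorphic_Omega_cmult[OF holomorphic_mode_star])
  have Qb: "Q (Some z, Some w) = poisson_mode_bidisk \<mu> (- n) z w" if "norm z < 1" "norm w < 1" for z w
    using poisson_mode_bidisk_eq[OF that] by (simp add: Q_def std mode_star_std)
  have P: "holomorphic_Omega (poisson_mode \<mu> (- n)) Omega_star \<and>
     (\<forall>z w. norm z < 1 \<longrightarrow> norm w < 1 \<longrightarrow> poisson_mode \<mu> (- n) (Some z, Some w) = poisson_mode_bidisk \<mu> (- n) z w)"
    unfolding poisson_mode_def
    by (rule someI[where x = Q]) (use Q Qb in blast)
  have "poisson_mode \<mu> (- n) p = Q p"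
  proof (rule holomorphic_Omega_unique[OF _ Q openin_Omega_star Omega_star_subset_Omega connectedin_Omega_star order.refl _
        openin_bidisk[of 1] _ _ p])
    show "sph_origin \<in> Omega_star" "sph_origin \<in> bidisk 1"
      using origin_in_bidisk[of 1] bidisk_subset_Omega_star by auto
    show "poisson_mode \<mu> (- n) p = Q p" if "p \<in> bidisk 1" for p
      using that P Qb by (auto simp: bidisk_def)
  qed (use P in blast)
  thus ?thesis by (simp add: Q_def)
qed

lemma mode_star_extension_unique:
  assumes g: "holomorphic_Omega g T" "\<And>p. p \<in> bidisk 1 \<Longrightarrow> g p = f p"
    and f: "holomorphic_Omega f T" and T: "subdomain T" "Omega_star \<subseteq> T" and p: "p \<in> T"
  shows "g p = f p"
proof (rule holomorphic_Omega_unique[OF g(1) f _ _ _ order.refl _ openin_bidisk[of 1] _ g(2) p])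
  show "sph_origin \<in> T" "sph_origin \<in> bidisk 1"
    using origin_in_bidisk[of 1] bidisk_subset_Omega_star T by auto
qed (use T in \<open>auto simp: subdomain_def\<close>)

text \<open>A nonzero a in A and a small t > 0 give b = t / a in B. Applied in flip coordinates, it
  yields points with z w = 1 / t > 1 near a point at infinity.\<close>

lemma open_product_real:
  fixes A B :: "complex set"
  assumes "open A" "a \<in> A" "open B" "0 \<in> B"
  obtains a b t where "a \<in> A" "b \<in> B" "a * b = complex_of_real t" "0 < t" "t < 1"
proof -
  obtain a where a: "a \<in> A" "a \<noteq> 0"
    using assms(1,2) by (metis insert_absorb not_open_singleton singletonI subset_singletonD subsetI)
  obtain e where e: "e > 0" "ball 0 e \<subseteq> B" using assms by (auto simp: open_contains_ball)
  define t where "t = min (e * norm a) 1 / 2"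
  have t: "0 < t" "t < e * norm a" "t < 1" using mult_pos_pos[OF e(1), of "norm a"] a by (auto simp: t_def min_def)
  have "complex_of_real t / a \<in> B" using t a e by (auto simp: norm_divide divide_simps)
  thus ?thesis using that[of a "complex_of_real t / a" t] a t by simp
qed

text \<open>Reduces every way of leaving \<open>Omega_star\<close> to a finite point on the cut. The
  product 1 is excluded by \<open>Omega\<close>, and a point at infinity has u v = 0, which can be
  perturbed to a small positive real number.\<close>

lemma boundary_point_real:
  assumes D: "openin sphere2_top D" "D \<subseteq> Omega" and p: "p \<in> D" "p \<notin> Omega_star"
  obtains z w x where "std_param (z, w) \<in> D" "z * w = complex_of_real x" "x > 1"
proof -
  have "p \<in> Omega" using D p by auto
  thus ?thesis
  proof (rule Omega_charts)
    fix q assume q: "p = std_param q"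
    obtain z w where zw: "q = (z, w)" by (cases q)
    have "z * w \<notin> slit" "z * w \<noteq> 1"
      using p(2) \<open>p \<in> Omega\<close> unfolding q zw std_param_in_Omega_star std_param_in_Omega by auto
    then obtain x where "x \<ge> 1" "z * w = of_real x" "x \<noteq> 1" by (auto simp: slit_def)
    thus ?thesis using that[of z w x] p(1) q zw by auto
  next
    fix u v assume uv: "p = flip_param (u, v)" "u = 0 \<or> v = 0"
    have oV: "open (flip_param -` D)" by (rule open_flip_vimage[OF D(1)])
    have "(u, v) \<in> flip_param -` D" using p uv by auto
    then obtain A B where AB: "open A" "open B" "u \<in> A" "v \<in> B" "A \<times> B \<subseteq> flip_param -` D"
      using open_prod_elim[OF oV] by (metis mem_Sigma_iff)
    have "\<exists>a b t. a \<in> A \<and> b \<in> B \<and> a * b = complex_of_real t \<and> 0 < t \<and> t < 1"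
    proof (cases "v = 0")
      case True
      thus ?thesis using open_product_real[OF AB(1,3,2)] AB(4) by metis
    next
      case False
      thus ?thesis using open_product_real[OF AB(2,4,1)] AB(3) uv(2) by (metis mult.commute)
    qed
    then obtain a b t where abt: "a \<in> A" "b \<in> B" "a * b = complex_of_real t" "0 < t" "t < 1" by blast
    have nz: "a \<noteq> 0" "b \<noteq> 0" using abt by auto
    have "std_param (1 / b, 1 / a) \<in> D" using abt AB nz by (auto simp flip: flip_param_eq_std)
    moreover have "1 / b * (1 / a) = complex_of_real (1 / t)"
      using abt(3) by (simp add: mult.commute)
    ultimately show ?thesis using that abt by (metis less_divide_eq_1_pos)
  qed
qed

section \<open>Maximal domains of existence\<close>

lemma isCont_zero_limit:
  fixes \<phi> :: "complex \<times> complex \<Rightarrow> complex"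
  assumes \<phi>: "isCont \<phi> p" and D: "open D" "p \<in> D"
    and zero: "\<And>u v. (u, v) \<in> D \<Longrightarrow> Im (u * v) \<noteq> 0 \<Longrightarrow> \<phi> (u, v) = 0"
  shows "\<phi> p = 0"
proof (rule ccontr)
  assume nz: "\<phi> p \<noteq> 0"
  have "(\<phi> \<longlongrightarrow> \<phi> p) (nhds p)"
    using \<phi> by (simp add: isCont_def tendsto_at_iff_tendsto_nhds)
  hence "eventually (\<lambda>q. \<phi> q \<in> - {0}) (nhds p)"
    by (rule topological_tendstoD) (use nz in auto)
  then obtain V where V: "open V" "p \<in> V" "\<And>q. q \<in> V \<Longrightarrow> \<phi> q \<noteq> 0"
    unfolding eventually_nhds by auto
  have "open (V \<inter> D)" "V \<inter> D \<noteq> {}" using V D by auto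
  then obtain u v where "(u, v) \<in> V \<inter> D" "Im (u * v) \<noteq> 0" by (rule open_meets_nonreal)
  thus False using zero V(3) by blast
qed

text \<open>A continuation across a boundary point makes \<open>K\<close> holomorphic on an annulus around
  \<open>|s| = s0\<close>, since that annulus meets the cut only near \<open>s0\<close>.\<close>

lemma hyp_fun_no_continuation:
  assumes ne: "\<And>k::int. of_int k * (of_int k - 1) \<noteq> \<kappa>"
    and s0: "s0 > 1" and e: "e > 0"
    and kk: "kk holomorphic_on ball (complex_of_real s0) e"
    and eq: "\<And>s. s \<in> ball (complex_of_real s0) e \<Longrightarrow> s \<in> slit \<Longrightarrow> kk s = hyp_fun N \<kappa> s"
  shows False
proof -
  \<comment> \<open>The bound s0 - 1 keeps the annulus outside the unit disc, as the triviality
    result on annuli requires.\<close>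
  define d where "d = min e (s0 - 1)"
  have d: "0 < d" "d \<le> e" "1 \<le> s0 - d" using e s0 by (auto simp: d_def)
  define B where "B = ball (complex_of_real s0) d"
  define A where "A = {s::complex. s0 - d < norm s \<and> norm s < s0 + d}"
  define K where "K s = (if s \<in> slit then hyp_fun N \<kappa> s else kk s)" for s
  have BK: "K s = kk s" if "s \<in> B" for s using that eq d by (auto simp: K_def B_def)
  have cover: "s \<in> slit \<or> s \<in> B" if "s \<in> A" for s
  proof (rule disjCI)
    assume "s \<notin> B"
    show "s \<in> slit"
    proof (rule ccontr)
      assume "s \<notin> slit"
      then obtain x where x: "x \<ge> 1" "s = of_real x" by (auto simp: slit_def)
      hence "\<bar>s0 - x\<bar> < d" using that by (auto simp: A_def)
      hence "s \<in> B" unfolding B_def x(2) mem_ball dist_of_real by (simp add: dist_real_def)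
      thus False using \<open>s \<notin> B\<close> by blast
    qed
  qed
  have oA: "open A" unfolding A_def by (rule open_annulus)
  have K: "K holomorphic_on A"
  proof (rule holomorphic_on_subset)
    have "K holomorphic_on slit"
      by (rule holomorphic_transform[OF holomorphic_hyp_fun[of N \<kappa>]]) (simp add: K_def)
    moreover have "kk holomorphic_on B"
      using kk by (rule holomorphic_on_subset) (use d in \<open>auto simp: B_def\<close>)
    hence "K holomorphic_on B" by (rule holomorphic_transform) (simp add: BK)
    ultimately show "K holomorphic_on slit \<union> B"
      by (intro holomorphic_on_Un open_slit) (auto simp: B_def)
  qed (use cover in blast)
  have K': "deriv K holomorphic_on A" "deriv (deriv K) holomorphic_on A"
    using K oA by (auto intro: holomorphic_deriv)
  have conn: "connected A"
    using connected_annulus(1)[where a = "0::complex" and ?r1.0 = "s0 - d" and ?r2.0 = "s0 + d"]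
    by (simp add: A_def)
  \<comment> \<open>On the side opposite to the cut, -s0 shows that the annulus meets the slit
    plane.\<close>
  have m: "complex_of_real (- s0) \<in> A \<inter> slit"
    using s0 d by (auto simp: A_def slit_def simp del: of_real_minus)
  have oAs: "open (A \<inter> slit)" by (intro open_Int oA open_slit)
  define E where "E s = s * (1 - s) * deriv (deriv K) s + (of_nat N + 1 - 2 * s) * deriv K s + \<kappa> * K s" for s
  have "E s = 0" if "s \<in> A" for s
  proof (rule analytic_continuation_open[where f = E and g = "\<lambda>_. 0" and s = "A \<inter> slit" and s' = A])
    show "A \<inter> slit \<noteq> {}" using m by blast
    show "E holomorphic_on A"
      unfolding E_def by (intro holomorphic_intros K K')
    show "E s = 0" if s: "s \<in> A \<inter> slit" for s
    proof -
      have "hyp_ode (of_nat N + 1) \<kappa> K s"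
        using hyp_ode_hyp_fun[of s N \<kappa>] hyp_ode_cong[OF open_slit, of s K "hyp_fun N \<kappa>"] s by (simp add: K_def)
      thus ?thesis by (simp add: hyp_ode_def E_def)
    qed
  qed (use oA oAs conn that in auto)
  hence "hyp_ode (of_nat N + 1) \<kappa> K s" if "s0 - d < norm s" "norm s < s0 + d" for s
    using that by (auto simp: hyp_ode_def E_def A_def)
  from hyp_ode_annulus_trivial[OF K[unfolded A_def] d(3) this ne]
  have K0: "K s = 0" if "s \<in> A" for s using that by (auto simp: A_def)
  have "hyp_fun N \<kappa> 0 = 0"
  proof (rule analytic_continuation_open[where f = "hyp_fun N \<kappa>" and g = "\<lambda>_. 0" and s = "A \<inter> slit" and s' = slit])
    show "A \<inter> slit \<noteq> {}" using m by blast
    show "hyp_fun N \<kappa> s = 0" if "s \<in> A \<inter> slit" for s using K0[of s] that by (auto simp: K_def)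
  qed (use oAs open_slit connected_slit holomorphic_hyp_fun in auto)
  thus False using hyp_fun_0 by simp
qed

text \<open>On the slice w = w0 through a boundary point on the cut, s =
  \<open>pfaff (z * w0)\<close> serves as coordinate. Dividing an extension by the monomial leaves a
  continuation of K across a real point s0 > 1.\<close>

theorem maximal_nonexceptional:
  assumes ne: "\<And>k::int. of_int k * (of_int k - 1) \<noteq> \<kappa>" and c: "c \<noteq> 0"
  shows "maximal_domain_of_existence (\<lambda>p. c * mode_star n \<kappa> p) Omega_star"
proof -
  define F where "F p = c * mode_star n \<kappa> p" for p
  have F: "holomorphic_Omega F Omega_star"
    unfolding F_def by (rule holomorphic_Omega_cmult[OF holomorphic_mode_star])
  have False if D: "subdomain D'" "Omega_star \<subset> D'" and g: "holomorphic_Omega g D'" "\<And>p. p \<in> bidisk 1 \<Longrightarrow> g p = F p" for D' g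
  proof -
    have D': "openin sphere2_top D'" "D' \<subseteq> Omega" using D by (auto simp: subdomain_def)
    have gF: "g p = F p" if "p \<in> Omega_star" for p
      by (rule mode_star_extension_unique[OF holomorphic_Omega_subset[OF g(1)] g(2) F subdomain_Omegas(1) order.refl that])
         (use D in auto)
    obtain p where "p \<in> D'" "p \<notin> Omega_star" using D by blast
    then obtain z0 w0 x0 where zw: "std_param (z0, w0) \<in> D'" "z0 * w0 = complex_of_real x0" "x0 > 1"
      using boundary_point_real[OF D'] by metis
    have w0: "w0 \<noteq> 0" using zw by auto
    have z0: "z0 = of_real x0 / w0" using zw(2) w0 by (simp add: field_simps)
    \<comment> \<open>The image of x0 under the involution \<open>pfaff\<close>; it exceeds 1
      because x0 does.\<close>
    define s0 where "s0 = x0 / (x0 - 1)"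
    have s0: "s0 > 1" using zw(3) by (simp add: s0_def)
    have ps0: "pfaff (of_real s0) = of_real x0"
    proof -
      have "pfaff (of_real s0) = of_real (s0 / (s0 - 1))" by (simp add: pfaff_def)
      also have "s0 / (s0 - 1) = x0" using zw(3) by (simp add: s0_def divide_simps)
      finally show ?thesis .
    qed
    define L where "L s = (pfaff s / w0, w0)" for s
    define U where "U = (- {0, 1}) \<inter> L -` (std_param -` D')"
    have "open U"
    proof -
      have "continuous_on (- {0, 1}) pfaff"
        by (intro holomorphic_on_imp_continuous_on holomorphic_pfaff) auto
      hence "continuous_on (- {0, 1}) L"
        unfolding L_def using w0 by (intro continuous_intros) auto
      thus ?thesis
        unfolding U_def by (intro continuous_open_preimage open_std_vimage D') auto
    qed
    moreover have "of_real s0 \<in> U"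
    proof -
      have "complex_of_real s0 \<noteq> 0" "complex_of_real s0 \<noteq> 1" using s0 by auto
      thus ?thesis using zw(1) z0 ps0 by (simp add: U_def L_def)
    qed
    ultimately obtain e where e: "e > 0" "ball (complex_of_real s0) e \<subseteq> U"
      by (auto simp: open_contains_ball)
    define kk where "kk s = g (std_param (pfaff s / w0, w0)) / (c * mono2 n (pfaff s / w0) w0)" for s
    have m: "mono2 n (pfaff s / w0) w0 \<noteq> 0" if "s \<in> U" for s
      using that w0 by (intro mono2_nonzero) (auto simp: U_def pfaff_def)
    have "kk holomorphic_on ball (of_real s0) e"
      unfolding holomorphic_on_def
    proof
      fix s assume "s \<in> ball (complex_of_real s0) e"
      hence s: "s \<in> U" using e by blast
      have pd: "pfaff field_differentiable (at s)"
        using holomorphic_on_imp_differentiable_at[OF holomorphic_pfaff[of "- {1}"]] s by (auto simp: U_def)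
      have ld: "(\<lambda>s. pfaff s / w0) field_differentiable (at s)"
        using pd w0 by (intro derivative_intros) auto
      have "holo2_at (g \<circ> std_param) (pfaff s / w0, w0)"
        using g(1) s by (auto simp: holomorphic_Omega_def holomorphic2_on_iff U_def L_def)
      hence "(\<lambda>s. (g \<circ> std_param) (pfaff s / w0, w0)) field_differentiable (at s)"
        by (rule holo2_at_curve[OF _ ld]) (intro derivative_intros)
      moreover have "(\<lambda>s. mono2 n (pfaff s / w0) w0) field_differentiable (at s)"
        unfolding mono2_def by (cases "n \<ge> 0") (auto intro!: derivative_intros ld)
      ultimately have "kk field_differentiable (at s)"
        unfolding kk_def[abs_def] o_def using c m[OF s] by (intro derivative_intros) auto
      thus "kk field_differentiable at s within ball (complex_of_real s0) e"
        by (rule field_differentiable_at_within)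
    qed
    moreover have "kk s = hyp_fun (nat \<bar>n\<bar>) \<kappa> s" if s: "s \<in> ball (complex_of_real s0) e" "s \<in> slit" for s
    proof -
      have sU: "s \<in> U" using s e by blast
      have "std_param (pfaff s / w0, w0) \<in> Omega_star"
        using pfaff_in_slit[OF s(2)] w0 by (simp add: std_param_in_Omega_star)
      hence "g (std_param (pfaff s / w0, w0)) = c * radial_mode n \<kappa> (pfaff s / w0, w0)"
        using gF by (simp add: F_def mode_star_std)
      also have "\<dots> = c * mono2 n (pfaff s / w0) w0 * hyp_fun (nat \<bar>n\<bar>) \<kappa> s"
        using w0 pfaff_pfaff[of s] sU by (simp add: radial_mode_def U_def)
      finally show ?thesis using c m[OF sU] by (simp add: kk_def)
    qed
    ultimately show False
      using hyp_fun_no_continuation[OF ne s0 e(1)] by blast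
  qed
  thus ?thesis
    using subdomain_Omegas(1) bidisk_subset_Omega_star F
    unfolding maximal_domain_of_existence_def extends_holomorphically_def F_def by blast
qed

section \<open>Rational modes in the exceptional case\<close>

lemma pfaff_inverse: "x \<noteq> 0 \<Longrightarrow> x \<noteq> 1 \<Longrightarrow> pfaff (1 / x) = 1 / (1 - x)"
  by (simp add: pfaff_def field_simps)

lemma holo2_at_poly_mode:
  assumes "fst q * snd q \<noteq> 1"
  shows "holo2_at (\<lambda>q. mono2 n (fst q) (snd q) * poly p (pfaff (fst q * snd q))) q"
proof -
  have "pfaff field_differentiable (at (fst q * snd q))"
    using holomorphic_on_imp_differentiable_at[OF holomorphic_pfaff[of "- {1}"]] assms by auto
  hence "holo2_at (\<lambda>q. pfaff (fst q * snd q)) q" by (rule holo2_at_compose[OF holo2_at_prod])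
  moreover have "poly p field_differentiable (at x)" for x
    using poly_DERIV field_differentiable_def by blast
  ultimately show ?thesis
    by (intro holo2_at_mult holo2_at_mono2 holo2_at_fst holo2_at_snd holo2_at_compose[where f = "poly p"])
qed

lemma holo2_at_flip_poly:
  assumes "fst q * snd q \<noteq> 1"
  shows "holo2_at (\<lambda>q. poly p (1 / (1 - fst q * snd q))) q"
proof -
  have "poly p field_differentiable (at x)" for x
    using poly_DERIV field_differentiable_def by blast
  thus ?thesis
    using assms by (intro holo2_at_compose[where f = "poly p"] holo2_intros) auto
qed

context
  fixes n :: int and \<kappa> :: complex and p :: "complex poly"
  assumes p: "\<And>s. s \<in> slit \<Longrightarrow> hyp_fun (nat \<bar>n\<bar>) \<kappa> s = poly p s"
begin

text \<open>Unlike \<open>radial_mode\<close>, this is regular at every finite point with z w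
  different from 1, including the cut.\<close>

definition poly_mode :: "complex \<times> complex \<Rightarrow> complex" where
  "poly_mode q = mono2 n (fst q) (snd q) * poly p (pfaff (fst q * snd q))"

lemma mode_star_poly: "std_param q \<in> Omega_star \<Longrightarrow> mode_star n \<kappa> (std_param q) = poly_mode q"
  using p[OF pfaff_in_slit, of "fst q * snd q"]
  by (cases q) (simp add: mode_star_std radial_mode_def poly_mode_def std_param_in_Omega_star)

text \<open>In flip coordinates s becomes 1 / (1 - u v) and the monomial becomes 1 /
  \<open>mono2 n v u\<close>. Cleared of this pole, the relation also makes sense at points at
  infinity.\<close>

lemma poly_mode_flip:
  assumes "u \<noteq> 0" "v \<noteq> 0" "u * v \<noteq> 1"
  shows "poly_mode (1 / v, 1 / u) * mono2 n v u = poly p (1 / (1 - u * v))"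
  using pfaff_inverse[of "u * v"] assms mono2_nonzero[of v u n]
  by (simp add: poly_mode_def mono2_inverse mult.commute)

lemma holo2_at_cleared:
  assumes "holo2_at g q" "fst q * snd q \<noteq> 1"
  shows "holo2_at (\<lambda>q. g q * mono2 n (snd q) (fst q) - c * poly p (1 / (1 - fst q * snd q))) q"
  by (intro holo2_at_diff holo2_at_mult holo2_at_const holo2_at_flip_poly holo2_at_mono2 holo2_at_fst holo2_at_snd assms)

lemma mode_star_extends:
  assumes T: "subdomain T" "Omega_star \<subseteq> T"
    and G2: "\<And>q. q \<in> flip_param -` T \<Longrightarrow> holo2_at G2 q"
    and eq: "\<And>u v. (u, v) \<in> flip_param -` T \<Longrightarrow> u \<noteq> 0 \<Longrightarrow> v \<noteq> 0 \<Longrightarrow> poly_mode (1 / v, 1 / u) = G2 (u, v)"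
  shows "holomorphic_Omega (glue poly_mode G2) T"
    and "q \<in> Omega_star \<Longrightarrow> glue poly_mode G2 q = mode_star n \<kappa> q"
proof -
  have TO: "T \<subseteq> Omega" "openin sphere2_top T" using T by (auto simp: subdomain_def)
  show "holomorphic_Omega (glue poly_mode G2) T"
  proof (rule holomorphic_glue[OF TO(2) _ G2 eq])
    fix q assume "q \<in> std_param -` T"
    hence "fst q * snd q \<noteq> 1" using TO(1) by (cases q) (auto simp: std_param_in_Omega[symmetric])
    thus "holo2_at poly_mode q"
      unfolding poly_mode_def[abs_def] by (rule holo2_at_poly_mode)
  qed auto
  show "glue poly_mode G2 q = mode_star n \<kappa> q" if "q \<in> Omega_star"
    using that mode_star_poly unfolding Omega_star_eq by (auto simp: glue_std std_param_in_Omega_star)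
qed

text \<open>In flip coordinates 1 - s = - u v / (1 - u v), and its |n|-th power cancels the pole of
  the monomial, leaving the monomial in - u / (1 - u v) and - v / (1 - u v). No subdomain is larger
  than \<open>Omega\<close>.\<close>

lemma maximal_inner:
  assumes N: "\<And>s. poly p s = (1 - s) ^ nat \<bar>n\<bar> * poly p' s"
  shows "maximal_domain_of_existence (\<lambda>q. c * mode_star n \<kappa> q) Omega"
proof -
  define G2 where "G2 q = mono2 n (- fst q / (1 - fst q * snd q)) (- snd q / (1 - fst q * snd q)) *
     poly p' (1 / (1 - fst q * snd q))" for q
  have ext: "holomorphic_Omega (glue poly_mode G2) Omega"
    "q \<in> Omega_star \<Longrightarrow> glue poly_mode G2 q = mode_star n \<kappa> q" for q
  proof -
    have h: "holo2_at G2 q" if "q \<in> flip_param -` Omega" for q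
    proof -
      have q: "fst q * snd q \<noteq> 1" using that by (simp add: vimage_Omega)
      have "holo2_at (\<lambda>q. (0 - fst q) / (1 - fst q * snd q)) q" "holo2_at (\<lambda>q. (0 - snd q) / (1 - fst q * snd q)) q"
        using q by (intro holo2_intros; simp)+
      thus ?thesis unfolding G2_def[abs_def]
        by (intro holo2_at_mult holo2_at_mono2 holo2_at_flip_poly q) simp_all
    qed
    have e: "poly_mode (1 / v, 1 / u) = G2 (u, v)" if "(u, v) \<in> flip_param -` Omega" "u \<noteq> 0" "v \<noteq> 0" for u v
    proof -
      have uv: "u * v \<noteq> 1" using that by (simp add: flip_param_in_Omega)
      hence nz: "1 - u * v \<noteq> 0" by simp
      have s: "pfaff (1 / v * (1 / u)) = 1 / (1 - u * v)" using pfaff_inverse[of "u * v"] that uv by (simp add: mult.commute)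
      have "1 - 1 / (1 - u * v) = - (u * v) / (1 - u * v)" using nz by (simp add: field_simps)
      hence "poly_mode (1 / v, 1 / u) = mono2 n (1 / v) (1 / u) * (- (u * v) / (1 - u * v)) ^ nat \<bar>n\<bar> * poly p' (1 / (1 - u * v))"
        by (simp add: poly_mode_def s N del: times_divide_eq_left times_divide_eq_right)
      also have "mono2 n (1 / v) (1 / u) * (- (u * v) / (1 - u * v)) ^ nat \<bar>n\<bar> =
         mono2 n (1 / v * (- (u * v) / (1 - u * v))) (1 / u * (- (u * v) / (1 - u * v)))"
        by (rule mono2_mult[symmetric])
      also have "1 / v * (- (u * v) / (1 - u * v)) = - u / (1 - u * v)" using that by simp
      also have "1 / u * (- (u * v) / (1 - u * v)) = - v / (1 - u * v)" using that by simp
      finally show ?thesis by (simp add: G2_def)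
    qed
    show "holomorphic_Omega (glue poly_mode G2) Omega"
      by (rule mode_star_extends(1)[OF subdomain_Omegas(2) Omega_star_subset_Omega h e])
    show "q \<in> Omega_star \<Longrightarrow> glue poly_mode G2 q = mode_star n \<kappa> q"
      by (rule mode_star_extends(2)[OF subdomain_Omegas(2) Omega_star_subset_Omega h e])
  qed
  have "extends_holomorphically (\<lambda>q. c * mode_star n \<kappa> q) (bidisk 1) Omega"
    unfolding extends_holomorphically_def
    by (rule exI[of _ "\<lambda>q. c * glue poly_mode G2 q"])
       (use ext bidisk_subset_Omega_star in \<open>auto intro: holomorphic_Omega_cmult\<close>)
  thus ?thesis
    using subdomain_Omegas(2) bidisk_subset_Omega_star Omega_star_subset_Omega
    unfolding maximal_domain_of_existence_def by (auto simp: subdomain_def)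
qed

text \<open>Multiplying by \<open>mono2 n v u\<close> clears the pole; at a boundary point that factor vanishes while
  \<open>p\<close> is evaluated at \<open>1\<close>.\<close>

lemma maximal_outer:
  assumes p1: "poly p 1 \<noteq> 0" and c: "c \<noteq> 0"
    and T: "subdomain T" "Omega_star \<subseteq> T"
    and Tn: "\<And>u v. flip_param (u, v) \<in> T \<Longrightarrow> mono2 n v u \<noteq> 0"
    and bd: "\<And>q. q \<in> Omega \<Longrightarrow> q \<notin> T \<Longrightarrow> \<exists>u v. q = flip_param (u, v) \<and> u * v = 0 \<and> mono2 n v u = 0"
  shows "maximal_domain_of_existence (\<lambda>q. c * mode_star n \<kappa> q) T"
proof -
  have TO: "T \<subseteq> Omega" "openin sphere2_top T" using T by (auto simp: subdomain_def)
  define G2 where "G2 q = poly p (1 / (1 - fst q * snd q)) / mono2 n (snd q) (fst q)" for q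
  have h: "holo2_at G2 q" if q: "q \<in> flip_param -` T" for q
  proof -
    have q': "fst q * snd q \<noteq> 1" using q TO by (cases q) (auto simp: flip_param_in_Omega[symmetric])
    have "mono2 n (snd q) (fst q) \<noteq> 0" using q Tn[of "fst q" "snd q"] by simp
    thus ?thesis unfolding G2_def[abs_def]
      by (intro holo2_at_divide holo2_at_flip_poly q' holo2_at_mono2 holo2_at_fst holo2_at_snd)
  qed
  have e: "poly_mode (1 / v, 1 / u) = G2 (u, v)" if "(u, v) \<in> flip_param -` T" "u \<noteq> 0" "v \<noteq> 0" for u v
  proof -
    have "u * v \<noteq> 1" using that TO by (auto simp: flip_param_in_Omega[symmetric])
    thus ?thesis using poly_mode_flip[OF that(2,3)] mono2_nonzero[OF that(3,2), of n]
      by (simp add: G2_def divide_simps)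
  qed
  define F where "F q = c * mode_star n \<kappa> q" for q
  have ext: "holomorphic_Omega (\<lambda>q. c * glue poly_mode G2 q) T" "\<And>q. q \<in> Omega_star \<Longrightarrow> c * glue poly_mode G2 q = F q"
    using mode_star_extends[OF T h e] by (auto intro: holomorphic_Omega_cmult simp: F_def)
  have False if D: "subdomain D'" "T \<subset> D'" and g: "holomorphic_Omega g D'" "\<And>p. p \<in> bidisk 1 \<Longrightarrow> g p = F p" for D' g
  proof -
    have D': "openin sphere2_top D'" "D' \<subseteq> Omega" using D by (auto simp: subdomain_def)
    have gF: "g q = F q" if "q \<in> Omega_star" for q
    proof -
      have "holomorphic_Omega F Omega_star"
        unfolding F_def by (rule holomorphic_Omega_cmult[OF holomorphic_mode_star])
      thus ?thesis
        using mode_star_extension_unique[OF holomorphic_Omega_subset[OF g(1)] g(2) _ subdomain_Omegas(1) order.refl that] D T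
        by blast
    qed
    obtain q where q: "q \<in> D'" "q \<notin> T" using D by blast
    then obtain u0 v0 where uv: "q = flip_param (u0, v0)" "u0 * v0 = 0" "mono2 n v0 u0 = 0"
      using bd D' by blast
    define \<phi> where "\<phi> q = (g \<circ> flip_param) q * mono2 n (snd q) (fst q) - c * poly p (1 / (1 - fst q * snd q))" for q
    have "\<phi> (u0, v0) = 0"
    proof (rule isCont_zero_limit)
      have "holo2_at (g \<circ> flip_param) (u0, v0)"
        using g(1) q(1) uv(1) by (auto simp: holomorphic_Omega_def holomorphic2_on_iff)
      moreover have "fst (u0, v0) * snd (u0, v0) \<noteq> 1" by (simp only: fst_conv snd_conv uv(2)) simp
      ultimately have "holo2_at \<phi> (u0, v0)"
        unfolding \<phi>_def[abs_def] by (rule holo2_at_cleared)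
      thus "isCont \<phi> (u0, v0)" by (rule continuous_holo2_at)
      show "open (flip_param -` D')" by (rule open_flip_vimage[OF D'(1)])
      show "(u0, v0) \<in> flip_param -` D'" using q uv by simp
      fix u v assume uv': "(u, v) \<in> flip_param -` D'" "Im (u * v) \<noteq> 0"
      have nz: "u \<noteq> 0" "v \<noteq> 0" using uv'(2) by auto
      have "u * v \<noteq> 1" using uv'(1) D' by (auto simp: flip_param_in_Omega[symmetric])
      have "Im (inverse (u * v)) \<noteq> 0" by (rule Im_inverse_nonzero[OF uv'(2)])
      hence "1 / v * (1 / u) \<in> slit" unfolding inverse_eq_divide by (intro slit_nonreal) (simp only: times_divide_times_eq mult_1 mult.commute not_False_eq_True)
      hence st: "std_param (1 / v, 1 / u) \<in> Omega_star" by (simp only: std_param_in_Omega_star)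
      have "(g \<circ> flip_param) (u, v) = c * poly_mode (1 / v, 1 / u)"
        using gF[OF st] mode_star_poly[OF st] nz by (simp add: F_def flip_param_eq_std)
      thus "\<phi> (u, v) = 0"
        using poly_mode_flip[OF nz \<open>u * v \<noteq> 1\<close>] by (simp add: \<phi>_def mult.assoc)
    qed
    thus False using uv p1 c by (simp add: \<phi>_def)
  qed
  moreover have "extends_holomorphically F (bidisk 1) T"
    unfolding extends_holomorphically_def
    using ext bidisk_subset_Omega_star by blast
  ultimately show ?thesis
    using T bidisk_subset_Omega_star
    unfolding maximal_domain_of_existence_def extends_holomorphically_def F_def by blast
qed

text \<open>The identity is propagated along \<open>D\<close> rather than along the possibly
  disconnected \<open>D \<inter> Omega_star\<close>. This works because \<open>poly_mode\<close> is
  single-valued across the cut. P is vacuous at points at infinity; there the cleared relation in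
  flip coordinates carries the argument.\<close>

lemma eigenfunction_eq_mode_star:
  assumes D: "subdomain D" "sph_origin \<in> D" and f: "holomorphic_Omega f D"
    and loc: "\<delta> > 0" "bidisk \<delta> \<subseteq> D" "\<And>q. q \<in> bidisk \<delta> \<Longrightarrow> q \<in> Omega_star \<Longrightarrow> f q = c * mode_star n \<kappa> q"
    and \<delta>: "\<delta> \<le> 1" and q: "q \<in> D" "q \<in> Omega_star"
  shows "f q = c * mode_star n \<kappa> q"
proof -
  have DO: "D \<subseteq> Omega" "openin sphere2_top D" "connectedin sphere2_top D" using D by (auto simp: subdomain_def)
  define P where "P q = (\<forall>z w. q = std_param (z, w) \<longrightarrow> f q = c * poly_mode (z, w))" for q
  have inj: "std_param a = std_param b \<longleftrightarrow> a = b" for a b by (auto simp: std_param_def split: prod.splits)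
  have bd: "bidisk \<delta> \<subseteq> Omega_star"
    using bidisk_subset_Omega_star \<delta> by (force simp: bidisk_def)
  have Pst: "P (std_param q) \<longleftrightarrow> f (std_param q) = c * poly_mode q" for q
    by (cases q) (auto simp: P_def inj)
  have "P q"
  proof (rule sphere_propagation[OF DO(2,1,3) order.refl, where x = sph_origin and V = "bidisk \<delta>"
      and ?G1.0 = "\<lambda>q. (f \<circ> std_param) q - c * poly_mode q"
      and ?G2.0 = "\<lambda>q. (f \<circ> flip_param) q * mono2 n (snd q) (fst q) - c * poly p (1 / (1 - fst q * snd q))"])
    show "holomorphic2_on (\<lambda>q. (f \<circ> std_param) q - c * poly_mode q) (std_param -` D)"
      unfolding holomorphic2_on_iff
    proof
      fix q assume q: "q \<in> std_param -` D"
      have "fst q * snd q \<noteq> 1" using q DO(1) by (cases q) (auto simp: std_param_in_Omega[symmetric])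
      moreover have "holo2_at (f \<circ> std_param) q" using f q by (simp add: holomorphic_Omega_def holomorphic2_on_iff)
      ultimately show "holo2_at (\<lambda>q. (f \<circ> std_param) q - c * poly_mode q) q"
        unfolding poly_mode_def by (intro holo2_at_diff holo2_at_mult[of "\<lambda>_. c"] holo2_at_const holo2_at_poly_mode)
    qed
    show "holomorphic2_on (\<lambda>q. (f \<circ> flip_param) q * mono2 n (snd q) (fst q) - c * poly p (1 / (1 - fst q * snd q))) (flip_param -` D)"
      unfolding holomorphic2_on_iff
    proof
      fix q assume q: "q \<in> flip_param -` D"
      have "fst q * snd q \<noteq> 1" using q DO(1) by (cases q) (auto simp: flip_param_in_Omega[symmetric])
      moreover have "holo2_at (f \<circ> flip_param) q" using f q by (simp add: holomorphic_Omega_def holomorphic2_on_iff)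
      ultimately show "holo2_at (\<lambda>q. (f \<circ> flip_param) q * mono2 n (snd q) (fst q) - c * poly p (1 / (1 - fst q * snd q))) q"
        by (intro holo2_at_cleared)
    qed
    \<comment> \<open>Where u and v are nonzero, the detecting function is the difference of f and
      the mode multiplied by the nonzero monomial.\<close>
    have key: "(f \<circ> flip_param) (u, v) * mono2 n v u - c * poly p (1 / (1 - u * v)) = 0 \<longleftrightarrow> P (flip_param (u, v))"
      if "flip_param (u, v) \<in> D" "u \<noteq> 0" "v \<noteq> 0" for u v
    proof -
      have uv: "u * v \<noteq> 1" using that DO(1) by (auto simp: flip_param_in_Omega[symmetric])
      show ?thesis
        unfolding poly_mode_flip[OF that(2,3) uv, symmetric] o_def flip_param_eq_std[OF that(2,3)] Pst
        using mono2_nonzero[OF that(3,2), of n] by (simp flip: mult.assoc)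
    qed
    fix q
    show "q \<in> std_param -` D \<Longrightarrow> ((f \<circ> std_param) q - c * poly_mode q = 0) = P (std_param q)"
      by (simp add: Pst)
    assume q: "q \<in> flip_param -` D"
    obtain u v where q': "q = (u, v)" by (cases q)
    {
      assume z: "(f \<circ> flip_param) q * mono2 n (snd q) (fst q) - c * poly p (1 / (1 - fst q * snd q)) = 0"
      show "P (flip_param q)"
      proof (cases "u = 0 \<or> v = 0")
        case True
        thus ?thesis unfolding P_def q' by (auto simp: flip_param_def std_param_def)
      next
        case False
        thus ?thesis using key[of u v] z q unfolding q' by simp
      qed
    next
      assume im: "Im (fst q * snd q) \<noteq> 0" and P: "P (flip_param q)"
      have "u \<noteq> 0" "v \<noteq> 0" using im by (auto simp: q')
      thus "(f \<circ> flip_param) q * mono2 n (snd q) (fst q) - c * poly p (1 / (1 - fst q * snd q)) = 0"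
        using key[of u v] q P unfolding q' by simp
    }
  next
    fix q assume q: "q \<in> bidisk \<delta>"
    then obtain a where a: "q = std_param a" by (auto simp: bidisk_eq)
    thus "P q" using loc(3)[OF q] bd q mode_star_poly[of a] Pst by auto
  qed (use D loc origin_in_bidisk openin_bidisk q in auto)
  moreover obtain a where "q = std_param a" using q(2) by (auto simp: Omega_star_eq)
  ultimately show ?thesis using q(2) Pst mode_star_poly by auto
qed

end

section \<open>Assembling the theorem\<close>

lemma exceptional_index:
  fixes lam \<kappa> :: complex
  assumes "lam = 4 * of_nat m * (of_nat m + 1)" "lam = 4 * \<kappa>"
  shows "\<kappa> = of_nat m * (of_nat m + 1)"
  using assms by simp

text \<open>The products k (k - 1) over the integers are the products m (m + 1) over the naturals: m
  = k - 1 for k \<ge> 1 and m = -k otherwise.\<close>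

lemma nonexceptional_index:
  assumes ne: "\<not> exceptional lam" and lam: "lam = 4 * \<kappa>"
  shows "of_int k * (of_int k - 1) \<noteq> \<kappa>"
proof
  assume k: "of_int k * (of_int k - 1) = \<kappa>"
  have "\<exists>m::nat. of_int k * (of_int k - 1) = (of_nat m * (of_nat m + 1) :: complex)"
  proof (cases "k \<ge> 1")
    case True
    hence "of_int k = (of_nat (nat (k - 1)) + 1 :: complex)" by simp
    thus ?thesis by (intro exI[of _ "nat (k - 1)"]) (simp add: algebra_simps)
  next
    case False
    hence "of_int k = (- of_nat (nat (- k)) :: complex)" by simp
    thus ?thesis by (intro exI[of _ "nat (- k)"]) (simp add: algebra_simps)
  qed
  thus False using ne lam k by (auto simp: exceptional_def)
qed

text \<open>Maximal domains refer to functions on the unit bidisk, which \<open>D\<close> need not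
  contain; F is the continuation to it of the germ of f at the origin. For the maximal domains f is
  assumed not to vanish identically, as the zero function extends to all of
  \<open>Omega\<close>.\<close>

theorem theorem4p2:
  fixes D :: "(csphere \<times> csphere) set" and f :: "csphere \<times> csphere \<Rightarrow> complex"
    and n :: int and lam \<mu> :: complex
  assumes "subdomain D" and "sph_origin \<in> D" and "rotationally_invariant D"
    and "holomorphic_Omega f D" and "homogeneous n f D"
    and "Delta_eigenfunction lam f D"
    and "lam = 4 * \<mu> * (\<mu> - 1)" and "Re \<mu> \<ge> 1/2"
  shows "(\<exists>c.
        (\<forall>p \<in> connected_component_of_set (subtopology sphere2_top (D \<inter> Omega_star)) sph_origin.
           f p = c * poisson_mode \<mu> (- n) p) \<and>
        (exceptional lam \<or> connectedin sphere2_top (D \<inter> Omega_star) \<longrightarrow>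
           (\<forall>p \<in> D \<inter> Omega_star. f p = c * poisson_mode \<mu> (- n) p) \<and>
           extends_holomorphically f D (D \<union> Omega_star))) \<and>
      ((\<exists>p\<in>D. f p \<noteq> 0) \<longrightarrow>
        (\<exists>F. holomorphic_Omega F (bidisk 1) \<and>
          (\<exists>r>0. bidisk r \<subseteq> D \<and> (\<forall>p \<in> bidisk r. F p = f p)) \<and>
          (\<not> exceptional lam \<longrightarrow> maximal_domain_of_existence F Omega_star) \<and>
          (\<forall>m::nat. lam = 4 * of_nat m * (of_nat m + 1) \<longrightarrow>
             (n < - int m \<longrightarrow> maximal_domain_of_existence F Omega_plus) \<and>
             (n > int m \<longrightarrow> maximal_domain_of_existence F Omega_minus) \<and>
             (\<bar>n\<bar> \<le> int m \<longrightarrow> maximal_domain_of_existence F Omega))))"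
proof -
  define \<kappa> where "\<kappa> = \<mu> * (\<mu> - 1)"
  have lam: "lam = 4 * \<kappa>" using assms(7) by (simp add: \<kappa>_def)
  have D: "D \<subseteq> Omega" "openin sphere2_top D" "connectedin sphere2_top D"
    using assms(1) by (auto simp: subdomain_def)
  obtain r where r: "r > 0" "bidisk r \<subseteq> D" "\<And>\<eta> z w. norm \<eta> = 1 \<Longrightarrow> norm z < r \<Longrightarrow> norm w < r \<Longrightarrow>
           f (Some (\<eta> * z), Some (w / \<eta>)) = \<eta> powi n * f (Some z, Some w)"
    using assms(5) unfolding homogeneous_def by blast
  have inD: "(z, w) \<in> std_param -` D" if "norm z < r" "norm w < r" for z w
    using r(2) that std_param_in_bidisk[of z w r] by blast
  have "\<exists>c \<delta>0. \<delta>0 > 0 \<and> \<delta>0 \<le> r \<and>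
    (\<forall>z w. norm z < \<delta>0 \<longrightarrow> norm w < \<delta>0 \<longrightarrow> (f \<circ> std_param) (z, w) = c * radial_mode n \<kappa> (z, w))"
  proof (rule homogeneous_eigenfunction_local[OF r(1), of "f \<circ> std_param" n \<kappa>])
    show "holo2_at (f \<circ> std_param) (z, w)" if "norm z < r" "norm w < r" for z w
      using assms(4) inD[OF that] by (simp add: holomorphic_Omega_def holomorphic2_on_iff)
    show "(f \<circ> std_param) (\<eta> * z, w / \<eta>) = \<eta> powi n * (f \<circ> std_param) (z, w)"
      if "norm \<eta> = 1" "norm z < r" "norm w < r" for \<eta> z w
      using r(3)[OF that] by (simp add: std_param_def)
    show "Delta_chart (f \<circ> std_param) (z, w) = 4 * \<kappa> * (f \<circ> std_param) (z, w)" if "norm z < r" "norm w < r" for z w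
      using assms(6) inD[OF that] by (simp add: Delta_eigenfunction_def lam)
  qed blast
  then obtain c \<delta>0 where \<delta>0: "\<delta>0 > 0" "\<delta>0 \<le> r"
    "\<And>z w. norm z < \<delta>0 \<Longrightarrow> norm w < \<delta>0 \<Longrightarrow> (f \<circ> std_param) (z, w) = c * radial_mode n \<kappa> (z, w)"
    by blast
  define \<delta> where "\<delta> = min \<delta>0 1"
  have \<delta>: "\<delta> > 0" "\<delta> \<le> 1" "\<delta> \<le> \<delta>0" using \<delta>0 by (auto simp: \<delta>_def)
  have \<delta>D: "bidisk \<delta> \<subseteq> D"
    using r(2) \<delta> \<delta>0 by (force simp: bidisk_def)
  have bOs: "bidisk \<delta> \<subseteq> Omega_star"
    using bidisk_subset_Omega_star \<delta> by (force simp: bidisk_def)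
  have loc: "f p = c * mode_star n \<kappa> p" if "p \<in> bidisk \<delta>" for p
    using that \<delta>0(3) \<delta> by (auto simp: bidisk_eq mode_star_std)
  define F where "F p = c * mode_star n \<kappa> p" for p
  have F: "holomorphic_Omega F Omega_star"
    unfolding F_def by (rule holomorphic_Omega_cmult[OF holomorphic_mode_star])
  \<comment> \<open>The Poisson mode is b times the normalised mode, so the constant of the theorem
    is c / b.\<close>
  define b where "b = binom_coeff \<mu> (nat \<bar>n\<bar>)"
  have b: "b \<noteq> 0" unfolding b_def using assms(8) by (intro binom_coeff_nonzero) linarith
  have pm: "(c / b) * poisson_mode \<mu> (- n) p = F p" if "p \<in> Omega_star" for p
    using poisson_mode_eq[OF that, of \<mu> n] b by (simp add: F_def b_def \<kappa>_def)
  have oT: "openin sphere2_top (D \<inter> Omega_star)" by (intro openin_Int D openin_Omega_star)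
  have x0: "sph_origin \<in> bidisk \<delta>" using \<delta> by (intro origin_in_bidisk)
  have conn: "f p = F p" if S: "connectedin sphere2_top S" "S \<subseteq> D \<inter> Omega_star" "sph_origin \<in> S" and p: "p \<in> S" for S p
  proof (rule holomorphic_Omega_unique[OF _ _ oT _ S(1,2,3) openin_bidisk[of \<delta>] x0 _ p])
    show "holomorphic_Omega f (D \<inter> Omega_star)" "holomorphic_Omega F (D \<inter> Omega_star)"
      using assms(4) F by (auto intro: holomorphic_Omega_subset)
  qed (use D loc in \<open>auto simp: F_def\<close>)
  have oI: "sph_origin \<in> D \<inter> Omega_star" using x0 \<delta>D bOs by blast
  have exc: "f p = F p" if "exceptional lam" "p \<in> D \<inter> Omega_star" for p
  proof -
    obtain m :: nat where "lam = 4 * of_nat m * (of_nat m + 1)" using \<open>exceptional lam\<close> by (auto simp: exceptional_def)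
    hence "\<kappa> = of_nat m * (of_nat m + 1)" using lam by (rule exceptional_index)
    then obtain p' where p': "\<And>s. s \<in> slit \<Longrightarrow> hyp_fun (nat \<bar>n\<bar>) \<kappa> s = poly p' s"
      using hyp_fun_exceptional[of \<kappa> m "nat \<bar>n\<bar>"] by blast
    show ?thesis
      unfolding F_def
      by (rule eigenfunction_eq_mode_star[OF p'(1) assms(1,2,4) \<delta>(1) \<delta>D loc \<delta>(2)]) (use that in auto)
  qed
  have part1: "\<forall>p \<in> connected_component_of_set (subtopology sphere2_top (D \<inter> Omega_star)) sph_origin.
           f p = (c / b) * poisson_mode \<mu> (- n) p"
  proof
    let ?S = "connected_component_of_set (subtopology sphere2_top (D \<inter> Omega_star)) sph_origin"
    fix p assume p: "p \<in> ?S"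
    have "connectedin (subtopology sphere2_top (D \<inter> Omega_star)) ?S"
      by (rule connectedin_connected_component_of)
    hence S: "connectedin sphere2_top ?S" "?S \<subseteq> D \<inter> Omega_star"
      by (auto simp: connectedin_subtopology)
    have "sph_origin \<in> ?S" using oI by (simp add: connected_component_of_refl)
    hence "f p = F p" using conn[OF S _ p] by blast
    also have "\<dots> = (c / b) * poisson_mode \<mu> (- n) p" using pm[of p] p S(2) by auto
    finally show "f p = (c / b) * poisson_mode \<mu> (- n) p" .
  qed
  have part2: "(\<forall>p \<in> D \<inter> Omega_star. f p = (c / b) * poisson_mode \<mu> (- n) p) \<and>
           extends_holomorphically f D (D \<union> Omega_star)"
    if "exceptional lam \<or> connectedin sphere2_top (D \<inter> Omega_star)"
  proof -
    have fF: "f p = F p" if "p \<in> D \<inter> Omega_star" for p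
      using \<open>exceptional lam \<or> _\<close> exc conn[OF _ order.refl oI] that by blast
    \<comment> \<open>Both branches agree on the overlap by \<open>fF\<close>, so g is holomorphic
      on each of the two open sets.\<close>
    define g where "g p = (if p \<in> D then f p else F p)" for p
    have "holomorphic_Omega g D"
      by (rule holomorphic_Omega_cong[OF D(2) _ assms(4)]) (simp add: g_def)
    moreover have "holomorphic_Omega g Omega_star"
      by (rule holomorphic_Omega_cong[OF openin_Omega_star _ F]) (use fF in \<open>auto simp: g_def\<close>)
    ultimately have "holomorphic_Omega g (D \<union> Omega_star)" by (rule holomorphic_Omega_Un)
    hence "extends_holomorphically f D (D \<union> Omega_star)"
      unfolding extends_holomorphically_def by (intro exI[of _ g]) (auto simp: g_def)
    moreover have "\<forall>p \<in> D \<inter> Omega_star. f p = (c / b) * poisson_mode \<mu> (- n) p"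
      using fF pm by (metis IntD2)
    ultimately show ?thesis by blast
  qed
  have part3: "\<exists>F. holomorphic_Omega F (bidisk 1) \<and>
          (\<exists>r>0. bidisk r \<subseteq> D \<and> (\<forall>p \<in> bidisk r. F p = f p)) \<and>
          (\<not> exceptional lam \<longrightarrow> maximal_domain_of_existence F Omega_star) \<and>
          (\<forall>m::nat. lam = 4 * of_nat m * (of_nat m + 1) \<longrightarrow>
             (n < - int m \<longrightarrow> maximal_domain_of_existence F Omega_plus) \<and>
             (n > int m \<longrightarrow> maximal_domain_of_existence F Omega_minus) \<and>
             (\<bar>n\<bar> \<le> int m \<longrightarrow> maximal_domain_of_existence F Omega))"
    if nz: "\<exists>p\<in>D. f p \<noteq> 0"
  proof (intro exI[of _ F] conjI allI impI)
    \<comment> \<open>If c were 0, f would vanish near the origin and hence on the connected set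
      \<open>D\<close>.\<close>
    have c: "c \<noteq> 0"
    proof
      assume c0: "c = 0"
      have z: "holomorphic_Omega (\<lambda>_. 0) D"
        by (auto simp: holomorphic_Omega_def holomorphic2_on_iff o_def intro: holo2_at_const)
      have "f p = 0" if "p \<in> D" for p
        by (rule holomorphic_Omega_unique[OF assms(4) z D(2,1,3) order.refl assms(2) openin_bidisk[of \<delta>] x0 _ that])
           (use loc c0 in simp)
      thus False using nz by blast
    qed
    show "holomorphic_Omega F (bidisk 1)"
      by (rule holomorphic_Omega_subset[OF F bidisk_subset_Omega_star])
    show "\<exists>r>0. bidisk r \<subseteq> D \<and> (\<forall>p \<in> bidisk r. F p = f p)"
      using \<delta>(1) \<delta>D loc by (intro exI[of _ \<delta>]) (auto simp: F_def)
    show "maximal_domain_of_existence F Omega_star" if "\<not> exceptional lam"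
      unfolding F_def using nonexceptional_index[OF that lam] c by (intro maximal_nonexceptional) auto
    fix m :: nat assume "lam = 4 * of_nat m * (of_nat m + 1)"
    hence "\<kappa> = of_nat m * (of_nat m + 1)" using lam by (rule exceptional_index)
    then obtain p where p: "\<And>s. s \<in> slit \<Longrightarrow> hyp_fun (nat \<bar>n\<bar>) \<kappa> s = poly p s"
      "m < nat \<bar>n\<bar> \<Longrightarrow> poly p 1 \<noteq> 0" "nat \<bar>n\<bar> \<le> m \<Longrightarrow> \<exists>p'. \<forall>s. poly p s = (1 - s) ^ nat \<bar>n\<bar> * poly p' s"
      using hyp_fun_exceptional[of \<kappa> m "nat \<bar>n\<bar>"] by blast
    show "maximal_domain_of_existence F Omega" if "\<bar>n\<bar> \<le> int m"
    proof -
      have "nat \<bar>n\<bar> \<le> m" using that by simp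
      then obtain p' where p': "\<And>s. poly p s = (1 - s) ^ nat \<bar>n\<bar> * poly p' s" using p(3) by blast
      show ?thesis unfolding F_def by (rule maximal_inner[OF p(1) p'])
    qed
    show "maximal_domain_of_existence F Omega_plus" if n: "n < - int m"
      unfolding F_def
    proof (rule maximal_outer[OF p(1) _ c subdomain_Omegas(3) Omega_star_subset(1)])
      show "poly p 1 \<noteq> 0" using p(2) n by simp
      \<comment> \<open>For n < 0 the clearing factor is a power of u = 1 / w, so the pole lies at w
        = infinity, which is exactly what \<open>Omega_plus\<close> leaves out.\<close>
      show "mono2 n v u \<noteq> 0" if "flip_param (u, v) \<in> Omega_plus" for u v
        using that n vimage_Omega_plus(2) by (auto simp: mono2_def vimage_def set_eq_iff)
      fix q assume q: "q \<in> Omega" "q \<notin> Omega_plus"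
      then obtain v where "q = flip_param (0, v)" by (rule not_in_Omega_plus)
      thus "\<exists>u v. q = flip_param (u, v) \<and> u * v = 0 \<and> mono2 n v u = 0"
        using n by (intro exI[of _ 0] exI[of _ v]) (auto simp: mono2_def)
    qed
    show "maximal_domain_of_existence F Omega_minus" if n: "n > int m"
      unfolding F_def
    proof (rule maximal_outer[OF p(1) _ c subdomain_Omegas(4) Omega_star_subset(2)])
      show "poly p 1 \<noteq> 0" using p(2) n by simp
      show "mono2 n v u \<noteq> 0" if "flip_param (u, v) \<in> Omega_minus" for u v
        using that n vimage_Omega_minus(2) by (auto simp: mono2_def vimage_def set_eq_iff)
      fix q assume q: "q \<in> Omega" "q \<notin> Omega_minus"
      then obtain u where "q = flip_param (u, 0)" by (rule not_in_Omega_minus)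
      thus "\<exists>u v. q = flip_param (u, v) \<and> u * v = 0 \<and> mono2 n v u = 0"
        using n by (intro exI[of _ u] exI[of _ 0]) (auto simp: mono2_def)
    qed
  qed
  show ?thesis
    using part1 part2 part3 by (intro conjI impI exI[of _ "c / b"]) auto
qed

end
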